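(* Let $k\ge 1$ be an integer, let $N$ be a perfect square (a positive integer), and let $f(z)=\sum_{n=1}^{\infty}a_{f}(n)e^{2\pi i n z}\in S_{k+\frac12}(\Gamma_0(4N))$. Assume that the Fourier coefficients $a_f(n)$ are either all real or all purely imaginary. For each choice of sign $\pm$, let $N_0^{\pm}(T)$ denote the number of zeros of odd order of the function $L(s,f)\pm L(s,f|W_{4N})$ of the form $s=\frac{k}{2}+\frac14+it$ with $0\le t\le T$. Then $N_0^{\pm}(T)=\Omega(T^{1/2})$; in other words, there exists some $d>0$ such that $$\limsup_{T\to\infty}\frac{N_0^{\pm}(T)}{T^{1/2}}>d.$$
   Context: $\mathbb{H}=\{w\in\mathbb{C}:\mathrm{Im}(w)>0\}$. The square root $z^{1/2}$ is chosen with $-\frac{\pi}{2}<\arg(z^{1/2})\le\frac{\pi}{2}$, and half-integral powers are $z^{k+1/2}=(z^{1/2})^{2k+1}$. $S_{k+\frac12}(\Gamma_0(4N))$ is the space of cusp forms of weight $k+\frac12$ on $\Gamma_0(4N)$: holomorphic functions $f$ on $\mathbb{H}$, vanishing at all cusps, satisfying $$f\left(\frac{az+b}{cz+d}\right)=\left(\frac{c}{d}\right)^{2k+1}\epsilon_d^{-2k-1}(cz+d)^{k+\frac12}f(z)\quad\text{for all }\begin{pmatrix}a&b\\c&d\end{pmatrix}\in\Gamma_0(4N),$$ where $\left(\frac{c}{d}\right)$ is Shimura's extension of the Jacobi symbol (for odd $d$: the Jacobi symbol $\left(\frac{c}{d}\right)$ if $d>0$; for $d<0$ and $c\neq0$,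 it is $\left(\frac{c}{|d|}\right)$ if $c>0$ and $-\left(\frac{c}{|d|}\right)$ if $c<0$; and $\left(\frac{0}{\pm1}\right)=1$), and $\epsilon_d=1$ if $d\equiv1\bmod 4$, $\epsilon_d=i$ if $d\equiv 3\bmod 4$. Such $f$ has a Fourier expansion $f(z)=\sum_{n\ge1}a_f(n)e^{2\pi i n z}$. The Fricke involution on $S_{k+\frac12}(\Gamma_0(4N))$ is $$(f|W_{4N})(z)=i^{k+\frac12}(4N)^{-\frac k2-\frac14}z^{-k-\frac12}f\left(-\frac{1}{4Nz}\right).$$ For a cusp form $g(z)=\sum_{n\ge1}a_g(n)e^{2\pi i nz}$, $L(s,g)=\sum_{n\ge1}a_g(n)n^{-s}$ for $\mathrm{Re}(s)$ large, and $L(s,g)$ also denotes its continuation to an entire function of $s$.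
   Formalization: For the chosen sign, L(s,f) ± L(s,f|W_{4N}) is assumed not identically zero; otherwise (e.g. f = 0, or f|W_{4N} = ∓f) it is the zero function, which has no zeros of odd order, and the claim fails. *)

theory Defs
  imports
    "HOL-Complex_Analysis.Complex_Analysis"
    "HOL-Number_Theory.Number_Theory"
begin

(* Throughout, half-integral powers are powers of csqrt, whose values satisfy
   -pi/2 < arg \<le> pi/2:  z^(k + 1/2) is  csqrt z powi (2 * k + 1). *)

definition upper_half_plane :: "complex set" where
  "upper_half_plane = {z. Im z > 0}"

definition Jacobi :: "int \<Rightarrow> int \<Rightarrow> int" where
  "Jacobi a n = (\<Prod>p\<in>#prime_factorization n. Legendre a p)"

(* Shimura's extension, for odd d.  For c = 0 and d = 1 or d = -1 the Jacobi symbol is an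
   empty product, so that (0/1) = (0/-1) = 1. *)
definition shimura_symbol :: "int \<Rightarrow> int \<Rightarrow> int" where
  "shimura_symbol c d = (if d < 0 \<and> c < 0 then - Jacobi c \<bar>d\<bar> else Jacobi c \<bar>d\<bar>)"

definition theta_eps :: "int \<Rightarrow> complex" where
  "theta_eps d = (if d mod 4 = 1 then 1 else \<i>)"

definition frac_lin :: "int \<Rightarrow> int \<Rightarrow> int \<Rightarrow> int \<Rightarrow> complex \<Rightarrow> complex" where
  "frac_lin a b c d z = (of_int a * z + of_int b) / (of_int c * z + of_int d)"

(* Every cusp is the image of \<infinity> under some element of SL(2,Z), so f vanishes at all cusps
   iff (cz+d)^(-k-1/2) f((az+b)/(cz+d)) tends to 0 as Im z tends to infinity, for each
   element of SL(2,Z). *)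
definition vanishes_at_cusps :: "nat \<Rightarrow> (complex \<Rightarrow> complex) \<Rightarrow> bool" where
  "vanishes_at_cusps k f \<longleftrightarrow>
     (\<forall>a b c d :: int. a * d - b * c = 1 \<longrightarrow>
        ((\<lambda>z. csqrt (of_int c * z + of_int d) powi (- 2 * int k - 1) * f (frac_lin a b c d z))
           \<longlongrightarrow> 0) (filtercomap Im at_top))"

(* Cusp forms of weight k + 1/2 on Gamma_0(M), for 4 dvd M.  Only the values of f on the upper
   half plane matter. *)
definition half_cusp_forms :: "nat \<Rightarrow> nat \<Rightarrow> (complex \<Rightarrow> complex) set" where
  "half_cusp_forms k M = {f.
     f holomorphic_on upper_half_plane \<and>
     (\<forall>a b c d :: int. a * d - b * c = 1 \<longrightarrow> int M dvd c \<longrightarrow>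
        (\<forall>z\<in>upper_half_plane.
           f (frac_lin a b c d z) =
             of_int (shimura_symbol c d) ^ (2 * k + 1) * theta_eps d powi (- 2 * int k - 1) *
             csqrt (of_int c * z + of_int d) powi (2 * int k + 1) * f z)) \<and>
     vanishes_at_cusps k f}"

(* The coefficients of the (unique) expansion over n \<ge> 1; the value at n = 0 is fixed as 0. *)
definition fourier_coeff :: "(complex \<Rightarrow> complex) \<Rightarrow> nat \<Rightarrow> complex" where
  "fourier_coeff f = (THE a. a 0 = 0 \<and>
     (\<forall>z\<in>upper_half_plane. (\<lambda>n. a n * exp (2 * of_real pi * \<i> * of_nat n * z)) sums f z))"

definition fricke :: "nat \<Rightarrow> nat \<Rightarrow> (complex \<Rightarrow> complex) \<Rightarrow> complex \<Rightarrow> complex" where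
  "fricke k M f z =
     csqrt \<i> powi (2 * int k + 1) * of_real (real M powr (- real k / 2 - 1 / 4)) *
     csqrt z powi (- 2 * int k - 1) * f (- 1 / (of_nat M * z))"

(* The entire continuation of the Dirichlet series. *)
definition L_function :: "(complex \<Rightarrow> complex) \<Rightarrow> complex \<Rightarrow> complex" where
  "L_function g = (THE F. F holomorphic_on UNIV \<and>
     (\<exists>\<sigma>::real. \<forall>s. Re s > \<sigma> \<longrightarrow>
        (\<lambda>n. fourier_coeff g (Suc n) * of_nat (Suc n) powr (- s)) sums F s))"

(* Number of distinct zeros of odd order of F on the segment from x to x + iT.
   F should not vanish identically: zorder is meaningless for the zero function. *)
definition odd_zero_count :: "(complex \<Rightarrow> complex) \<Rightarrow> real \<Rightarrow> real \<Rightarrow> nat" where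
  "odd_zero_count F x T =
     card {s. Re s = x \<and> 0 \<le> Im s \<and> Im s \<le> T \<and> F s = 0 \<and> odd (zorder F s)}"

end

theory Submission
  imports Defs "HOL-Probability.Probability"
begin

text \<open>
  Put \<open>M = 4 N = c\<^sup>2\<close>, \<open>p = k/2 + 1/4\<close> and \<open>P(u) = f(\<i> e\<^sup>u / c) e\<^bsup>p u\<^esup>\<close>. The Fricke involution acts on \<open>P\<close> by
  \<open>u \<mapsto> - u\<close>, so on the critical line \<open>L(s,f) \<plusminus> L(s,f|W)\<close> is, up to a factor without zeros, the Fourier
  transform \<open>\<Xi>(t)\<close> of \<open>\<Psi>(u) = P(u) \<plusminus> P(- u)\<close>, which is real up to a constant. The function \<open>\<Psi>\<close> is
  holomorphic in the strip \<open>|Im u| < pi/2\<close>, and as \<open>u\<close> approaches \<open>\<i> pi/2\<close> the argument of \<open>f\<close> approaches the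
  cusps \<open>\<plusminus> 1/c\<close>; these are rational because \<open>N\<close> is a square. Hence \<open>\<Psi>(v + \<i> (pi/2 - \<delta>))\<close> is
  \<open>O(exp(- const/\<delta>))\<close> for \<open>|v| \<le> \<delta>\<close>, and by a contour shift and Cauchy's inequalities the moments
  \<open>\<integral> \<Xi>(t) t\<^sup>n exp(- \<delta>\<^sup>3 t\<^sup>2 + (pi/2 - \<delta>) t) dt\<close> are at most \<open>n! (\<theta> \<delta>)\<^bsup>-n\<^esup> exp(- const/\<delta>)\<close>. If there were at
  most \<open>D \<surd>T\<close> zeros \<open>t\<^sub>j\<close> of odd order up to \<open>T\<close>, then \<open>\<Prod> (1 - t\<^sup>2/t\<^sub>j\<^sup>2)\<close> would be of size \<open>exp(O(D \<surd>t))\<close>, and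
  for small \<open>D\<close> the integral of this product against \<open>\<Xi>(t) exp(- \<delta>\<^sup>3 t\<^sup>2 + (pi/2 - \<delta>) t)\<close> would tend to \<open>0\<close> with \<open>\<delta>\<close>.
  But the integrand has constant sign, so the integral stays away from \<open>0\<close>.
\<close>

section \<open>Functions decaying faster than any exponential\<close>

text \<open>The exponent 1/2 comes from a balance in which every loss and every gain has the shape
  exp(const/d). Multiplying \<open>xi\<close> by exp(-l t^2) turns its Laplace transform at pi/2 - d
  + rho into an average of \<open>Psi\<close> over the line Im = pi/2 - d against a Gaussian of
  width about sqrt l. For l = d^3 this width is small against d: the part |v| > d contributes
  exp(-const/d), like the cusp decay, and |rho| <= theta d costs only exp(theta^2/(4 d)). A product
  of size exp(b sqrt t), tested against moments of radius theta d, costs exp(b^2/(2 theta d)), so a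
  small b loses against the cusp. A product contains only the zeros up to some T, hence the sign of
  the integrand is known for |t| < T alone. All bounds are therefore uniform in T: first T tends to
  infinity at fixed d, where the Gaussian makes the tail integrable, and only then d tends to 0. The
  factor exp((pi/2 - d) t) has no parity, so the integrand is replaced by its even part, in which
  the exponential becomes cosh or sinh.\<close>

lemma coefficient_eq_deriv_over_fact:
  fixes a :: "nat \<Rightarrow> complex"
  assumes r: "r > 0" and s: "\<And>z. z \<in> ball w r \<Longrightarrow> (\<lambda>n. a n * (z - w) ^ n) sums f z"
  shows "a n = (deriv ^^ n) f w / fact n"
proof -
  have "(\<lambda>u. f (w + u)) has_fps_expansion Abs_fps a"
  proof (rule has_fps_expansionI)
    have "eventually (\<lambda>u. u \<in> ball 0 r) (nhds (0::complex))"
      using r by (intro eventually_nhds_in_open) auto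
    then show "\<forall>\<^sub>F u in nhds 0. (\<lambda>n. fps_nth (Abs_fps a) n * u ^ n) sums f (w + u)"
    proof eventually_elim
      case (elim u)
      then show ?case using s[of "w + u"] by (simp add: dist_norm)
    qed
  qed
  then have "fps_nth (Abs_fps a) n = (deriv ^^ n) (\<lambda>u. f (w + u)) 0 / fact n"
    by (rule fps_nth_fps_expansion)
  then show ?thesis using higher_deriv_shift_0[of n f w] by (simp add: o_def add.commute)
qed

lemma power_le_fact_times_exp:
  fixes x :: real
  assumes "x \<ge> 0"
  shows "x ^ n \<le> fact n * exp x"
proof -
  have "(\<Sum>k\<in>{n}. x ^ k /\<^sub>R fact k) \<le> (\<Sum>k. x ^ k /\<^sub>R fact k)"
    using assms by (intro sum_le_suminf sums_summable[OF exp_converges]) auto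
  then show ?thesis
    using exp_converges[of x] by (simp add: sums_iff divide_simps mult.commute)
qed

lemma exp_abs_le:
  fixes t :: real and z :: complex
  shows "norm (exp (z * of_real t)) \<le> exp (norm z * \<bar>t\<bar>)"
proof -
  have "norm (exp (z * of_real t)) \<le> exp (norm (z * of_real t))" by (rule norm_exp)
  then show ?thesis by (simp add: norm_mult)
qed

text \<open>Strong enough for the Laplace transform to be entire and for every moment to exist
  against every exponential. It is used on two levels: for \<open>Psi\<close> on the real line, and
  again for the Fourier transform of \<open>Psi\<close> times a Gaussian.\<close>

locale super_exp_decay =
  fixes h :: "real \<Rightarrow> complex"
  assumes meas [measurable]: "h \<in> borel_measurable borel"
    and int: "\<And>A. integrable lborel (\<lambda>t. exp (A * \<bar>t\<bar>) * norm (h t))"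
begin

lemma integrable_power_exp:
  "integrable lborel (\<lambda>t. h t * of_real t ^ n * exp (z * of_real t))"
proof (rule Bochner_Integration.integrable_bound[where f="\<lambda>t. fact n * (exp ((norm z + 1) * \<bar>t\<bar>) * norm (h t))"])
  show "integrable lborel (\<lambda>t. fact n * (exp ((norm z + 1) * \<bar>t\<bar>) * norm (h t)))"
    using int by (rule integrable_mult_right)
  show "(\<lambda>t. h t * complex_of_real t ^ n * exp (z * complex_of_real t)) \<in> borel_measurable lborel"
    by measurable
  show "AE t in lborel. norm (h t * complex_of_real t ^ n * exp (z * complex_of_real t)) \<le>
      norm (fact n * (exp ((norm z + 1) * \<bar>t\<bar>) * norm (h t)))"
  proof (rule AE_I2)
    fix t :: real
    have 1: "\<bar>t\<bar> ^ n \<le> fact n * exp \<bar>t\<bar>"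
      by (rule power_le_fact_times_exp) simp
    have "norm (h t * complex_of_real t ^ n * exp (z * complex_of_real t)) =
      norm (h t) * (\<bar>t\<bar> ^ n * norm (exp (z * of_real t)))" by (simp add: norm_mult norm_power)
    also have "\<dots> \<le> norm (h t) * ((fact n * exp \<bar>t\<bar>) * exp (norm z * \<bar>t\<bar>))"
      by (intro mult_left_mono mult_mono 1 exp_abs_le) auto
    also have "\<dots> = norm (fact n * (exp ((norm z + 1) * \<bar>t\<bar>) * norm (h t)))"
      by (simp add: exp_add algebra_simps abs_mult)
    finally show "norm (h t * complex_of_real t ^ n * exp (z * complex_of_real t)) \<le>
      norm (fact n * (exp ((norm z + 1) * \<bar>t\<bar>) * norm (h t)))" .
  qed
qed

lemma integrable_exp: "integrable lborel (\<lambda>t. h t * exp (z * of_real t))"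
  using integrable_power_exp[of 0 z] by simp

definition laplace :: "complex \<Rightarrow> complex" where
  "laplace z = (\<integral>t. h t * exp (z * of_real t) \<partial>lborel)"

text \<open>Termwise integration of exp((z - w) t). The centre \<open>w\<close> is arbitrary because
  the moments of interest carry the weight exp(w t) with w = pi/2 - d; up to n! they are the Taylor
  coefficients of \<open>laplace\<close> at \<open>w\<close>.\<close>

lemma laplace_sums:
  "(\<lambda>n. (\<integral>t. h t * of_real t ^ n * exp (w * of_real t) \<partial>lborel) / fact n * (z - w) ^ n)
     sums laplace z"
proof -
  define f where "f = (\<lambda>n t. h t * of_real t ^ n * exp (w * of_real t) / fact n * (z - w) ^ n)"
  have fi: "integrable lborel (f n)" for n
    unfolding f_def by (intro integrable_mult_left integrable_divide integrable_power_exp)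
  have nf: "norm (f n t) = norm (h t) * norm (exp (w * of_real t)) * ((norm (z - w) * \<bar>t\<bar>) ^ n /\<^sub>R fact n)" for n t
    by (simp add: f_def norm_mult norm_divide norm_power power_mult_distrib divide_simps)
  have es: "(\<lambda>n. norm (f n t)) sums (norm (h t) * norm (exp (w * of_real t)) * exp (norm (z - w) * \<bar>t\<bar>))" for t
    unfolding nf by (intro sums_mult exp_converges)
  have fs: "(\<lambda>n. f n t) sums (h t * exp (z * of_real t))" for t
  proof -
    have "(\<lambda>n. h t * exp (w * of_real t) * (((z - w) * of_real t) ^ n /\<^sub>R fact n)) sums
       (h t * exp (w * of_real t) * exp ((z - w) * of_real t))"
      by (intro sums_mult exp_converges)
    moreover have "h t * exp (w * of_real t) * exp ((z - w) * of_real t) = h t * exp (z * of_real t)"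
      by (simp add: exp_add[symmetric] algebra_simps)
    moreover have "h t * exp (w * of_real t) * (((z - w) * of_real t) ^ n /\<^sub>R fact n) = f n t" for n
      by (simp add: f_def power_mult_distrib scaleR_conv_of_real divide_simps)
    ultimately show ?thesis by simp
  qed
  \<comment> \<open>The first summand bounds the weight exp(w t), the second the full series of
    absolute values.\<close>
  let ?A = "norm w + norm (z - w)"
  have "(\<lambda>n. integral\<^sup>L lborel (f n)) sums (\<integral>t. (\<Sum>n. f n t) \<partial>lborel)"
  proof (rule sums_integral[OF fi])
    show "AE x in lborel. summable (\<lambda>i. norm (f i x))" using es by (auto simp: sums_iff)
      show "summable (\<lambda>i. \<integral>t. norm (f i t) \<partial>lborel)"
    proof (rule bounded_imp_summable)
      show "0 \<le> (\<integral>t. norm (f i t) \<partial>lborel)" for i by simp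
      fix n
      have "(\<Sum>i\<le>n. \<integral>t. norm (f i t) \<partial>lborel) = (\<integral>t. (\<Sum>i\<le>n. norm (f i t)) \<partial>lborel)"
        using fi by (intro Bochner_Integration.integral_sum[symmetric]) auto
      also have "\<dots> \<le> (\<integral>t. exp (?A * \<bar>t\<bar>) * norm (h t) \<partial>lborel)"
      proof (rule integral_mono)
        show "integrable lborel (\<lambda>t. \<Sum>i\<le>n. norm (f i t))" using fi by auto
        fix t :: real
        have "(\<Sum>i\<le>n. norm (f i t)) \<le> norm (h t) * norm (exp (w * of_real t)) * exp (norm (z - w) * \<bar>t\<bar>)"
          using sum_le_suminf[of "\<lambda>n. norm (f n t)" "{..n}"] es[of t] by (auto simp: sums_iff)
        also have "\<dots> \<le> norm (h t) * exp (norm w * \<bar>t\<bar>) * exp (norm (z - w) * \<bar>t\<bar>)"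
          by (intro mult_left_mono mult_right_mono exp_abs_le) auto
        also have "\<dots> = exp (?A * \<bar>t\<bar>) * norm (h t)" by (simp add: exp_add algebra_simps)
        finally show "(\<Sum>i\<le>n. norm (f i t)) \<le> exp (?A * \<bar>t\<bar>) * norm (h t)" .
      qed (use int in auto)
      finally show "(\<Sum>i\<le>n. \<integral>t. norm (f i t) \<partial>lborel) \<le> (\<integral>t. exp (?A * \<bar>t\<bar>) * norm (h t) \<partial>lborel)" .
    qed
  qed
  moreover have "integral\<^sup>L lborel (f n) = (\<integral>t. h t * of_real t ^ n * exp (w * of_real t) \<partial>lborel) / fact n * (z - w) ^ n" for n
    unfolding f_def by simp
  moreover have "(\<Sum>n. f n t) = h t * exp (z * of_real t)" for t using fs[of t] by (simp add: sums_iff)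
  ultimately show ?thesis by (simp add: laplace_def)
qed

lemma laplace_holomorphic: "laplace holomorphic_on A"
proof -
  have "laplace holomorphic_on ball 0 (norm z + 1)" for z :: complex
    by (rule power_series_holomorphic[where a="\<lambda>n. (\<integral>t. h t * of_real t ^ n * exp (0 * of_real t) \<partial>lborel) / fact n"])
      (use laplace_sums[of 0] in simp)
  then have "laplace field_differentiable at z" for z
    using holomorphic_on_imp_differentiable_at[of laplace "ball 0 (norm z + 1)" z] by auto
  then show ?thesis by (auto simp: holomorphic_on_def field_differentiable_at_within)
qed

text \<open>By \<open>laplace_sums\<close> the moment is the \<open>n\<close>-th derivative of
  \<open>laplace\<close> at \<open>w\<close>, so this is Cauchy's inequality on the circle of radius
  \<open>r\<close>.\<close>

lemma moment_bound:
  assumes r: "r > 0" and B: "\<And>z. norm (w - z) = r \<Longrightarrow> norm (laplace z) \<le> B"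
  shows "norm (\<integral>t. h t * of_real t ^ n * exp (w * of_real t) \<partial>lborel) \<le> fact n * B / r ^ n"
proof -
  have "(\<integral>t. h t * of_real t ^ n * exp (w * of_real t) \<partial>lborel) / fact n = (deriv ^^ n) laplace w / fact n"
    by (rule coefficient_eq_deriv_over_fact[OF r laplace_sums])
  then have "(\<integral>t. h t * of_real t ^ n * exp (w * of_real t) \<partial>lborel) = (deriv ^^ n) laplace w"
    by simp
  moreover have "norm ((deriv ^^ n) laplace w) \<le> fact n * B / r ^ n"
    using B by (intro Cauchy_inequality r laplace_holomorphic holomorphic_on_imp_continuous_on) auto
  ultimately show ?thesis by simp
qed

end

section \<open>Gaussian integrals and products over sparse sets\<close>

lemma integrable_lborel_inverse_1_plus_square: "integrable lborel (\<lambda>x::real. 1 / (1 + x\<^sup>2))"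
  using integrable_inverse_1_plus_square
  by (simp add: set_integrable_def inverse_eq_divide)

text \<open>Cauchy's theorem for rectangles, phrased with a primitive \<open>g\<close>: the
  horizontal integrals over [-n, n] are differences of \<open>g\<close> at the corners, and each
  vertical side contributes at most K a/(1 + n^2), which tends to 0.\<close>

lemma integral_horizontal_shift:
  fixes h :: "complex \<Rightarrow> complex"
  assumes S: "open S" "convex S" "h holomorphic_on S" "{z. 0 \<le> Im z \<and> Im z \<le> a} \<subseteq> S" and a: "a \<ge> 0"
    and K: "\<And>z. 0 \<le> Im z \<Longrightarrow> Im z \<le> a \<Longrightarrow> norm (h z) \<le> K / (1 + (Re z)\<^sup>2)"
  shows "(\<integral>x. h (of_real x) \<partial>lborel) = (\<integral>x. h (of_real x + \<i> * of_real a) \<partial>lborel)"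
proof -
  let ?h = "\<lambda>b x. h (complex_of_real x + \<i> * complex_of_real b)"
  have "\<exists>g. \<forall>z\<in>S. (g has_field_derivative h z) (at z within S)"
  proof (rule holomorphic_convex_primitive'[OF S(2,1,3)])
    fix g assume g: "\<And>x. x \<in> S \<Longrightarrow> (g has_field_derivative h x) (at x within S)"
    show ?thesis by (rule exI[of _ g]) (use g in simp)
  qed
  then obtain g where g: "\<forall>z\<in>S. (g has_field_derivative h z) (at z within S)" by (rule exE)
  have g': "(g has_field_derivative h z) (at z)" if "z \<in> S" for z
    using bspec[OF g that] unfolding at_within_open[OF that S(1)] .
  define I where "I = (\<lambda>b (n::nat). \<integral>x. indicator {- real n..real n} x *\<^sub>R h (of_real x + \<i> * of_real b) \<partial>lborel)"
  have inS: "of_real x + \<i> * of_real b \<in> S" if "0 \<le> b" "b \<le> a" for b x :: real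
    using S(4) that by auto
  have conth: "continuous_on A (\<lambda>x::real. h (of_real x + \<i> * of_real b))" if "0 \<le> b" "b \<le> a" for b A
    by (rule continuous_on_compose2[OF holomorphic_on_imp_continuous_on[OF S(3)]])
      (use inS that in \<open>auto intro!: continuous_intros\<close>)
  have meas: "(\<lambda>x::real. h (of_real x + \<i> * of_real b)) \<in> borel_measurable lborel" if "0 \<le> b" "b \<le> a" for b
    using conth[OF that, of UNIV] borel_measurable_continuous_onI by (simp add: borel_measurable_continuous_onI)
  have lim: "I b \<longlonglongrightarrow> (\<integral>x. h (of_real x + \<i> * of_real b) \<partial>lborel)" if b: "0 \<le> b" "b \<le> a" for b
    unfolding I_def
  proof (rule integral_dominated_convergence[where w="\<lambda>x. \<bar>K\<bar> * (1 / (1 + x\<^sup>2))"])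
    show "(\<lambda>x. ?h b x) \<in> borel_measurable lborel" using meas b .
    then show "(\<lambda>x. indicat_real {- real i..real i} x *\<^sub>R ?h b x) \<in> borel_measurable lborel" for i
      by measurable
    show "integrable lborel (\<lambda>x. \<bar>K\<bar> * (1 / (1 + x\<^sup>2)))"
      by (intro integrable_mult_right integrable_lborel_inverse_1_plus_square)
    show "AE x in lborel. (\<lambda>i. indicat_real {- real i..real i} x *\<^sub>R ?h b x) \<longlonglongrightarrow> ?h b x"
    proof (rule AE_I2)
      fix x :: real
      obtain n where n: "real n \<ge> \<bar>x\<bar>" using real_arch_simple by blast
      have "eventually (\<lambda>i. indicat_real {- real i..real i} x *\<^sub>R ?h b x = ?h b x) sequentially"
        using eventually_ge_at_top[of n] by eventually_elim (use n in \<open>auto simp: indicator_def\<close>)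
      then show "(\<lambda>i. indicat_real {- real i..real i} x *\<^sub>R ?h b x) \<longlonglongrightarrow> ?h b x"
        by (rule tendsto_eventually)
    qed
    show "AE x in lborel. norm (indicat_real {- real i..real i} x *\<^sub>R ?h b x) \<le> \<bar>K\<bar> * (1 / (1 + x\<^sup>2))" for i
    proof (rule AE_I2)
      fix x :: real
      have "norm (?h b x) \<le> K / (1 + x\<^sup>2)"
        using K[of "of_real x + \<i> * of_real b"] b by simp
      also have "\<dots> \<le> \<bar>K\<bar> * (1 / (1 + x\<^sup>2))" by (auto intro!: divide_right_mono)
      finally show "norm (indicat_real {- real i..real i} x *\<^sub>R ?h b x) \<le> \<bar>K\<bar> * (1 / (1 + x\<^sup>2))"
        by (auto simp: indicator_def)
    qed
  qed
  have FTC: "I b n = g (of_real (real n) + \<i> * of_real b) - g (of_real (- real n) + \<i> * of_real b)" if b: "0 \<le> b" "b \<le> a" for b n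
    unfolding I_def
  proof (rule integral_FTC_Icc)
    show "((\<lambda>x. g (complex_of_real x + \<i> * complex_of_real b)) has_vector_derivative ?h b x) (at x within {- real n..real n})" for x
    proof -
      have "((\<lambda>x. complex_of_real x + \<i> * complex_of_real b) has_vector_derivative 1) (at x within {- real n..real n})"
        by (auto intro!: derivative_eq_intros)
      from field_vector_diff_chain_within[OF this has_field_derivative_at_within[OF g'[OF inS[OF b]]]]
      show ?thesis by (simp add: o_def)
    qed
  qed (use b conth in auto)
  have gd: "norm (g (of_real x) - g (of_real x + \<i> * of_real a)) \<le> K / (1 + x\<^sup>2) * a" for x :: real
  proof -
    let ?L = "{z. Re z = x \<and> 0 \<le> Im z \<and> Im z \<le> a}"
    have "norm (g (of_real x) - g (of_real x + \<i> * of_real a)) \<le> K / (1 + x\<^sup>2) * norm (of_real x - (of_real x + \<i> * of_real a))"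
    proof (rule field_differentiable_bound[where S="?L" and f=g and f'=h])
      have L: "?L = {z. Re z \<ge> x} \<inter> {z. Re z \<le> x} \<inter> ({z. Im z \<ge> 0} \<inter> {z. Im z \<le> a})" by auto
      show "convex ?L" unfolding L
        by (intro convex_Int convex_halfspace_Im_ge convex_halfspace_Im_le convex_halfspace_Re_ge convex_halfspace_Re_le)
      fix z assume "z \<in> ?L"
      then have z: "Re z = x" "0 \<le> Im z" "Im z \<le> a" by simp_all
      show "norm (h z) \<le> K / (1 + x\<^sup>2)" using K[OF z(2,3)] unfolding z(1) .
      show "(g has_field_derivative h z) (at z within ?L)"
        by (rule has_field_derivative_at_within, rule g', rule subsetD[OF S(4)]) (use z in simp)
    qed (use a in simp_all)
    then show ?thesis using a by (simp add: norm_mult)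
  qed
  have "(\<lambda>n. I 0 n - I a n) \<longlonglongrightarrow> 0"
  proof (rule tendsto_rabs_zero_cancel Lim_null_comparison)
    show "\<forall>\<^sub>F n in sequentially. norm (I 0 n - I a n) \<le> 2 * (K * a) / (1 + (real n)\<^sup>2)"
    proof (rule always_eventually, rule allI)
      fix n
      have "I 0 n - I a n = (g (of_real (real n)) - g (of_real (real n) + \<i> * of_real a)) - (g (of_real (- real n)) - g (of_real (- real n) + \<i> * of_real a))"
        using FTC[of 0 n] FTC[of a n] a by simp
      also have "norm \<dots> \<le> K / (1 + (real n)\<^sup>2) * a + K / (1 + (- real n)\<^sup>2) * a"
        by (intro norm_triangle_le_diff add_mono gd)
      finally show "norm (I 0 n - I a n) \<le> 2 * (K * a) / (1 + (real n)\<^sup>2)" by simp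
    qed
    show "(\<lambda>n. 2 * (K * a) / (1 + (real n)\<^sup>2)) \<longlonglongrightarrow> 0" by real_asymp
  qed
  moreover have "(\<lambda>n. I 0 n - I a n) \<longlonglongrightarrow> (\<integral>x. h (of_real x + \<i> * of_real 0) \<partial>lborel) - (\<integral>x. h (of_real x + \<i> * of_real a) \<partial>lborel)"
    by (intro tendsto_diff lim) (use a in auto)
  ultimately show ?thesis using LIMSEQ_unique by fastforce
qed

lemma real_gaussian_integral:
  fixes l w :: real
  assumes l: "l > 0"
  shows "has_bochner_integral lborel (\<lambda>t. exp (- l * t\<^sup>2 + w * t)) (sqrt (pi / l) * exp (w\<^sup>2 / (4 * l)))"
proof -
  \<comment> \<open>After completing the square the integrand is a multiple of the normal density
    with mean w/(2 l) and variance s^2.\<close>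
  define s where "s = sqrt (1 / (2 * l))"
  have s: "s > 0" "s\<^sup>2 = 1 / (2 * l)" using l by (auto simp: s_def)
  have "has_bochner_integral lborel (\<lambda>t. (sqrt (pi / l) * exp (w\<^sup>2 / (4 * l))) * normal_density (w / (2 * l)) s t) ((sqrt (pi / l) * exp (w\<^sup>2 / (4 * l))) * 1)"
    using s(1) by (intro has_bochner_integral_mult_right) (auto simp: has_bochner_integral_iff)
  moreover have "(sqrt (pi / l) * exp (w\<^sup>2 / (4 * l))) * normal_density (w / (2 * l)) s t = exp (- l * t\<^sup>2 + w * t)" for t
  proof -
    have e: "w\<^sup>2 / (4 * l) + - (t - w / (2 * l))\<^sup>2 / (2 * s\<^sup>2) = - l * t\<^sup>2 + w * t"
      unfolding s(2) using l by (simp add: power2_eq_square field_simps)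
    have "sqrt (pi / l) = sqrt (2 * pi * s\<^sup>2)" using l by (simp add: s)
    then have "(sqrt (pi / l) * exp (w\<^sup>2 / (4 * l))) * normal_density (w / (2 * l)) s t
       = exp (w\<^sup>2 / (4 * l)) * exp (- (t - w / (2 * l))\<^sup>2 / (2 * s\<^sup>2))"
      using l s by (simp add: normal_density_def)
    then show ?thesis using e by (simp flip: exp_add)
  qed
  ultimately show ?thesis by simp
qed

lemma exp_abs_le_sum: "exp (A * \<bar>t\<bar>) \<le> exp (A * t) + exp (- A * t)" for A t :: real
  by (cases "t \<ge> 0") auto

lemma gaussian_integrable_abs:
  fixes l A :: real
  assumes l: "l > 0"
  shows "integrable lborel (\<lambda>t. exp (A * \<bar>t\<bar>) * exp (- l * t\<^sup>2))"
proof (rule Bochner_Integration.integrable_bound)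
  show "integrable lborel (\<lambda>t. exp (- l * t\<^sup>2 + A * t) + exp (- l * t\<^sup>2 + (- A) * t))"
    using real_gaussian_integral[OF l, of A] real_gaussian_integral[OF l, of "- A"]
    by (intro Bochner_Integration.integrable_add) (simp_all only: has_bochner_integral_iff)
  show "AE t in lborel. norm (exp (A * \<bar>t\<bar>) * exp (- l * t\<^sup>2)) \<le> norm (exp (- l * t\<^sup>2 + A * t) + exp (- l * t\<^sup>2 + (- A) * t))"
  proof (rule AE_I2)
    fix t :: real
    have "exp (A * \<bar>t\<bar>) * exp (- l * t\<^sup>2) \<le> (exp (A * t) + exp (- A * t)) * exp (- l * t\<^sup>2)"
      by (intro mult_right_mono exp_abs_le_sum) simp
    also have "\<dots> = exp (- l * t\<^sup>2 + A * t) + exp (- l * t\<^sup>2 + (- A) * t)"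
      by (simp add: exp_add[symmetric] algebra_simps)
    finally show "norm (exp (A * \<bar>t\<bar>) * exp (- l * t\<^sup>2)) \<le> norm (exp (- l * t\<^sup>2 + A * t) + exp (- l * t\<^sup>2 + (- A) * t))" by simp
  qed
qed simp

section \<open>Growth of products over sets with at most D sqrt T elements up to T\<close>

lemma prod_le_quartic_prod:
  fixes S :: "real set"
  assumes "finite S" "S \<subseteq> {0<..}" "D > 0"
    and "\<And>T. T > 0 \<Longrightarrow> real (card (S \<inter> {..T})) \<le> D * sqrt T"
  shows "(\<Prod>t\<in>S. 1 + x\<^sup>2 / t\<^sup>2) \<le> (\<Prod>j=1..card S. 1 + x\<^sup>2 * D ^ 4 / real j ^ 4)"
  using assms
proof (induction "card S" arbitrary: S)
  case 0
  then show ?case by simp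
next
  case (Suc n)
  let ?m = "Max S"
  have ne: "S \<noteq> {}" using Suc by auto
  have m: "?m \<in> S" "?m > 0" using Suc.prems ne by (auto dest: Max_in)
  have cS: "card (S - {?m}) = n" using Suc m by simp
  \<comment> \<open>All \<open>Suc n\<close> elements lie below the maximum, so the counting
    hypothesis there gives 1/max^2 <= D^4/(Suc n)^4: the maximum pays for the last factor on the
    right, and induction removes it.\<close>
  have "S \<inter> {..?m} = S" using Suc.prems by auto
  then have "real (Suc n) \<le> D * sqrt ?m" using Suc.prems(4)[OF m(2)] Suc.hyps(2) by simp
  then have "real (Suc n) ^ 4 \<le> (D * sqrt ?m) ^ 4" by (intro power_mono) auto
  also have "\<dots> = D ^ 4 * ?m\<^sup>2"
    using m(2) power_mult[of "sqrt ?m" 2 2] by (simp add: power_mult_distrib)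
  finally have q: "real (Suc n) ^ 4 \<le> D ^ 4 * ?m\<^sup>2" .
  have "1 / ?m\<^sup>2 \<le> D ^ 4 / real (Suc n) ^ 4"
    using q m(2) by (simp add: divide_simps del: of_nat_Suc)
  then have f: "1 + x\<^sup>2 / ?m\<^sup>2 \<le> 1 + x\<^sup>2 * D ^ 4 / real (Suc n) ^ 4"
    using mult_left_mono[of "1 / ?m\<^sup>2" "D ^ 4 / real (Suc n) ^ 4" "x\<^sup>2"] by simp
  have IH: "(\<Prod>t\<in>S - {?m}. 1 + x\<^sup>2 / t\<^sup>2) \<le> (\<Prod>j=1..card (S - {?m}). 1 + x\<^sup>2 * D ^ 4 / real j ^ 4)"
  proof (rule Suc.hyps(1))
    show "n = card (S - {?m})" using cS by simp
    fix T :: real assume T: "T > 0"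
    have "card ((S - {?m}) \<inter> {..T}) \<le> card (S \<inter> {..T})" using Suc.prems by (intro card_mono) auto
    then show "real (card ((S - {?m}) \<inter> {..T})) \<le> D * sqrt T" using Suc.prems(4)[OF T] by linarith
  qed (use Suc.prems in auto)
  have "(\<Prod>t\<in>S. 1 + x\<^sup>2 / t\<^sup>2) = (1 + x\<^sup>2 / ?m\<^sup>2) * (\<Prod>t\<in>S - {?m}. 1 + x\<^sup>2 / t\<^sup>2)"
    using Suc.prems m by (intro prod.remove) auto
  also have "\<dots> \<le> (1 + x\<^sup>2 * D ^ 4 / real (Suc n) ^ 4) * (\<Prod>j=1..n. 1 + x\<^sup>2 * D ^ 4 / real j ^ 4)"
    using IH f cS by (intro mult_mono prod_nonneg) (auto intro!: prod_nonneg add_nonneg_nonneg)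
  also have "\<dots> = (\<Prod>j=1..Suc n. 1 + x\<^sup>2 * D ^ 4 / real j ^ 4)" by (simp add: mult.commute)
  finally show ?case using Suc.hyps(2) by simp
qed

text \<open>The product formula of the sine at i y shows that the products increase to sinh(pi
  y)/(pi y), and sinh x <= x exp x for x >= 0.\<close>

lemma prod_1_plus_le_exp:
  fixes y :: real
  assumes y: "y \<ge> 0"
  shows "(\<Prod>j=1..n. 1 + y\<^sup>2 / real j ^ 2) \<le> exp (pi * y)"
proof (cases "y = 0")
  case False
  with y have y: "y > 0" by simp
  define P where "P = (\<lambda>n. \<Prod>j=1..n. 1 + y\<^sup>2 / real j ^ 2)"
  have "(\<lambda>n. complex_of_real pi * (\<i> * of_real y) * (\<Prod>k = 1..n. 1 - (\<i> * of_real y)\<^sup>2 / (complex_of_nat k)\<^sup>2))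
    \<longlonglongrightarrow> sin (complex_of_real pi * (\<i> * of_real y))" by (rule sin_product_formula_complex)
  moreover have "(\<Prod>k = 1..n. 1 - (\<i> * of_real y)\<^sup>2 / (complex_of_nat k)\<^sup>2) = of_real (P n)" for n
    by (simp add: P_def power_mult_distrib)
  ultimately have "(\<lambda>n. Im (complex_of_real pi * (\<i> * of_real y) * of_real (P n))) \<longlonglongrightarrow> Im (sin (complex_of_real pi * (\<i> * of_real y)))"
    by (intro tendsto_Im) simp
  moreover have "Im (sin (complex_of_real pi * (\<i> * of_real y))) = (exp (pi * y) - exp (- (pi * y))) / 2"
    by (simp add: Im_sin)
  ultimately have lim: "(\<lambda>n. pi * y * P n) \<longlonglongrightarrow> (exp (pi * y) - exp (- (pi * y))) / 2" by simp
  have "incseq (\<lambda>n. pi * y * P n)"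
  proof (rule incseq_SucI)
    fix n
    have "P n * 1 \<le> P n * (1 + y\<^sup>2 / real (Suc n) ^ 2)"
      unfolding P_def by (intro mult_left_mono prod_nonneg) (auto intro!: add_nonneg_nonneg)
    then have "P n \<le> P (Suc n)" by (simp add: P_def mult.commute)
    then show "pi * y * P n \<le> pi * y * P (Suc n)" using y by (intro mult_left_mono) auto
  qed
  then have "pi * y * P n \<le> (exp (pi * y) - exp (- (pi * y))) / 2" using lim by (rule incseq_le)
  also have "\<dots> = exp (pi * y) * (1 - exp (- (2 * (pi * y)))) / 2"
    by (simp add: algebra_simps exp_add[symmetric])
  also have "\<dots> \<le> exp (pi * y) * (2 * (pi * y)) / 2"
    using exp_ge_add_one_self[of "- (2 * (pi * y))"] by (intro divide_right_mono mult_left_mono) auto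
  finally have "pi * y * P n \<le> pi * y * exp (pi * y)" by (simp add: algebra_simps)
  then show ?thesis using y by (simp add: P_def)
qed simp

text \<open>With y = D sqrt x one has 1 + y^4/j^4 <= (1 + y^2/j^2)^2, so the quartic product is at
  most the square of a product bounded by exp(pi y).\<close>

lemma prod_le_exp_sqrt:
  fixes S :: "real set"
  assumes "finite S" "S \<subseteq> {0<..}" "D > 0" "x \<ge> 0"
    and "\<And>T. T > 0 \<Longrightarrow> real (card (S \<inter> {..T})) \<le> D * sqrt T"
  shows "(\<Prod>t\<in>S. 1 + x\<^sup>2 / t\<^sup>2) \<le> exp (2 * pi * D * sqrt x)"
proof -
  define y where "y = D * sqrt x"
  have y: "y \<ge> 0" using assms by (simp add: y_def)
  have y4: "x\<^sup>2 * D ^ 4 = (y\<^sup>2)\<^sup>2"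
    using assms by (simp add: y_def power_mult_distrib power_mult[symmetric]) 
  have "(\<Prod>t\<in>S. 1 + x\<^sup>2 / t\<^sup>2) \<le> (\<Prod>j=1..card S. 1 + x\<^sup>2 * D ^ 4 / real j ^ 4)"
    using assms by (intro prod_le_quartic_prod) auto
  also have "\<dots> \<le> (\<Prod>j=1..card S. (1 + y\<^sup>2 / real j ^ 2)\<^sup>2)"
  proof (intro prod_mono conjI)
    fix j assume "j \<in> {1..card S}"
    have "x\<^sup>2 * D ^ 4 / real j ^ 4 = (y\<^sup>2 / real j ^ 2)\<^sup>2"
      by (simp add: y4 power_divide power_mult[symmetric])
    then show "1 + x\<^sup>2 * D ^ 4 / real j ^ 4 \<le> (1 + y\<^sup>2 / real j ^ 2)\<^sup>2"
      by (simp add: power2_sum)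
  qed (auto intro!: add_nonneg_nonneg)
  also have "\<dots> = (\<Prod>j=1..card S. 1 + y\<^sup>2 / real j ^ 2)\<^sup>2" by (simp add: prod_power_distrib)
  also have "\<dots> \<le> (exp (pi * y))\<^sup>2"
    by (intro power_mono prod_1_plus_le_exp y prod_nonneg) (auto intro!: add_nonneg_nonneg)
  also have "\<dots> = exp (2 * pi * D * sqrt x)" by (simp add: y_def exp_double[symmetric] algebra_simps)
  finally show ?thesis .
qed

text \<open>Read off from the total mass 1 of the Erlang density of shape \<open>n\<close> and rate
  \<open>r\<close>.\<close>

lemma power_exp_integral:
  fixes r :: real
  assumes r: "r > 0"
  shows "has_bochner_integral lborel (\<lambda>x. indicator {0..} x * (x ^ n * exp (- r * x))) (fact n / r ^ Suc n)"
proof -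
  interpret prob_space "density lborel (erlang_density n r)" by (rule prob_space_erlang_density[OF r])
  have "has_bochner_integral lborel (erlang_density n r) 1"
  proof (rule has_bochner_integral_nn_integral)
    show "(\<integral>\<^sup>+ x. ennreal (erlang_density n r x) \<partial>lborel) = ennreal 1"
      using emeasure_space_1 by (simp add: emeasure_density)
  qed (use r in auto)
  then have "has_bochner_integral lborel (\<lambda>x. (fact n / r ^ Suc n) * erlang_density n r x) ((fact n / r ^ Suc n) * 1)"
    by (rule has_bochner_integral_mult_right)
  moreover have "(fact n / r ^ Suc n) * erlang_density n r x = indicator {0..} x * (x ^ n * exp (- r * x))" for x
    using r by (auto simp: erlang_density_def indicator_def)
  ultimately show ?thesis by simp
qed

text \<open>Since \<open>n! / r\<^sup>n = r \<integral> x\<^sup>n exp(- r x) dx\<close> over \<open>x \<ge> 0\<close>, the sum is \<open>r \<integral> \<Prod> (1 + c\<^sub>s x\<^sup>2) exp(- r x) dx\<close>.\<close>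

lemma sum_subsets_fact_le:
  fixes c :: "'a \<Rightarrow> real"
  assumes S: "finite S" "\<And>s. s \<in> S \<Longrightarrow> c s \<ge> 0" and r: "r > 0" and b: "b \<ge> 0"
    and C: "\<And>x. x \<ge> 0 \<Longrightarrow> (\<Prod>s\<in>S. 1 + c s * x\<^sup>2) \<le> C * exp (b * sqrt x)"
  shows "(\<Sum>B\<in>Pow S. (\<Prod>s\<in>B. c s) * (fact (2 * card B) / r ^ (2 * card B))) \<le> 2 * C * exp (b\<^sup>2 / (2 * r))"
proof -
  let ?sum = "\<Sum>B\<in>Pow S. (\<Prod>s\<in>B. c s) * (fact (2 * card B) / r ^ Suc (2 * card B))"
  have C0: "C \<ge> 0" using C[of 0] by simp
  have "has_bochner_integral lborel (\<lambda>x. \<Sum>B\<in>Pow S. (\<Prod>s\<in>B. c s) * (indicator {0..} x * (x ^ (2 * card B) * exp (- r * x))))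
     ?sum"
    by (intro has_bochner_integral_sum has_bochner_integral_mult_right power_exp_integral r)
  moreover have "(\<Sum>B\<in>Pow S. (\<Prod>s\<in>B. c s) * (indicator {0..} x * (x ^ (2 * card B) * exp (- r * x)))) =
     indicator {0..} x * ((\<Prod>s\<in>S. 1 + c s * x\<^sup>2) * exp (- r * x))" for x
  proof -
    have "(\<Prod>s\<in>S. c s * x\<^sup>2 + 1) = (\<Sum>B\<in>Pow S. (\<Prod>s\<in>B. c s * x\<^sup>2) * (\<Prod>s\<in>S-B. 1))"
      by (rule prod_add[OF S(1)])
    also have "\<dots> = (\<Sum>B\<in>Pow S. (\<Prod>s\<in>B. c s) * x ^ (2 * card B))"
      by (intro sum.cong refl) (simp add: prod.distrib power_mult)
    finally have e: "(\<Prod>s\<in>S. 1 + c s * x\<^sup>2) = (\<Sum>B\<in>Pow S. (\<Prod>s\<in>B. c s) * x ^ (2 * card B))"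
      by (simp add: add.commute)
    show ?thesis unfolding e sum_distrib_left sum_distrib_right by (intro sum.cong refl) (simp add: mult_ac)
  qed
  ultimately have 1: "has_bochner_integral lborel (\<lambda>x. indicator {0..} x * ((\<Prod>s\<in>S. 1 + c s * x\<^sup>2) * exp (- r * x)))
     ?sum" by simp
  have 2: "has_bochner_integral lborel (\<lambda>x. C * exp (b\<^sup>2 / (2 * r)) * (indicator {0..} x * (x ^ 0 * exp (- (r/2) * x))))
     (C * exp (b\<^sup>2 / (2 * r)) * (fact 0 / (r/2) ^ Suc 0))"
    by (intro has_bochner_integral_mult_right power_exp_integral) (use r in simp)
  have "?sum \<le> C * exp (b\<^sup>2 / (2 * r)) * (fact 0 / (r/2) ^ Suc 0)"
    unfolding has_bochner_integral_integral_eq[OF 1, symmetric] has_bochner_integral_integral_eq[OF 2, symmetric]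
  proof (rule integral_mono[OF integrable.intros[OF 1] integrable.intros[OF 2]])
    fix x :: real
    show "indicator {0..} x * ((\<Prod>s\<in>S. 1 + c s * x\<^sup>2) * exp (- r * x)) \<le> C * exp (b\<^sup>2 / (2 * r)) * (indicator {0..} x * (x ^ 0 * exp (- (r/2) * x)))"
    proof (cases "x \<ge> 0")
      case True
      \<comment> \<open>Half of the decay exp(-r x) absorbs exp(b sqrt x), because b sqrt x <=
        b^2/(2 r) + r x/2; the other half has integral 2/r.\<close>
      have "0 \<le> (b - r * sqrt x)\<^sup>2" by simp
      also have "\<dots> = b\<^sup>2 - 2 * r * (b * sqrt x) + r * (r * x)"
        using True by (simp add: power2_diff power_mult_distrib) (simp add: power2_eq_square)
      finally have "b * sqrt x \<le> b\<^sup>2 / (2 * r) + r / 2 * x" using r by (simp add: field_simps)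
      then have "exp (b * sqrt x) * exp (- r * x) \<le> exp (b\<^sup>2 / (2 * r)) * exp (- (r/2) * x)"
        by (simp add: exp_add[symmetric] algebra_simps)
      then have "C * (exp (b * sqrt x) * exp (- r * x)) \<le> C * (exp (b\<^sup>2 / (2 * r)) * exp (- (r/2) * x))"
        using C0 by (rule mult_left_mono)
      moreover have "(\<Prod>s\<in>S. 1 + c s * x\<^sup>2) * exp (- r * x) \<le> C * exp (b * sqrt x) * exp (- r * x)"
        by (intro mult_right_mono C True) simp
      ultimately have "(\<Prod>s\<in>S. 1 + c s * x\<^sup>2) * exp (- r * x) \<le> C * (exp (b\<^sup>2 / (2 * r)) * exp (- (r/2) * x))"
        by (simp only: mult.assoc)
      then show ?thesis using True by (simp add: mult.assoc)
    qed simp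
  qed
  then have "r * ?sum \<le> r * (C * exp (b\<^sup>2 / (2 * r)) * (fact 0 / (r/2) ^ Suc 0))"
    using r by (intro mult_left_mono) auto
  then show ?thesis using r by (simp add: sum_distrib_left mult_ac divide_simps)
qed

section \<open>Gaussian regularisation of the Fourier transform and the contour shift\<close>

lemma super_exp_decay_gaussian_mult:
  assumes [measurable]: "g \<in> borel_measurable borel" and B: "\<And>t. norm (g t) \<le> B" and l: "l > 0"
  shows "super_exp_decay (\<lambda>t. g t * of_real (exp (- l * t\<^sup>2)))"
proof
  show "(\<lambda>t. g t * of_real (exp (- l * t\<^sup>2))) \<in> borel_measurable borel" by measurable
  fix A :: real
  show "integrable lborel (\<lambda>t. exp (A * \<bar>t\<bar>) * norm (g t * of_real (exp (- l * t\<^sup>2))))"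
  proof (rule Bochner_Integration.integrable_bound)
    show "integrable lborel (\<lambda>t. B * (exp (A * \<bar>t\<bar>) * exp (- l * t\<^sup>2)))"
      by (intro integrable_mult_right gaussian_integrable_abs l)
    show "AE t in lborel. norm (exp (A * \<bar>t\<bar>) * norm (g t * of_real (exp (- l * t\<^sup>2)))) \<le> norm (B * (exp (A * \<bar>t\<bar>) * exp (- l * t\<^sup>2)))"
    proof (rule AE_I2)
      fix t :: real
      have "norm (g t) * (exp (A * \<bar>t\<bar>) * exp (- l * t\<^sup>2)) \<le> B * (exp (A * \<bar>t\<bar>) * exp (- l * t\<^sup>2))"
        by (intro mult_right_mono B) simp
      then show "norm (exp (A * \<bar>t\<bar>) * norm (g t * of_real (exp (- l * t\<^sup>2)))) \<le> norm (B * (exp (A * \<bar>t\<bar>) * exp (- l * t\<^sup>2)))"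
        using order_trans[OF norm_ge_zero B] by (simp add: norm_mult mult_ac)
    qed
  qed measurable
qed

text \<open>Both sides are entire in \<open>w\<close> and agree for real \<open>w\<close> by
  \<open>real_gaussian_integral\<close>; the identity theorem applies since the real axis
  accumulates at 0.\<close>

lemma gaussian_laplace:
  fixes w :: complex
  assumes l: "l > 0"
  shows "(\<integral>t. of_real (exp (- l * t\<^sup>2)) * exp (w * of_real t) \<partial>lborel)
    = of_real (sqrt (pi / l)) * exp (w\<^sup>2 / (4 * of_real l))"
proof -
  interpret super_exp_decay "\<lambda>t. 1 * of_real (exp (- l * t\<^sup>2))"
    by (rule super_exp_decay_gaussian_mult[OF _ _ l, of _ 1]) auto
  have "laplace w - of_real (sqrt (pi / l)) * exp (w\<^sup>2 / (4 * of_real l)) = 0"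
  proof (rule analytic_continuation[where f="\<lambda>w. laplace w - of_real (sqrt (pi / l)) * exp (w\<^sup>2 / (4 * of_real l))" and w=w and S=UNIV and U="range complex_of_real" and \<xi>=0])
    show "(\<lambda>w. laplace w - of_real (sqrt (pi / l)) * exp (w\<^sup>2 / (4 * of_real l))) holomorphic_on UNIV"
      by (intro holomorphic_intros laplace_holomorphic) (use l in simp)
    show "(0::complex) islimpt range complex_of_real"
    proof (rule islimptI)
      fix T :: "complex set" assume "0 \<in> T" "open T"
      then obtain e where e: "e > 0" "ball 0 e \<subseteq> T" using open_contains_ball by blast
      then have "complex_of_real (e/2) \<in> T" by (intro subsetD[OF e(2)]) simp
      then show "\<exists>y\<in>range complex_of_real. y \<in> T \<and> y \<noteq> 0" using e(1)
        by (intro bexI[OF _ rangeI[of _ "e/2"]]) auto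
    qed
    fix z assume "z \<in> range complex_of_real"
    then obtain x where z: "z = of_real x" by auto
    have "has_bochner_integral lborel (\<lambda>t. complex_of_real (exp (- l * t\<^sup>2 + x * t))) (of_real (sqrt (pi / l) * exp (x\<^sup>2 / (4 * l))))"
      using real_gaussian_integral[OF l] by (rule has_bochner_integral_of_real)
    then have "laplace z = of_real (sqrt (pi / l) * exp (x\<^sup>2 / (4 * l)))"
      unfolding laplace_def z by (simp add: has_bochner_integral_iff exp_add mult_exp_exp flip: exp_of_real)
    then show "laplace z - of_real (sqrt (pi / l)) * exp (z\<^sup>2 / (4 * of_real l)) = 0"
      by (simp add: z exp_of_real[symmetric])
  qed auto
  then show ?thesis unfolding laplace_def by simp
qed

context super_exp_decay
begin

definition xi :: "real \<Rightarrow> complex" where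
  "xi t = laplace (\<i> * of_real t)"

lemma integrable_norm: "integrable lborel (\<lambda>t. norm (h t))"
  using int[of 0] by simp

lemma xi_bounded: "norm (xi t) \<le> (\<integral>u. norm (h u) \<partial>lborel)"
proof -
  have "norm (xi t) \<le> (\<integral>u. norm (h u * exp (\<i> * of_real t * of_real u)) \<partial>lborel)"
    unfolding xi_def laplace_def by (rule integral_norm_bound)
  then show ?thesis by (simp add: norm_mult)
qed

lemma continuous_xi: "continuous_on A xi"
  unfolding xi_def
  by (rule continuous_on_compose2[OF holomorphic_on_imp_continuous_on[OF laplace_holomorphic[of UNIV]]])
    (auto intro!: continuous_intros)

lemma xi_measurable [measurable]: "xi \<in> borel_measurable borel"
  by (rule borel_measurable_continuous_onI[OF continuous_xi])

lemma super_exp_decay_xi_gauss: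
  "l > 0 \<Longrightarrow> super_exp_decay (\<lambda>t. xi t * of_real (exp (- l * t\<^sup>2)))"
  by (rule super_exp_decay_gaussian_mult[OF xi_measurable xi_bounded])

text \<open>Fubini, with \<open>gaussian_laplace\<close> for the inner integral over t. The point is
  to return from \<open>xi\<close> to \<open>h\<close>: for \<open>h\<close> given by
  \<open>Psi\<close>, the new integrand continues analytically into a strip, where the contour can
  be moved towards the cusp.\<close>

lemma laplace_xi_gauss:
  assumes l: "l > 0"
  shows "super_exp_decay.laplace (\<lambda>t. xi t * of_real (exp (- l * t\<^sup>2))) b =
    of_real (sqrt (pi / l)) * (\<integral>u. h u * exp ((b + \<i> * of_real u)\<^sup>2 / (4 * of_real l)) \<partial>lborel)"
proof -
  interpret X: super_exp_decay "\<lambda>t. xi t * of_real (exp (- l * t\<^sup>2))"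
    by (rule super_exp_decay_xi_gauss[OF l])
  interpret G: super_exp_decay "\<lambda>t. 1 * of_real (exp (- l * t\<^sup>2))"
    by (rule super_exp_decay_gaussian_mult[OF _ _ l, of _ 1]) auto
  let ?E = "\<lambda>t::real. of_real (exp (- l * t\<^sup>2)) * exp (b * of_real t)"
  have Ei: "integrable lborel ?E" using G.integrable_exp[of b] by simp
  let ?f = "\<lambda>t u. h u * exp (\<i> * of_real t * of_real u) * ?E t"
  have "integrable (lborel \<Otimes>\<^sub>M lborel) (\<lambda>(t, u). ?f t u)"
  proof (rule lborel_pair.Fubini_integrable)
    show "(\<lambda>(t, u). ?f t u) \<in> borel_measurable (lborel \<Otimes>\<^sub>M lborel)" by measurable
    have nE: "integrable lborel (\<lambda>t. (\<integral>u. norm (h u) \<partial>lborel) * norm (?E t))"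
      by (intro integrable_mult_right Bochner_Integration.integrable_norm Ei)
    have "(\<integral>u. norm (case (t, u) of (t, u) \<Rightarrow> ?f t u) \<partial>lborel) = (\<integral>u. norm (h u) \<partial>lborel) * norm (?E t)" for t
      by (simp add: norm_mult)
    then show "integrable lborel (\<lambda>t. \<integral>u. norm (case (t, u) of (t, u) \<Rightarrow> ?f t u) \<partial>lborel)"
      using nE by (simp only:)
    show "AE t in lborel. integrable lborel (\<lambda>u. case (t, u) of (t, u) \<Rightarrow> ?f t u)"
    proof (rule AE_I2)
      fix t :: real
      show "integrable lborel (\<lambda>u. case (t, u) of (t, u) \<Rightarrow> ?f t u)"
        using integrable_mult_left[OF integrable_exp[of "\<i> * of_real t"], of "?E t"] by simp
    qed
  qed
  then have F: "(\<integral>u. (\<integral>t. ?f t u \<partial>lborel) \<partial>lborel) = (\<integral>t. (\<integral>u. ?f t u \<partial>lborel) \<partial>lborel)"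
    by (rule lborel_pair.Fubini_integral)
  have inner: "(\<integral>u. ?f t u \<partial>lborel) = xi t * ?E t" for t
    unfolding xi_def laplace_def by (rule integral_mult_left_zero)
  have "X.laplace b = (\<integral>t. (\<integral>u. ?f t u \<partial>lborel) \<partial>lborel)"
    unfolding inner X.laplace_def by (simp add: mult.assoc)
  also have "\<dots> = (\<integral>u. (\<integral>t. ?f t u \<partial>lborel) \<partial>lborel)" using F by simp
  also have "\<dots> = (\<integral>u. of_real (sqrt (pi / l)) * (h u * exp ((b + \<i> * of_real u)\<^sup>2 / (4 * of_real l))) \<partial>lborel)"
  proof (intro Bochner_Integration.integral_cong refl)
    fix u :: real
    have "(\<integral>t. ?f t u \<partial>lborel) = (\<integral>t. h u * (of_real (exp (- l * t\<^sup>2)) * exp ((b + \<i> * of_real u) * of_real t)) \<partial>lborel)"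
      by (intro Bochner_Integration.integral_cong refl) (simp add: algebra_simps exp_add)
    also have "\<dots> = h u * (\<integral>t. of_real (exp (- l * t\<^sup>2)) * exp ((b + \<i> * of_real u) * of_real t) \<partial>lborel)"
      by (rule integral_mult_right_zero)
    finally show "(\<integral>t. ?f t u \<partial>lborel) = of_real (sqrt (pi / l)) * (h u * exp ((b + \<i> * of_real u)\<^sup>2 / (4 * of_real l)))"
      unfolding gaussian_laplace[OF l] by (simp only: mult_ac)
  qed
  finally show ?thesis by simp
qed

end

text \<open>With y = |b + x|, completing the square gives c y <= y^2/(4 l) + c^2 l, and |x| <= y +
  |b|.\<close>

lemma exp_linear_gaussian_le:
  fixes x b l c :: real
  assumes l: "l > 0" and c: "c \<ge> 0"
  shows "exp (c * \<bar>x\<bar> - (b + x)\<^sup>2 / (4 * l)) \<le> exp (c * \<bar>b\<bar> + c\<^sup>2 * l)"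
proof -
  let ?y = "\<bar>b + x\<bar>"
  have "0 \<le> (?y - 2 * c * l)\<^sup>2" by simp
  also have "\<dots> = (b + x)\<^sup>2 - 4 * l * (c * ?y) + 4 * l * (c\<^sup>2 * l)"
    by (simp add: power2_eq_square algebra_simps)
  finally have "c * ?y \<le> (b + x)\<^sup>2 / (4 * l) + c\<^sup>2 * l" using l by (simp add: field_simps)
  moreover have "c * \<bar>x\<bar> \<le> c * (?y + \<bar>b\<bar>)" using c by (intro mult_left_mono) auto
  ultimately have "c * \<bar>x\<bar> - (b + x)\<^sup>2 / (4 * l) \<le> c * \<bar>b\<bar> + c\<^sup>2 * l" by (simp add: distrib_left)
  then show ?thesis by simp
qed

text \<open>Moving the line up by \<open>a\<close> replaces \<open>b\<close> by \<open>b - a\<close>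
  in the Gaussian. For \<open>b\<close> close to \<open>a\<close> this removes the factor exp(b^2/(4
  l)), which is huge for small \<open>l\<close>. The Gaussian in Re z outweighs the growth exp(A |Re
  z|).\<close>

lemma gaussian_contour_shift:
  fixes P :: "complex \<Rightarrow> complex"
  assumes S: "open S" "convex S" "P holomorphic_on S" "{z. 0 \<le> Im z \<and> Im z \<le> a} \<subseteq> S" and a: "a \<ge> 0"
    and C: "\<And>z. 0 \<le> Im z \<Longrightarrow> Im z \<le> a \<Longrightarrow> norm (P z) \<le> C * exp (A * \<bar>Re z\<bar>)" and A: "A \<ge> 0" and l: "l > 0"
  shows "(\<integral>u. P (of_real u) * exp ((b + \<i> * of_real u)\<^sup>2 / (4 * of_real l)) \<partial>lborel) =
    (\<integral>u. P (of_real u + \<i> * of_real a) * exp ((b - of_real a + \<i> * of_real u)\<^sup>2 / (4 * of_real l)) \<partial>lborel)"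
proof -
  define h where "h = (\<lambda>z. P z * exp ((b + \<i> * z)\<^sup>2 / (4 * of_real l)))"
  \<comment> \<open>Writing \<open>A + 1\<close> for \<open>A\<close> sets aside a factor exp(-|x|),
    which supplies the decay 2/(1 + x^2).\<close>
  let ?K = "2 * C * exp ((\<bar>Re b\<bar> + a)\<^sup>2 / (4 * l)) * exp ((A + 1) * \<bar>Im b\<bar> + (A + 1)\<^sup>2 * l)"
  have C0: "C \<ge> 0" using C[of 0] a order_trans[OF norm_ge_zero] by simp blast
  have "(\<integral>x. h (of_real x) \<partial>lborel) = (\<integral>x. h (of_real x + \<i> * of_real a) \<partial>lborel)"
  proof (rule integral_horizontal_shift[OF S(1,2) _ S(4) a])
    show "h holomorphic_on S" unfolding h_def using l by (intro holomorphic_intros S(3)) auto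
    fix z assume z: "0 \<le> Im z" "Im z \<le> a"
    define x where "x = Re z"
    have "Re ((b + \<i> * z)\<^sup>2 / (4 * of_real l)) = Re ((b + \<i> * z)\<^sup>2) / (4 * l)"
      using Re_divide_of_real[of "(b + \<i> * z)\<^sup>2" "4 * l"] by simp
    also have "Re ((b + \<i> * z)\<^sup>2) = (Re b - Im z)\<^sup>2 - (Im b + x)\<^sup>2"
      by (simp add: power2_eq_square x_def)
    finally have R: "Re ((b + \<i> * z)\<^sup>2 / (4 * of_real l)) = (Re b - Im z)\<^sup>2 / (4 * l) - (Im b + x)\<^sup>2 / (4 * l)"
      by (simp add: diff_divide_distrib)
    have "\<bar>Re b - Im z\<bar> \<le> \<bar>Re b\<bar> + a" using z by linarith
    then have "(Re b - Im z)\<^sup>2 \<le> (\<bar>Re b\<bar> + a)\<^sup>2" using abs_le_square_iff[of "Re b - Im z" "\<bar>Re b\<bar> + a"] a by auto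
    then have q: "(Re b - Im z)\<^sup>2 / (4 * l) \<le> (\<bar>Re b\<bar> + a)\<^sup>2 / (4 * l)" using l by (simp add: divide_right_mono)
    have x2: "1 + x\<^sup>2 \<le> 2 * exp \<bar>x\<bar>"
    proof -
      have "x\<^sup>2 \<le> 2 * (exp \<bar>x\<bar> - 1)" using power_le_fact_times_exp[of "\<bar>x\<bar>" 2] exp_lower_Taylor_quadratic[of "\<bar>x\<bar>"] by simp
      then show ?thesis by simp
    qed
    have "norm (h z) = norm (P z) * exp ((Re b - Im z)\<^sup>2 / (4 * l) - (Im b + x)\<^sup>2 / (4 * l))"
      by (simp add: h_def norm_mult R)
    also have "\<dots> \<le> (C * exp (A * \<bar>x\<bar>)) * exp ((\<bar>Re b\<bar> + a)\<^sup>2 / (4 * l) - (Im b + x)\<^sup>2 / (4 * l))"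
      using C[OF z] q C0 by (intro mult_mono) (auto simp: x_def)
    also have "\<dots> = C * exp ((\<bar>Re b\<bar> + a)\<^sup>2 / (4 * l)) * exp ((A + 1) * \<bar>x\<bar> - (Im b + x)\<^sup>2 / (4 * l)) * exp (- \<bar>x\<bar>)"
      by (simp add: exp_add[symmetric] algebra_simps)
    also have "\<dots> \<le> C * exp ((\<bar>Re b\<bar> + a)\<^sup>2 / (4 * l)) * exp ((A + 1) * \<bar>Im b\<bar> + (A + 1)\<^sup>2 * l) * (2 / (1 + x\<^sup>2))"
    proof (intro mult_mono mult_left_mono exp_linear_gaussian_le l)
      have "exp (- \<bar>x\<bar>) * (1 + x\<^sup>2) \<le> exp (- \<bar>x\<bar>) * (2 * exp \<bar>x\<bar>)" by (intro mult_left_mono x2) simp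
      also have "\<dots> = 2" by (simp add: exp_minus)
      finally show "exp (- \<bar>x\<bar>) \<le> 2 / (1 + x\<^sup>2)" by (simp add: pos_le_divide_eq add_pos_nonneg)
    qed (use C0 A in auto)
    finally show "norm (h z) \<le> ?K / (1 + (Re z)\<^sup>2)" by (simp add: x_def mult_ac)
  qed
  moreover have "b + \<i> * (of_real x + \<i> * of_real a) = b - of_real a + \<i> * of_real x" for x
    by (simp add: algebra_simps)
  ultimately show ?thesis by (simp add: h_def)
qed

text \<open>The Gaussian has width of order d^(3/2) and its centre - Im \<open>\<rho>\<close> lies
  within d/4 of 0. For |v| <= d the bound \<open>E\<close> applies; for |v| > d the distance to the
  centre is at least 3 d/4, and half of the exponent already gives exp(-(3/4)^2/(8 d)) = exp(-9/(128
  d)). The real part of \<open>\<rho>\<close> costs exp(th^2/(4 d)).\<close>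

lemma gaussian_average_bound:
  fixes P :: "real \<Rightarrow> complex"
  assumes A: "A \<ge> 0" and d: "0 < d" "d \<le> 1" and th: "0 < th" "th \<le> 1/4"
    and rho: "norm \<rho> \<le> th * d"
    and E: "\<And>v. \<bar>v\<bar> \<le> d \<Longrightarrow> norm (P v) \<le> E" and C: "\<And>v. norm (P v) \<le> C * exp (A * \<bar>v\<bar>)"
  shows "norm (\<integral>v. P v * exp ((\<rho> + \<i> * of_real v)\<^sup>2 / (4 * of_real (d ^ 3))) \<partial>lborel)
    \<le> exp (th\<^sup>2 / (4 * d)) * (E + C * exp (- 9 / (128 * d))) * exp A * (\<integral>v. exp (A * \<bar>v\<bar>) * exp (- (1/8) * v\<^sup>2) \<partial>lborel)"
proof -
  define l where "l = d ^ 3"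
  define b where "b = Im \<rho>"
  have l: "0 < l" "l \<le> 1" using d by (auto simp: l_def power_le_one)
  have C0: "C \<ge> 0" using C[of 0] order_trans[OF norm_ge_zero] by simp blast
  have E0: "E \<ge> 0" using E[of 0] d order_trans[OF norm_ge_zero] by simp blast
  have rb: "\<bar>Re \<rho>\<bar> \<le> th * d" "\<bar>b\<bar> \<le> th * d"
    using rho abs_Re_le_cmod[of \<rho>] abs_Im_le_cmod[of \<rho>] by (auto simp: b_def)
  have "th * d \<le> 1 / 4 * d" using th d by (intro mult_right_mono) auto
  then have b1: "\<bar>b\<bar> \<le> d / 4" "\<bar>b\<bar> \<le> 1" using rb(2) d by linarith+
  let ?c = "exp (th\<^sup>2 / (4 * d)) * (E + C * exp (- 9 / (128 * d)))"
  let ?g = "\<lambda>v::real. exp (A * \<bar>v\<bar>) * exp (- (1/8) * v\<^sup>2)"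
  have gi: "integrable lborel ?g" by (rule gaussian_integrable_abs) simp
  have gi': "integrable lborel (\<lambda>v. ?g (b + v))"
    using lborel_integrable_real_affine[OF gi, of 1 b] by simp
  have gI: "(\<integral>v. ?g (b + v) \<partial>lborel) = (\<integral>v. ?g v \<partial>lborel)"
    using lborel_integral_real_affine[of 1 ?g b] by simp
  have bd: "norm (P v * exp ((\<rho> + \<i> * of_real v)\<^sup>2 / (4 * of_real l))) \<le> ?c * exp A * ?g (b + v)" for v
  proof -
    have "Re ((\<rho> + \<i> * of_real v)\<^sup>2 / (4 * of_real l)) = Re ((\<rho> + \<i> * of_real v)\<^sup>2) / (4 * l)"
      using Re_divide_of_real[of "(\<rho> + \<i> * of_real v)\<^sup>2" "4 * l"] by simp
    also have "\<dots> = (Re \<rho>)\<^sup>2 / (4 * l) - (b + v)\<^sup>2 / (4 * l)"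
      by (simp add: power2_eq_square b_def diff_divide_distrib)
    finally have R: "Re ((\<rho> + \<i> * of_real v)\<^sup>2 / (4 * of_real l)) = (Re \<rho>)\<^sup>2 / (4 * l) - (b + v)\<^sup>2 / (4 * l)" .
    have "(Re \<rho>)\<^sup>2 \<le> (th * d)\<^sup>2" using rb(1) abs_le_square_iff[of "Re \<rho>" "th * d"] by auto
    then have "(Re \<rho>)\<^sup>2 / (4 * l) \<le> (th * d)\<^sup>2 / (4 * l)" using l by (simp add: divide_right_mono)
    also have "\<dots> = th\<^sup>2 / (4 * d)" using d by (simp add: l_def power_mult_distrib power2_eq_square power3_eq_cube)
    finally have q1: "(Re \<rho>)\<^sup>2 / (4 * l) \<le> th\<^sup>2 / (4 * d)" .
    have q2: "(b + v)\<^sup>2 / (8 * l) \<ge> (1/8) * (b + v)\<^sup>2"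
      using l mult_right_mono[of l 1 "(b+v)\<^sup>2"] by (simp add: pos_le_divide_eq mult_ac)
    \<comment> \<open>One half of the exponent is spent on the region |v| > d; the other is relaxed
      to (b + v)^2/8, by l <= 1, so that the remaining integral does not depend on
      \<open>d\<close>.\<close>
    have half: "(b + v)\<^sup>2 / (4 * l) = (b + v)\<^sup>2 / (8 * l) + (b + v)\<^sup>2 / (8 * l)" using l by (simp add: field_simps)
    have Pb: "norm (P v) * exp (- ((b + v)\<^sup>2 / (8 * l))) \<le> (E + C * exp (- 9 / (128 * d))) * exp (A * \<bar>v\<bar>)"
    proof (cases "\<bar>v\<bar> \<le> d")
      case True
      have "norm (P v) * exp (- ((b + v)\<^sup>2 / (8 * l))) \<le> E * 1"
        using E[OF True] E0 l by (intro mult_mono) auto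
      also have "\<dots> \<le> (E + C * exp (- 9 / (128 * d))) * exp (A * \<bar>v\<bar>)"
        using E0 C0 A by (intro mult_mono) auto
      finally show ?thesis .
    next
      case False
      then have "\<bar>b + v\<bar> \<ge> 3/4 * d" using b1 by linarith
      then have "(3/4 * d)\<^sup>2 \<le> (b + v)\<^sup>2" using d abs_le_square_iff[of "3/4 * d" "b + v"] by simp
      then have "(3/4 * d)\<^sup>2 / (8 * l) \<le> (b + v)\<^sup>2 / (8 * l)" using l by (simp add: divide_right_mono)
      moreover have "(3/4 * d)\<^sup>2 / (8 * l) = 9 / (128 * d)" using d by (simp add: l_def power_mult_distrib power2_eq_square power3_eq_cube)
      ultimately have "exp (- ((b + v)\<^sup>2 / (8 * l))) \<le> exp (- 9 / (128 * d))" by simp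
      then have "norm (P v) * exp (- ((b + v)\<^sup>2 / (8 * l))) \<le> (C * exp (A * \<bar>v\<bar>)) * exp (- 9 / (128 * d))"
        using C C0 by (intro mult_mono) auto
      also have "\<dots> \<le> (E + C * exp (- 9 / (128 * d))) * exp (A * \<bar>v\<bar>)"
        using E0 by (simp add: algebra_simps)
      finally show ?thesis .
    qed
    have "norm (P v * exp ((\<rho> + \<i> * of_real v)\<^sup>2 / (4 * of_real l))) =
       norm (P v) * exp ((Re \<rho>)\<^sup>2 / (4 * l) - (b + v)\<^sup>2 / (4 * l))" by (simp add: norm_mult R)
    also have "\<dots> = (norm (P v) * exp (- ((b + v)\<^sup>2 / (8 * l)))) * (exp ((Re \<rho>)\<^sup>2 / (4 * l)) * exp (- ((b + v)\<^sup>2 / (8 * l))))"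
    proof -
      have "exp (X - (Y + Y)) = exp (- Y) * (exp X * exp (- Y))" for X Y :: real
        by (simp add: mult_exp_exp)
      then show ?thesis unfolding half by (simp only: mult.assoc)
    qed
    also have "\<dots> \<le> ((E + C * exp (- 9 / (128 * d))) * exp (A * \<bar>v\<bar>)) * (exp (th\<^sup>2 / (4 * d)) * exp (- ((1/8) * (b + v)\<^sup>2)))"
      using q1 q2 E0 C0 by (intro mult_mono[OF Pb] mult_mono) auto
    also have "\<dots> \<le> ((E + C * exp (- 9 / (128 * d))) * (exp A * exp (A * \<bar>b + v\<bar>))) * (exp (th\<^sup>2 / (4 * d)) * exp (- ((1/8) * (b + v)\<^sup>2)))"
    proof -
      have "A * \<bar>v\<bar> \<le> A * (1 + \<bar>b + v\<bar>)" using A b1 by (intro mult_left_mono) auto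
      then have "exp (A * \<bar>v\<bar>) \<le> exp A * exp (A * \<bar>b + v\<bar>)" by (simp add: mult_exp_exp distrib_left)
      then show ?thesis using E0 C0 by (intro mult_right_mono mult_left_mono) auto
    qed
    also have "\<dots> = ?c * exp A * ?g (b + v)" by simp
    finally show ?thesis .
  qed
  have "norm (\<integral>v. P v * exp ((\<rho> + \<i> * of_real v)\<^sup>2 / (4 * of_real l)) \<partial>lborel) \<le> (\<integral>v. ?c * exp A * ?g (b + v) \<partial>lborel)"
  proof (rule order_trans[OF integral_norm_bound integral_mono'])
    show "integrable lborel (\<lambda>v. ?c * exp A * ?g (b + v))" by (intro integrable_mult_right gi')
    show "0 \<le> ?c * exp A * ?g (b + v)" for v using order_trans[OF norm_ge_zero bd] .
  qed (rule bd)
  also have "\<dots> = ?c * exp A * (\<integral>v. ?g v \<partial>lborel)"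
    using gI by simp
  finally show ?thesis by (simp add: l_def)
qed

section \<open>Fourier expansions of periodic functions\<close>

lemma periodic_of_int:
  fixes h :: "complex \<Rightarrow> complex"
  assumes per: "\<And>w. w \<in> upper_half_plane \<Longrightarrow> h (w + of_real L) = h w" and w: "w \<in> upper_half_plane"
  shows "h (w + of_int n * of_real L) = h w"
proof -
  have nat: "h (w + of_nat n * of_real L) = h w" if "w \<in> upper_half_plane" for n w
  proof (induction n)
    case (Suc n)
    have "w + of_nat n * of_real L \<in> upper_half_plane" using that by (simp add: upper_half_plane_def)
    from per[OF this] Suc show ?case by (simp add: algebra_simps)
  qed simp
  show ?thesis
  proof (cases "n \<ge> 0")
    case True
    then show ?thesis using nat[OF w, of "nat n"] by simp
  next
    case False
    have "w + of_int n * of_real L \<in> upper_half_plane" using w by (simp add: upper_half_plane_def)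
    from nat[OF this, of "nat (- n)"] False show ?thesis by simp
  qed
qed

text \<open>Periodicity makes \<open>h\<close> a function of q = exp(2 pi i w/L) in the punctured
  unit disc, whatever branch of the logarithm is chosen. As q tends to 0, Im w tends to infinity and
  \<open>h\<close> to 0, so the singularity is removable with value 0.\<close>

lemma periodic_holomorphic_imp_q_expansion:
  fixes h :: "complex \<Rightarrow> complex"
  assumes hol: "h holomorphic_on upper_half_plane" and L: "L > 0"
    and per: "\<And>w. w \<in> upper_half_plane \<Longrightarrow> h (w + of_real L) = h w"
    and lim: "(h \<longlongrightarrow> 0) (filtercomap Im at_top)"
  obtains F where "F holomorphic_on ball 0 1" "F 0 = 0"
    "\<And>w. w \<in> upper_half_plane \<Longrightarrow> h w = F (exp (2 * of_real pi * \<i> * w / of_real L))"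
proof -
  define e where "e = (\<lambda>w. exp (2 * of_real pi * \<i> * w / of_real L))"
  have eq: "h w = h w'" if "e w = e w'" "w \<in> upper_half_plane" "w' \<in> upper_half_plane" for w w'
  proof -
    from that(1) obtain n :: int where "2 * of_real pi * \<i> * w / of_real L = 2 * of_real pi * \<i> * w' / of_real L + of_int (2 * n) * pi * \<i>"
      unfolding e_def exp_eq by blast
    then have "2 * of_real pi * \<i> * w = 2 * of_real pi * \<i> * (w' + of_int n * of_real L)"
      using L by (simp add: field_simps)
    then have "w = w' + of_int n * of_real L" by simp
    then show ?thesis using periodic_of_int[where h=h and L=L, OF per that(3)] by simp
  qed
  define s where "s = (\<lambda>l. of_real L * l / (2 * of_real pi * \<i>))"
  have es: "e (s l) = exp l" for l using L by (simp add: e_def s_def)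
  have Ims: "Im (s l) = - L * Re l / (2 * pi)" for l
    by (simp add: s_def Im_divide power2_eq_square)
  have s_in: "s l \<in> upper_half_plane" if "Re l < 0" for l
    using that L by (simp add: upper_half_plane_def Ims divide_neg_pos mult_pos_neg)
  define F0 where "F0 = (\<lambda>q. h (s (Ln q)))"
  have Re_neg: "Re (Ln q) < 0" if "q \<in> ball 0 1 - {0}" for q
    using that by (simp add: ln_less_zero)
  have F0_e: "F0 (e w) = h w" if w: "w \<in> upper_half_plane" for w
  proof -
    have "norm (e w) < 1" using w L by (simp add: e_def upper_half_plane_def divide_neg_pos mult_pos_neg)
    then have "s (Ln (e w)) \<in> upper_half_plane" by (intro s_in Re_neg) (auto simp: e_def)
    then show ?thesis unfolding F0_def by (intro eq) (auto simp: es w, auto simp: e_def)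
  qed
  have "F0 field_differentiable at q" if q: "q \<in> ball 0 1 - {0}" for q
  proof (cases "q \<in> \<real>\<^sub>\<le>\<^sub>0")
    case False
    have "(\<lambda>q. h (s (Ln q))) holomorphic_on (ball 0 1 - \<real>\<^sub>\<le>\<^sub>0)"
    proof (rule holomorphic_on_compose_gen[OF _ hol, unfolded o_def])
      show "(\<lambda>q. s (Ln q)) holomorphic_on (ball 0 1 - \<real>\<^sub>\<le>\<^sub>0)"
        unfolding s_def by (intro holomorphic_intros) auto
      show "(\<lambda>q. s (Ln q)) ` (ball 0 1 - \<real>\<^sub>\<le>\<^sub>0) \<subseteq> upper_half_plane"
        by (rule image_subsetI, rule s_in, rule Re_neg) auto
    qed
    then show ?thesis unfolding F0_def
      using False q by (intro holomorphic_on_imp_differentiable_at[of _ "ball 0 1 - \<real>\<^sub>\<le>\<^sub>0"]) auto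
  next
    case True
    \<comment> \<open>On the cut of \<open>Ln\<close> the branch \<open>Ln (- q) + \<i> * pi\<close>
      takes over; it is holomorphic in the left half-disc and yields the same value of
      \<open>h\<close>.\<close>
    let ?U = "{q. Re q < 0} \<inter> ball 0 1"
    have U: "?U \<subseteq> ball 0 1 - {0}" by auto
    have m: "- q \<notin> \<real>\<^sub>\<le>\<^sub>0" if "q \<in> ?U" for q using that by (auto simp: complex_nonpos_Reals_iff)
    have R: "Re (Ln (- q) + \<i> * pi) < 0" if "q \<in> ?U" for q
    proof -
      have "- q \<in> ball 0 1 - {0}" using that by auto
      from Re_neg[OF this] show ?thesis by simp
    qed
    have "(\<lambda>q. h (s (Ln (- q) + \<i> * pi))) holomorphic_on ?U"
    proof (rule holomorphic_on_compose_gen[OF _ hol, unfolded o_def])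
      show "(\<lambda>q. s (Ln (- q) + \<i> * pi)) holomorphic_on ?U"
        unfolding s_def by (intro holomorphic_intros) (use m in auto)
      show "(\<lambda>q. s (Ln (- q) + \<i> * pi)) ` ?U \<subseteq> upper_half_plane"
        by (rule image_subsetI) (rule s_in[OF R])
    qed
    moreover have "h (s (Ln (- q) + \<i> * pi)) = F0 q" if "q \<in> ?U" for q
      unfolding F0_def
    proof (rule eq)
      have "q \<noteq> 0" using that by auto
      then show "e (s (Ln (- q) + \<i> * pi)) = e (s (Ln q))" by (simp add: es exp_add)
      show "s (Ln (- q) + \<i> * pi) \<in> upper_half_plane" by (rule s_in[OF R[OF that]])
      show "s (Ln q) \<in> upper_half_plane" by (rule s_in, rule Re_neg) (use that in auto)
    qed
    ultimately have "F0 holomorphic_on ?U" by (rule holomorphic_transform)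
    moreover have "open ?U" by (intro open_Int open_halfspace_Re_lt open_ball)
    moreover have "q \<in> ?U" using True q by (auto simp: complex_nonpos_Reals_iff complex_eq_iff)
    ultimately show ?thesis by (rule holomorphic_on_imp_differentiable_at)
  qed
  then have F0_hol: "F0 holomorphic_on ball 0 1 - {0}"
    by (auto simp: holomorphic_on_def field_differentiable_at_within)
  have "filterlim (\<lambda>q. s (Ln q)) (filtercomap Im at_top) (at 0)"
  proof (subst filterlim_filtercomap_iff)
    have "filterlim (\<lambda>q::complex. norm q) (at_right 0) (at 0)"
      unfolding filterlim_at
    proof
      show "\<forall>\<^sub>F q in at (0::complex). norm q \<in> {0<..} \<and> norm q \<noteq> 0"
        by (simp add: eventually_at_filter)
      show "((\<lambda>q::complex. norm q) \<longlongrightarrow> 0) (at 0)" by (intro tendsto_norm_zero tendsto_ident_at)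
    qed
    then have "filterlim (\<lambda>q::complex. ln (norm q)) at_bot (at 0)"
      by (rule filterlim_compose[OF ln_at_0])
    then have "filterlim (\<lambda>q::complex. - ln (norm q)) at_top (at 0)"
      by (simp add: filterlim_uminus_at_top)
    then have "filterlim (\<lambda>q::complex. L / (2 * pi) * - ln (norm q)) at_top (at 0)"
      by (intro filterlim_tendsto_pos_mult_at_top[OF tendsto_const]) (use L in auto)
    then have top: "filterlim (\<lambda>q::complex. L / (2 * pi) * - ln (norm q)) at_top (at 0)" .
    have ev: "\<forall>\<^sub>F q in at (0::complex). L / (2 * pi) * - ln (norm q) = (Im \<circ> (\<lambda>q. s (Ln q))) q"
      unfolding eventually_at_filter by (rule always_eventually) (simp add: Ims)
    show "filterlim (Im \<circ> (\<lambda>q. s (Ln q))) at_top (at 0)"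
      using top unfolding filterlim_cong[OF refl refl ev] .
  qed
  then have "F0 \<midarrow>0\<rightarrow> 0" unfolding F0_def by (rule filterlim_compose[OF lim])
  then have "(\<lambda>y. if y = 0 then 0 else F0 y) holomorphic_on ball 0 1"
    by (intro removable_singularity F0_hol) auto
  moreover have "h w = (if exp (2 * of_real pi * \<i> * w / of_real L) = 0 then 0 else F0 (exp (2 * of_real pi * \<i> * w / of_real L)))"
    if "w \<in> upper_half_plane" for w using F0_e[OF that] by (simp add: e_def)
  ultimately show ?thesis by (intro that[of "\<lambda>y. if y = 0 then 0 else F0 y"]) auto
qed

text \<open>Since F(0) = 0, the function F is O(|q|) on the closed disc that corresponds to Im w >=
  y0, and |q| is exactly the exponential in the bound.\<close>

lemma periodic_holomorphic_decay:
  fixes h :: "complex \<Rightarrow> complex"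
  assumes hol: "h holomorphic_on upper_half_plane" and L: "L > 0"
    and per: "\<And>w. w \<in> upper_half_plane \<Longrightarrow> h (w + of_real L) = h w"
    and lim: "(h \<longlongrightarrow> 0) (filtercomap Im at_top)" and y0: "y0 > 0"
  shows "\<exists>C\<ge>0. \<forall>w. Im w \<ge> y0 \<longrightarrow> norm (h w) \<le> C * exp (- 2 * pi * Im w / L)"
proof -
  obtain F where F: "F holomorphic_on ball 0 1" "F 0 = 0"
    "\<And>w. w \<in> upper_half_plane \<Longrightarrow> h w = F (exp (2 * of_real pi * \<i> * w / of_real L))"
    using periodic_holomorphic_imp_q_expansion[OF hol L per lim] by blast
  define r where "r = exp (- 2 * pi * y0 / L)"
  have r: "0 < r" "r < 1" using y0 L by (auto simp: r_def divide_neg_pos)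
  have sub: "cball 0 r \<subseteq> ball (0::complex) 1" using r by auto
  have "deriv F holomorphic_on ball 0 1" by (rule holomorphic_deriv[OF F(1) open_ball])
  then have "compact (deriv F ` cball 0 r)"
    by (intro compact_continuous_image holomorphic_on_imp_continuous_on[OF holomorphic_on_subset[OF _ sub]]) auto
  then obtain B where B: "\<And>z. z \<in> cball 0 r \<Longrightarrow> norm (deriv F z) \<le> B"
    using compact_imp_bounded bounded_iff by (metis imageI)
  have B0: "B \<ge> 0" using B[of 0] r order_trans[OF norm_ge_zero] by simp blast
  have Fb: "norm (F q - F 0) \<le> B * norm (q - 0)" if "q \<in> cball 0 r" for q
  proof (rule field_differentiable_bound[where S="cball 0 r" and f=F and f'="deriv F"])
    fix z :: complex assume "z \<in> cball 0 r"
    then have "F field_differentiable at z"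
      using sub by (intro holomorphic_on_imp_differentiable_at[OF F(1)]) auto
    then have "(F has_field_derivative deriv F z) (at z)" by (simp add: field_differentiable_derivI)
    then show "(F has_field_derivative deriv F z) (at z within cball 0 r)" by (rule has_field_derivative_at_within)
  qed (use B r that in auto)
  show ?thesis
  proof (intro exI[of _ B] conjI B0 allI impI)
    fix w assume w: "Im w \<ge> y0"
    let ?q = "exp (2 * of_real pi * \<i> * w / of_real L)"
    have n: "norm ?q = exp (- 2 * pi * Im w / L)" by simp
    have "norm ?q \<le> r" unfolding n r_def using w L by (simp add: divide_right_mono)
    then have "norm (F ?q) \<le> B * norm ?q" using Fb[of ?q] F(2) by simp
    then show "norm (h w) \<le> B * exp (- 2 * pi * Im w / L)"
      using F(3)[of w] w y0 n by (simp add: upper_half_plane_def)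
  qed
qed

section \<open>Fourth powers of cusp forms of half-integral weight\<close>

lemma Legendre_square:
  "\<not> p dvd a \<Longrightarrow> (Legendre a p)\<^sup>2 = 1"
  by (simp add: Legendre_def cong_0_iff)

lemma prod_mset_Legendre_square:
  "(\<And>p. p \<in># A \<Longrightarrow> \<not> p dvd a) \<Longrightarrow> (\<Prod>p\<in>#A. Legendre a p)\<^sup>2 = 1"
  by (induction A) (auto simp: power_mult_distrib Legendre_square)

lemma Jacobi_square:
  assumes "coprime c d"
  shows "(Jacobi c d)\<^sup>2 = 1"
  unfolding Jacobi_def
proof (rule prod_mset_Legendre_square)
  fix p assume p: "p \<in># prime_factorization d"
  then have "p dvd d" "prime p" by (auto simp: in_prime_factors_iff)
  then show "\<not> p dvd c" using assms by (metis coprime_common_divisor not_prime_unit)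
qed

text \<open>The bottom row of a matrix of determinant 1 is coprime, so no Legendre factor vanishes
  and the symbol is 1 or -1.\<close>

lemma shimura_symbol_square:
  assumes "a * d - b * c = (1::int)"
  shows "(shimura_symbol c d)\<^sup>2 = 1"
proof -
  have "coprime c d"
  proof (rule coprimeI)
    fix e assume "e dvd c" "e dvd d"
    then have "e dvd a * d - b * c" by (intro dvd_diff dvd_mult)
    then show "is_unit e" using assms by simp
  qed
  then have "(Jacobi c \<bar>d\<bar>)\<^sup>2 = 1" by (intro Jacobi_square) simp
  then show ?thesis
    by (cases "d < 0 \<and> c < 0") (simp_all only: shimura_symbol_def if_True if_False power2_minus simp_thms)
qed

lemma frac_lin_denominator_nonzero:
  assumes "a * d - b * c = (1::int)" "Im z > 0"
  shows "of_int c * z + of_int d \<noteq> 0"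
proof
  assume 0: "of_int c * z + of_int d = 0"
  then have "Im (of_int c * z + of_int d) = 0" by simp
  then have "c = 0" using assms by simp
  with 0 have "d = 0" by simp
  with \<open>c = 0\<close> assms show False by simp
qed

lemma Im_frac_lin:
  assumes "a * d - b * c = (1::int)"
  shows "Im (frac_lin a b c d z) = Im z / (norm (of_int c * z + of_int d))\<^sup>2"
proof -
  have "real_of_int a * real_of_int d - real_of_int b * real_of_int c = 1"
    using assms by (metis of_int_1 of_int_diff of_int_mult)
  then have "(of_int c * Re z + of_int d) * (of_int a * Im z) - (of_int a * Re z + of_int b) * (of_int c * Im z) = Im z"
    by (simp add: algebra_simps) algebra
  then show ?thesis
    by (simp add: frac_lin_def Im_divide cmod_power2 algebra_simps)
qed

lemma frac_lin_in_upper_half_plane: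
  assumes "a * d - b * c = (1::int)" "z \<in> upper_half_plane"
  shows "frac_lin a b c d z \<in> upper_half_plane"
  using assms frac_lin_denominator_nonzero[OF assms(1), of z]
  by (simp add: upper_half_plane_def Im_frac_lin)

lemma frac_lin_holomorphic:
  assumes "a * d - b * c = (1::int)"
  shows "frac_lin a b c d holomorphic_on upper_half_plane"
  unfolding frac_lin_def
  by (intro holomorphic_intros) (use frac_lin_denominator_nonzero[OF assms] in \<open>auto simp: upper_half_plane_def\<close>)

text \<open>The fourth power of a form of weight \<open>k + 1/2\<close> is a form of integral weight \<open>4 k + 2\<close> with
  trivial multiplier, so that no branches of the square root occur in the growth estimates.\<close>

definition slash4 :: "nat \<Rightarrow> (complex \<Rightarrow> complex) \<Rightarrow> int \<Rightarrow> int \<Rightarrow> int \<Rightarrow> int \<Rightarrow> complex \<Rightarrow> complex" where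
  "slash4 k f a b c d w = f (frac_lin a b c d w) ^ 4 / (of_int c * w + of_int d) ^ (4 * k + 2)"

lemma csqrt_powi_4: "(csqrt w powi (2 * int k + 1)) ^ 4 = w ^ (4 * k + 2)"
proof -
  have "2 * int k + 1 = int (2 * k + 1)" by simp
  then have "csqrt w powi (2 * int k + 1) = csqrt w ^ (2 * k + 1)" by (simp only: power_int_of_nat)
  moreover have "(2 * k + 1) * 4 = 2 * (4 * k + 2)" by simp
  ultimately have "(csqrt w powi (2 * int k + 1)) ^ 4 = (csqrt w ^ 2) ^ (4 * k + 2)"
    by (metis power_mult)
  then show ?thesis by simp
qed

lemma csqrt_powi_neg_4: "(csqrt w powi (- 2 * int k - 1)) ^ 4 = inverse (w ^ (4 * k + 2))"
proof -
  have "- 2 * int k - 1 = - (2 * int k + 1)" by simp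
  then have "csqrt w powi (- 2 * int k - 1) = inverse (csqrt w powi (2 * int k + 1))"
    by (simp only: power_int_minus)
  then show ?thesis using csqrt_powi_4[of w k] by (simp add: power_inverse)
qed

lemma theta_eps_powi_4: "(theta_eps d powi n) ^ 4 = 1"
proof -
  have "theta_eps d ^ 4 = 1" by (simp add: theta_eps_def)
  moreover have "(theta_eps d powi n) ^ 4 = (theta_eps d ^ 4) powi n"
    by (metis power_int_of_nat power_int_mult mult.commute)
  ultimately show ?thesis by simp
qed

text \<open>The level is any positive integer here; that it is a square enters through the
  hypotheses of \<open>cusp_decay_rational\<close> and \<open>P_cusp_decay\<close>.\<close>

locale half_integral_cusp_form =
  fixes k M :: nat and f :: "complex \<Rightarrow> complex"
  assumes form: "f \<in> half_cusp_forms k M" and M_pos: "M > 0"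
begin

lemma holo: "f holomorphic_on upper_half_plane"
  using form by (simp add: half_cusp_forms_def)

lemma transform:
  "a * d - b * c = 1 \<Longrightarrow> int M dvd c \<Longrightarrow> z \<in> upper_half_plane \<Longrightarrow>
   f (frac_lin a b c d z) =
     of_int (shimura_symbol c d) ^ (2 * k + 1) * theta_eps d powi (- 2 * int k - 1) *
     csqrt (of_int c * z + of_int d) powi (2 * int k + 1) * f z"
  using form unfolding half_cusp_forms_def by blast

lemma vanishes:
  "a * d - b * c = 1 \<Longrightarrow>
   ((\<lambda>z. csqrt (of_int c * z + of_int d) powi (- 2 * int k - 1) * f (frac_lin a b c d z)) \<longlongrightarrow> 0)
     (filtercomap Im at_top)"
  using form unfolding half_cusp_forms_def vanishes_at_cusps_def by blast

lemma transform_4: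
  assumes "a * d - b * c = 1" "int M dvd c" "z \<in> upper_half_plane"
  shows "f (frac_lin a b c d z) ^ 4 = (of_int c * z + of_int d) ^ (4 * k + 2) * f z ^ 4"
proof -
  have "(of_int (shimura_symbol c d) ^ (2 * k + 1) :: complex) ^ 4 = of_int (((shimura_symbol c d)\<^sup>2) ^ (2 * (2 * k + 1)))"
    unfolding of_int_power power_mult[symmetric] by (rule arg_cong[where f="power _"]) simp
  then have "(of_int (shimura_symbol c d) ^ (2 * k + 1) :: complex) ^ 4 = 1"
    using shimura_symbol_square[OF assms(1)] by simp
  then show ?thesis
    unfolding transform[OF assms] power_mult_distrib theta_eps_powi_4 csqrt_powi_4 by simp
qed

lemma slash4_vanishes:
  assumes "a * d - b * c = 1"
  shows "(slash4 k f a b c d \<longlongrightarrow> 0) (filtercomap Im at_top)"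
proof -
  have "((\<lambda>z. (csqrt (of_int c * z + of_int d) powi (- 2 * int k - 1) * f (frac_lin a b c d z)) ^ 4) \<longlongrightarrow> 0 ^ 4)
     (filtercomap Im at_top)"
    by (intro tendsto_power vanishes assms)
  then show ?thesis
    unfolding power_mult_distrib csqrt_powi_neg_4 slash4_def[abs_def] by (simp add: field_simps)
qed

lemma slash4_holomorphic:
  assumes "a * d - b * c = 1"
  shows "slash4 k f a b c d holomorphic_on upper_half_plane"
proof -
  have "(\<lambda>w. f (frac_lin a b c d w)) holomorphic_on upper_half_plane"
    by (rule holomorphic_on_compose_gen[OF frac_lin_holomorphic[OF assms] holo, unfolded o_def])
      (use frac_lin_in_upper_half_plane[OF assms] in auto)
  then show ?thesis
    unfolding slash4_def[abs_def]
    by (intro holomorphic_intros) (use frac_lin_denominator_nonzero[OF assms] in \<open>auto simp: upper_half_plane_def\<close>)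
qed

text \<open>The first matrix times the inverse of the second is (A, B; C, D), and C = c d' - d c' is
  divisible by \<open>M\<close>. By \<open>transform_4\<close> and the cocycle relation of c z + d
  the two functions agree, so only finitely many functions \<open>slash4 k f a b c d\<close> occur
  on the upper half-plane.\<close>

lemma slash4_cong:
  assumes 1: "a * d - b * c = 1" and 2: "a' * d' - b' * c' = 1"
    and c: "[c = c'] (mod int M)" and d: "[d = d'] (mod int M)" and w: "w \<in> upper_half_plane"
  shows "slash4 k f a b c d w = slash4 k f a' b' c' d' w"
proof -
  define A B C D where "A = a * d' - b * c'" and "B = b * a' - a * b'" and "C = c * d' - d * c'" and "D = d * a' - c * b'"
  have "A * D - B * C = (a * d - b * c) * (a' * d' - b' * c')"
    by (simp add: A_def B_def C_def D_def algebra_simps)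
  then have det: "A * D - B * C = 1" using 1 2 by simp
  have "[c * d' = c' * d] (mod int M)" using c d by (intro cong_mult) (auto simp: cong_sym)
  then have MC: "int M dvd C" by (simp add: C_def cong_iff_dvd_diff mult.commute)
  define v where "v = frac_lin a' b' c' d' w"
  have v: "v \<in> upper_half_plane" unfolding v_def by (rule frac_lin_in_upper_half_plane[OF 2 w])
  have nz: "of_int c' * w + of_int d' \<noteq> 0" "of_int c * w + of_int d \<noteq> 0"
    using frac_lin_denominator_nonzero[OF 2] frac_lin_denominator_nonzero[OF 1] w by (auto simp: upper_half_plane_def)
  have det': "of_int a' * of_int d' - of_int b' * of_int c' = (1::complex)"
    using 2 by (metis of_int_1 of_int_diff of_int_mult)
  have v': "v * (of_int c' * w + of_int d') = of_int a' * w + of_int b'"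
    using nz by (simp add: v_def frac_lin_def)
  have "(of_int C * v + of_int D) * (of_int c' * w + of_int d') = of_int C * (of_int a' * w + of_int b') + of_int D * (of_int c' * w + of_int d')"
    using v' by (simp add: distrib_right mult.assoc)
  also have "\<dots> = (of_int a' * of_int d' - of_int b' * of_int c') * (of_int c * w + of_int d)"
    by (simp add: C_def D_def algebra_simps)
  finally have j: "(of_int C * v + of_int D) * (of_int c' * w + of_int d') = of_int c * w + of_int d" using det' by simp
  have "(of_int A * v + of_int B) * (of_int c' * w + of_int d') = of_int A * (of_int a' * w + of_int b') + of_int B * (of_int c' * w + of_int d')"
    using v' by (simp add: distrib_right mult.assoc)
  also have "\<dots> = (of_int a' * of_int d' - of_int b' * of_int c') * (of_int a * w + of_int b)"
    by (simp add: A_def B_def algebra_simps)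
  finally have n: "(of_int A * v + of_int B) * (of_int c' * w + of_int d') = of_int a * w + of_int b" using det' by simp
  have "frac_lin A B C D v = frac_lin a b c d w"
    unfolding frac_lin_def using nz by (simp flip: j n)
  then have "f (frac_lin a b c d w) ^ 4 = (of_int C * v + of_int D) ^ (4 * k + 2) * f v ^ 4"
    using transform_4[OF det MC v] by simp
  then show ?thesis
    unfolding slash4_def v_def[symmetric] j[symmetric] power_mult_distrib
    using nz j by (auto simp: divide_simps)
qed

text \<open>Translation by \<open>M\<close> changes the bottom row to (c, c M + d), which is
  congruent to (c, d).\<close>

lemma slash4_periodic:
  assumes "a * d - b * c = 1" and w: "w \<in> upper_half_plane"
  shows "slash4 k f a b c d (w + of_real (real M)) = slash4 k f a b c d w"
proof -
  have "slash4 k f a b c d (w + of_real (real M)) = slash4 k f a (a * int M + b) c (c * int M + d) w"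
    by (simp add: slash4_def frac_lin_def algebra_simps)
  also have "\<dots> = slash4 k f a b c d w"
    by (rule slash4_cong[OF _ assms(1) _ _ w]) (use assms in \<open>auto simp: algebra_simps cong_iff_dvd_diff\<close>)
  finally show ?thesis .
qed

lemma slash4_decay:
  assumes "a * d - b * c = 1" "y0 > 0"
  shows "\<exists>C\<ge>0. \<forall>w. Im w \<ge> y0 \<longrightarrow> norm (slash4 k f a b c d w) \<le> C * exp (- 2 * pi * Im w / M)"
  using slash4_periodic[OF assms(1)] M_pos
  by (intro periodic_holomorphic_decay slash4_holomorphic slash4_vanishes assms) auto

text \<open>By \<open>slash4_cong\<close> one representative for each pair (c, d) modulo
  \<open>M\<close> suffices, and each is bounded by \<open>slash4_decay\<close>. The height 1/5 is
  the one reached in \<open>polynomial_growth_4\<close>.\<close>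

lemma slash4_bounded:
  "\<exists>B\<ge>0. \<forall>a b c d w. a * d - b * c = 1 \<longrightarrow> Im w \<ge> 1/5 \<longrightarrow> norm (slash4 k f a b c d w) \<le> B"
proof -
  have ex: "\<exists>B\<ge>0. \<forall>a b c d w. a * d - b * c = 1 \<and> c mod int M = p \<and> d mod int M = q \<longrightarrow> Im w \<ge> 1/5 \<longrightarrow>
     norm (slash4 k f a b c d w) \<le> B" for p q
  proof (cases "\<exists>a b c d. a * d - b * c = 1 \<and> c mod int M = p \<and> d mod int M = q")
    case True
    then obtain a b c d where abcd: "a * d - b * c = 1" "c mod int M = p" "d mod int M = q" by blast
    from slash4_decay[OF abcd(1), of "1/5"] obtain C where
      C: "C \<ge> 0" "\<And>w. Im w \<ge> 1/5 \<Longrightarrow> norm (slash4 k f a b c d w) \<le> C * exp (- 2 * pi * Im w / M)" by auto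
    show ?thesis
    proof (intro exI[of _ C] conjI C(1) allI impI)
      fix a' b' c' d' w assume h: "a' * d' - b' * c' = 1 \<and> c' mod int M = p \<and> d' mod int M = q" and w: "Im w \<ge> 1/5"
      have "slash4 k f a' b' c' d' w = slash4 k f a b c d w"
        using h abcd w by (intro slash4_cong) (auto simp: cong_def upper_half_plane_def)
      also have "norm \<dots> \<le> C * exp (- 2 * pi * Im w / M)" by (rule C(2)[OF w])
      also have "\<dots> \<le> C * 1" using C(1) w by (intro mult_left_mono) (auto intro!: divide_nonpos_nonneg)
      finally show "norm (slash4 k f a' b' c' d' w) \<le> C" by simp
    qed
  next
    case False
    then show ?thesis by (intro exI[of _ 0]) auto
  qed
  obtain B where B: "\<And>p q. B p q \<ge> 0" "\<And>p q a b c d w. a * d - b * c = 1 \<Longrightarrow> c mod int M = p \<Longrightarrow> d mod int M = q \<Longrightarrow> Im w \<ge> 1/5 \<Longrightarrow>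
     norm (slash4 k f a b c d w) \<le> B p q"
    using ex by metis
  let ?R = "{0..<int M} \<times> {0..<int M}"
  let ?B = "\<Sum>x\<in>?R. B (fst x) (snd x)"
  show ?thesis
  proof (intro exI[of _ ?B] conjI allI impI)
    show "?B \<ge> 0" by (intro sum_nonneg B(1))
    fix a b c d w assume h: "a * d - b * c = (1::int)" "Im w \<ge> 1/5"
    have "norm (slash4 k f a b c d w) \<le> B (fst (c mod int M, d mod int M)) (snd (c mod int M, d mod int M))"
      using B(2)[OF h(1) refl refl h(2)] by simp
    also have "\<dots> \<le> ?B"
      using M_pos B(1) by (intro member_le_sum[of "(c mod int M, d mod int M)" ?R "\<lambda>x. B (fst x) (snd x)"]) auto
    finally show "norm (slash4 k f a b c d w) \<le> ?B" .
  qed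
qed

text \<open>Dirichlet approximation yields \<open>(c, d)\<close> with \<open>|c z + d|\<^sup>2 \<le> 5 Im z\<close>. Completed to a matrix, this pair moves
  \<open>z\<close> into \<open>Im w \<ge> 1/5\<close>, so that no fundamental domain is needed.\<close>

lemma polynomial_growth_4:
  "\<exists>B\<ge>0. \<forall>z. Im z > 0 \<longrightarrow> norm (f z) ^ 4 \<le> B * (1 + (1 / Im z) ^ (4 * k + 2))"
proof -
  from slash4_bounded obtain B where B: "B \<ge> 0"
    "\<And>a b c d w. a * d - b * c = 1 \<Longrightarrow> Im w \<ge> 1/5 \<Longrightarrow> norm (slash4 k f a b c d w) \<le> B" by blast
  have "norm (f z) ^ 4 \<le> B * (1 + (1 / Im z) ^ (4 * k + 2))" if y: "Im z > 0" for z
  proof (cases "Im z \<ge> 1/5")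
    case True
    have "norm (f z) ^ 4 = norm (slash4 k f 1 0 0 1 z)" by (simp add: slash4_def frac_lin_def norm_power)
    also have "\<dots> \<le> B * 1" using B(2)[of 1 1 0 0 z] True by simp
    also have "\<dots> \<le> B * (1 + (1 / Im z) ^ (4 * k + 2))" using B(1) y by (intro mult_left_mono) auto
    finally show ?thesis .
  next
    case False
    define y where "y = Im z"
    have y: "0 < y" "y < 1/5" using that False by (auto simp: y_def)
    \<comment> \<open>This size balances the two parts of |c z + d|^2: c <= 1/sqrt y gives (c y)^2
      <= y, and the approximation error 1/n <= 2 sqrt y contributes at most 4 y.\<close>
    define n where "n = nat \<lfloor>1 / sqrt y\<rfloor>"
    have sy: "0 < sqrt y" "sqrt y < 1" using y real_sqrt_lt_1_iff[of y] by auto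
    then have 1: "1 < 1 / sqrt y" by simp
    then have "\<lfloor>1 / sqrt y\<rfloor> \<ge> 1" by linarith
    then have n: "n > 0" "real n \<le> 1 / sqrt y" "1 / sqrt y < real n + 1"
      unfolding n_def by linarith+
    have "1 / sqrt y \<le> 2 * real n" using n 1 by linarith
    then have n2: "1 / real n \<le> 2 * sqrt y" using sy n(1) by (simp add: field_simps)
    obtain h c where hc: "coprime h c" "0 < c" "c \<le> int n" "\<bar>of_int c * Re z - of_int h\<bar> < 1 / real n"
      using Dirichlet_approx_coprime[OF n(1), of "Re z"] by blast
    obtain u v where uv: "u * h + v * c = 1" using bezout_int[of h c] hc(1) by auto
    define a b d where "a = - u" and "b = - v" and "d = - h"
    have det: "a * d - b * c = 1" using uv by (simp add: a_def b_def d_def)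
    have det': "d * a - (- b) * (- c) = 1" using det by (simp add: mult.commute)
    define j where "j = of_int c * z + of_int d"
    have j0: "j \<noteq> 0" unfolding j_def by (rule frac_lin_denominator_nonzero[OF det that])
    have "real_of_int c \<le> 1 / sqrt y" using hc(3) n(2) by linarith
    then have "of_int c * sqrt y \<le> 1" using sy by (simp add: field_simps)
    then have "(of_int c * sqrt y)\<^sup>2 \<le> 1\<^sup>2" using hc(2) sy by (intro power_mono) auto
    then have "(of_int c)\<^sup>2 * y \<le> 1" using y by (simp add: power_mult_distrib)
    then have "(of_int c)\<^sup>2 * y * y \<le> 1 * y" using y by (intro mult_right_mono) auto
    then have cy: "(of_int c * y)\<^sup>2 \<le> y" by (simp add: power2_eq_square mult_ac)
    have "\<bar>of_int c * Re z + of_int d\<bar> \<le> 2 * sqrt y" using hc(4) n2 by (simp add: d_def)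
    then have "(of_int c * Re z + of_int d)\<^sup>2 \<le> (2 * sqrt y)\<^sup>2"
      using abs_le_square_iff[of "of_int c * Re z + of_int d" "2 * sqrt y"] sy by auto
    then have "(norm j)\<^sup>2 \<le> 5 * y"
      using cy y by (simp add: cmod_power2 j_def y_def[symmetric] power_mult_distrib)
    moreover have nj: "(norm j)\<^sup>2 > 0" using j0 by simp
    ultimately have "1 / 5 \<le> y / (norm j)\<^sup>2" by (simp add: field_simps)
    define w where "w = frac_lin a b c d z"
    have w: "Im w \<ge> 1/5"
      using \<open>1 / 5 \<le> y / (norm j)\<^sup>2\<close> by (simp add: w_def Im_frac_lin[OF det] j_def y_def)
    have detc: "of_int a * of_int d - of_int b * of_int c = (1::complex)"
      using det by (metis of_int_1 of_int_diff of_int_mult)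
    have wj: "w * j = of_int a * z + of_int b" using j0 by (simp add: w_def frac_lin_def j_def)
    have "(- of_int c * w + of_int a) * j = - of_int c * (w * j) + of_int a * j" by (simp add: algebra_simps)
    also have "\<dots> = of_int a * of_int d - of_int b * of_int c" unfolding wj by (simp add: j_def algebra_simps)
    finally have den: "- of_int c * w + of_int a = 1 / j" using detc j0 by (simp add: field_simps)
    have "(of_int d * w - of_int b) * j = of_int d * (w * j) - of_int b * j" by (simp add: algebra_simps)
    also have "\<dots> = (of_int a * of_int d - of_int b * of_int c) * z" unfolding wj by (simp add: j_def algebra_simps)
    finally have num: "of_int d * w - of_int b = z / j" using detc j0 by (simp add: field_simps)
    \<comment> \<open>The inverse matrix carries \<open>w\<close> back to \<open>z\<close> with
      automorphy factor 1/j, so the uniform bound at \<open>w\<close> controls |f(z)|^4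
      |j|^(4k+2).\<close>
    have fl: "frac_lin d (- b) (- c) a w = z"
      using num den j0 by (simp add: frac_lin_def)
    have "slash4 k f d (- b) (- c) a w = f z ^ 4 * j ^ (4 * k + 2)"
      unfolding slash4_def fl of_int_minus den power_one_over using j0 by simp
    then have "norm (f z) ^ 4 * norm j ^ (4 * k + 2) \<le> B"
      using B(2)[OF det' w] by (simp add: norm_mult norm_power)
    then have fz: "norm (f z) ^ 4 \<le> B * (1 / norm j) ^ (4 * k + 2)"
      using j0 by (simp add: field_simps power_one_over)
    \<comment> \<open>A lower bound for |j| is needed now; c >= 1 gives |j| >= Im j = c y >=
      y.\<close>
    have "1 * y \<le> of_int c * y" using hc(2) y by (intro mult_right_mono) auto
    also have "\<dots> = Im j" by (simp add: j_def y_def)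
    also have "\<dots> \<le> norm j" by (rule order_trans[OF abs_ge_self abs_Im_le_cmod])
    finally have "1 / norm j \<le> 1 / y" using y by (simp add: frac_le)
    then have "(1 / norm j) ^ (4 * k + 2) \<le> (1 / y) ^ (4 * k + 2)" by (intro power_mono) auto
    then have "B * (1 / norm j) ^ (4 * k + 2) \<le> B * (1 + (1 / y) ^ (4 * k + 2))"
      using B(1) by (intro mult_left_mono) auto
    with fz show ?thesis by (simp add: y_def)
  qed
  then show ?thesis using B(1) by blast
qed

text \<open>The matrix (e, 0; c, e) has determinant e^2 = 1 and maps infinity to e/c. The preimage
  \<open>w\<close> of e/c + z has height Im z/(c |z|)^2 and automorphy factor -1/(c z), so this is
  \<open>slash4_decay\<close> at \<open>w\<close>.\<close>

lemma cusp_decay_4: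
  fixes e c :: int
  assumes e: "e = 1 \<or> e = - 1" and c: "c > 0"
  shows "\<exists>B\<ge>0. \<forall>z. 1 \<le> Im z / (of_int c * norm z)\<^sup>2 \<longrightarrow>
    norm (f (of_int e / of_int c + z)) ^ 4 * (of_int c * norm z) ^ (4 * k + 2)
      \<le> B * exp (- 2 * pi * (Im z / (of_int c * norm z)\<^sup>2) / M)"
proof -
  have e2: "e * e = 1" using e by auto
  have det: "e * e - 0 * c = 1" using e2 by simp
  have e2c: "of_int e * of_int e = (1::complex)" using e2 by (metis of_int_1 of_int_mult)
  from slash4_decay[OF det, of 1] obtain B where B: "B \<ge> 0"
    "\<And>w. Im w \<ge> 1 \<Longrightarrow> norm (slash4 k f e 0 c e w) \<le> B * exp (- 2 * pi * Im w / M)" by auto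
  show ?thesis
  proof (intro exI[of _ B] conjI B(1) allI impI)
    fix z :: complex
    assume z: "1 \<le> Im z / (of_int c * norm z)\<^sup>2"
    then have z0: "z \<noteq> 0" by auto
    define w where "w = - 1 / ((of_int c)\<^sup>2 * z) - of_int e / of_int c"
    have "- 1 / ((of_int c)\<^sup>2 * z) = of_real (1 / (of_int c)\<^sup>2) * (- inverse z)"
      using z0 c by (simp add: field_simps)
    then have "Im w = 1 / (of_int c)\<^sup>2 * (Im z / (norm z)\<^sup>2)"
      by (simp add: w_def cmod_power2 del: of_real_divide)
    then have Imw: "Im w = Im z / (of_int c * norm z)\<^sup>2" by (simp add: power_mult_distrib)
    have den: "of_int c * w + of_int e = - 1 / (of_int c * z)"
      using c z0 by (simp add: w_def field_simps power2_eq_square)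
    have "of_int e * w = - 1 / (of_int c * z) * (of_int e / of_int c + of_int e * of_int e * z)"
      using c z0 e2c by (simp add: w_def field_simps power2_eq_square)
    then have num: "of_int e * w = - 1 / (of_int c * z) * (of_int e / of_int c + z)" using e2c by simp
    have "frac_lin e 0 c e w = of_int e / of_int c + z"
      unfolding frac_lin_def den using num c z0 by simp
    then have "slash4 k f e 0 c e w = f (of_int e / of_int c + z) ^ 4 / (- 1 / (of_int c * z)) ^ (4 * k + 2)"
      unfolding slash4_def den by simp
    then have "norm (slash4 k f e 0 c e w) = norm (f (of_int e / of_int c + z)) ^ 4 * (of_int c * norm z) ^ (4 * k + 2)"
      using c by (simp add: norm_divide norm_mult norm_power power_divide)
    then show "norm (f (of_int e / of_int c + z)) ^ 4 * (of_int c * norm z) ^ (4 * k + 2)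
      \<le> B * exp (- 2 * pi * (Im z / (of_int c * norm z)\<^sup>2) / M)"
      using B(2)[of w] z by (simp add: Imw)
  qed
qed

end

section \<open>Fourier coefficients and Mellin transforms\<close>

text \<open>What the Fourier expansion and the Mellin transform use, isolated so that it applies
  both to \<open>f\<close> and to its Fricke image. Any polynomial growth exponent \<open>A\<close>
  will do.\<close>

locale periodic_cusp_function =
  fixes h :: "complex \<Rightarrow> complex" and A :: nat and B :: real
  assumes hol: "h holomorphic_on upper_half_plane"
    and per: "\<And>w. w \<in> upper_half_plane \<Longrightarrow> h (w + 1) = h w"
    and lim: "(h \<longlongrightarrow> 0) (filtercomap Im at_top)"
    and growth: "\<And>z. Im z > 0 \<Longrightarrow> norm (h z) \<le> B * (1 + (1 / Im z) ^ A)"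
begin

lemma q_expansion:
  obtains F where "F holomorphic_on ball 0 1" "F 0 = 0"
    "\<And>w. w \<in> upper_half_plane \<Longrightarrow> h w = F (exp (2 * of_real pi * \<i> * w))"
  using periodic_holomorphic_imp_q_expansion[OF hol, of 1] per lim by auto

lemma decay:
  "y0 > 0 \<Longrightarrow> \<exists>C\<ge>0. \<forall>w. Im w \<ge> y0 \<longrightarrow> norm (h w) \<le> C * exp (- 2 * pi * Im w)"
  using periodic_holomorphic_decay[OF hol, of 1 y0] per lim by simp

lemma B_nonneg: "B \<ge> 0"
proof -
  have "0 \<le> B * (1 + (1 / Im \<i>) ^ A)" by (rule order_trans[OF norm_ge_zero growth]) simp
  then show ?thesis by simp
qed

lemma surj_exp_disc:
  assumes "q \<in> ball 0 1" "q \<noteq> 0"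
  obtains w where "w \<in> upper_half_plane" "exp (2 * of_real pi * \<i> * w) = q" "Im w = - ln (norm q) / (2 * pi)"
proof
  let ?w = "Ln q / (2 * of_real pi * \<i>)"
  show Im: "Im ?w = - ln (norm q) / (2 * pi)" using assms by (simp add: Im_divide power2_eq_square)
  show "?w \<in> upper_half_plane"
    using assms ln_less_zero[of "norm q"] by (simp add: upper_half_plane_def Im divide_neg_pos)
  show "exp (2 * of_real pi * \<i> * ?w) = q" using assms by simp
qed

lemma
  shows fourier_coeff_0: "fourier_coeff h 0 = 0"
    and fourier_coeff_sums: "z \<in> upper_half_plane \<Longrightarrow>
      (\<lambda>n. fourier_coeff h n * exp (2 * of_real pi * \<i> * of_nat n * z)) sums h z"
    and fourier_coeff_bound: "n > 0 \<Longrightarrow> norm (fourier_coeff h n) \<le> 2 * B * exp (2 * pi) * real n ^ A"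
proof -
  obtain F where F: "F holomorphic_on ball 0 1" "F 0 = 0"
    "\<And>w. w \<in> upper_half_plane \<Longrightarrow> h w = F (exp (2 * of_real pi * \<i> * w))"
    using q_expansion by blast
  define a where "a = (\<lambda>n. (deriv ^^ n) F 0 / fact n)"
  let ?P = "\<lambda>a. a 0 = 0 \<and> (\<forall>z\<in>upper_half_plane. (\<lambda>n. a n * exp (2 * of_real pi * \<i> * of_nat n * z)) sums h z)"
  have en: "exp (2 * of_real pi * \<i> * of_nat n * z) = exp (2 * of_real pi * \<i> * z) ^ n" for n z
    by (simp add: exp_of_nat_mult[symmetric] mult_ac)
  have Pa: "?P a"
  proof (intro conjI ballI)
    show "a 0 = 0" by (simp add: a_def F)
    fix z :: complex assume z: "z \<in> upper_half_plane"
    have "exp (2 * of_real pi * \<i> * z) \<in> ball 0 1" using z by (simp add: upper_half_plane_def)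
    from holomorphic_power_series[OF F(1) this]
    show "(\<lambda>n. a n * exp (2 * of_real pi * \<i> * of_nat n * z)) sums h z"
      using F(3)[OF z] by (simp add: a_def en)
  qed
  \<comment> \<open>Every q in the punctured disc comes from the upper half-plane, so any admissible
    \<open>b\<close> is the Taylor series of the same \<open>F\<close>; at q = 0 the convention
    \<open>b 0 = 0\<close> matches F(0) = 0.\<close>
  have uniq: "b = a" if b: "?P b" for b
  proof
    fix n
    have "b n = (deriv ^^ n) F 0 / fact n"
    proof (rule coefficient_eq_deriv_over_fact[of 1])
      fix q :: complex assume q: "q \<in> ball 0 1"
      show "(\<lambda>n. b n * (q - 0) ^ n) sums F q"
      proof (cases "q = 0")
        case True
        then show ?thesis using b F(2) powser_sums_zero[of b] by simp
      next
        case False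
        obtain w where w: "w \<in> upper_half_plane" "exp (2 * of_real pi * \<i> * w) = q"
          using surj_exp_disc[OF q False] by blast
        have "(\<lambda>n. b n * exp (2 * of_real pi * \<i> * of_nat n * w)) sums h w" using b w(1) by blast
        then show ?thesis unfolding en w(2) F(3)[OF w(1)] by simp
      qed
    qed simp
    then show "b n = a n" by (simp add: a_def)
  qed
  have fc: "fourier_coeff h = a"
    unfolding fourier_coeff_def by (rule the_equality[of ?P, OF Pa uniq])
  show "fourier_coeff h 0 = 0" using Pa fc by simp
  show "z \<in> upper_half_plane \<Longrightarrow> (\<lambda>n. fourier_coeff h n * exp (2 * of_real pi * \<i> * of_nat n * z)) sums h z"
    using Pa fc by simp
  assume n: "n > 0"
  \<comment> \<open>Hecke's choice: this circle is the height Im w = 1/n, where the growth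
    hypothesis gives n^A, while r^n = exp(-2 pi) is independent of \<open>n\<close>.\<close>
  define r where "r = exp (- (2 * pi / n))"
  have r: "0 < r" "r < 1" using n by (auto simp: r_def)
  have "norm ((deriv ^^ n) F 0) \<le> fact n * (2 * B * real n ^ A) / r ^ n"
  proof (rule Cauchy_inequality)
    show "F holomorphic_on ball 0 r" by (rule holomorphic_on_subset[OF F(1)]) (use r in auto)
    show "continuous_on (cball 0 r) F"
      by (rule holomorphic_on_imp_continuous_on, rule holomorphic_on_subset[OF F(1)]) (use r in auto)
    fix q :: complex assume "norm (0 - q) = r"
    then have nq: "norm q = r" by simp
    have q: "q \<in> ball 0 1" "q \<noteq> 0" using nq r by auto
    obtain w where w: "w \<in> upper_half_plane" "exp (2 * of_real pi * \<i> * w) = q" "Im w = - ln (norm q) / (2 * pi)"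
      by (rule surj_exp_disc[OF q])
    have Iw: "Im w = 1 / n" unfolding w(3) nq r_def by simp
    have "norm (F q) \<le> B * (1 + real n ^ A)"
      using growth[of w] F(3)[OF w(1)] w(2) Iw n by (simp add: power_one_over)
    also have "\<dots> \<le> B * (2 * real n ^ A)"
      using B_nonneg one_le_power[of "real n" A] n by (intro mult_left_mono) auto
    finally show "norm (F q) \<le> 2 * B * real n ^ A" by simp
  qed (use r in auto)
  then have "norm ((deriv ^^ n) F 0) / fact n \<le> (fact n * (2 * B * real n ^ A) / r ^ n) / fact n"
    by (rule divide_right_mono) simp
  then have "norm (a n) \<le> 2 * B * real n ^ A / r ^ n"
    by (simp add: a_def norm_divide)
  also have "r ^ n = exp (- 2 * pi)" unfolding r_def using n by (simp add: exp_of_nat_mult[symmetric])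
  finally show "norm (fourier_coeff h n) \<le> 2 * B * exp (2 * pi) * real n ^ A"
    by (simp add: fc exp_minus field_simps)
qed

end

section \<open>Mellin transforms and the entire continuation of the Dirichlet series\<close>

lemma Gamma_integral_exp:
  assumes s: "Re s > 0"
  shows "has_bochner_integral lborel (\<lambda>u::real. exp (s * of_real u - of_real (exp u))) (Gamma s)"
proof -
  let ?f = "\<lambda>t. complex_of_real t powr (s - 1) / of_real (exp t)"
  \<comment> \<open>The substitution t = exp u in Euler's integral turns the Mellin transform into a
    Laplace transform over the whole line.\<close>
  have "range exp = {0::real<..}" by (auto simp: image_iff intro: exp_ln[symmetric])
  then have 1: "?f absolutely_integrable_on range exp \<and> integral (range exp) ?f = Gamma s"
    using absolutely_integrable_Gamma_integral'[OF s] Gamma_integral_complex'[OF s] by (simp add: integral_unique)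
  have 2: "(\<lambda>x. \<bar>exp x\<bar> *\<^sub>R ?f (exp x)) absolutely_integrable_on UNIV \<and> integral UNIV (\<lambda>x. \<bar>exp x\<bar> *\<^sub>R ?f (exp x)) = Gamma s"
    by (subst has_absolute_integral_change_of_variables_real[where g=exp and S=UNIV])
      (use 1 in \<open>auto intro!: derivative_eq_intros simp: inj_on_def\<close>)
  have e: "\<bar>exp x\<bar> *\<^sub>R ?f (exp x) = exp (s * of_real x - of_real (exp x))" for x :: real
  proof -
    have "complex_of_real (exp x) powr (s - 1) = exp ((s - 1) * of_real x)"
      by (simp add: powr_def Ln_of_real)
    then show ?thesis
      by (simp add: scaleR_conv_of_real exp_diff exp_of_real algebra_simps exp_minus divide_simps)
  qed
  have m: "(\<lambda>x::real. exp (s * of_real x - of_real (exp x))) \<in> borel_measurable lborel" by measurable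
  have 3: "integrable lebesgue (\<lambda>x::real. exp (s * of_real x - of_real (exp x)))"
    using 2 unfolding e set_integrable_def by simp
  have "(LINT x|lebesgue. exp (s * of_real x - of_real (exp x))) = Gamma s"
    using 2 set_lebesgue_integral_eq_integral(2)[of UNIV "\<lambda>x::real. exp (s * of_real x - of_real (exp x))"]
    unfolding e set_lebesgue_integral_def by simp
  with 3 show ?thesis
    using integrable_completion[OF m] integral_completion[OF m] by (simp add: has_bochner_integral_iff)
qed

lemma Gamma_integral_exp_scaled:
  assumes s: "Re s > 0" and l: "l > 0"
  shows "has_bochner_integral lborel (\<lambda>u::real. exp (s * of_real u - of_real (l * exp u))) (of_real l powr (- s) * Gamma s)"
proof -
  have "has_bochner_integral lborel (\<lambda>u::real. exp (s * of_real (ln l + 1 * u) - of_real (exp (ln l + 1 * u)))) (Gamma s /\<^sub>R \<bar>1\<bar>)"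
    by (rule lborel_has_bochner_integral_real_affine_iff[THEN iffD1, OF _ Gamma_integral_exp[OF s]]) simp
  then have "has_bochner_integral lborel (\<lambda>u::real. of_real l powr (- s) * exp (s * of_real (ln l + 1 * u) - of_real (exp (ln l + 1 * u)))) (of_real l powr (- s) * Gamma s)"
    by (intro has_bochner_integral_mult_right) simp
  moreover have "of_real l powr (- s) * exp (s * of_real (ln l + 1 * u) - of_real (exp (ln l + 1 * u))) = exp (s * of_real u - of_real (l * exp u))" for u
    using l by (simp add: powr_def Ln_of_real exp_add mult_exp_exp algebra_simps)
  ultimately show ?thesis by simp
qed

text \<open>The inequality exp |t| >= t^2/2 reduces the double exponential to a Gaussian.\<close>

lemma double_exp_decay_imp_super_exp_decay:
  assumes m: "h \<in> borel_measurable borel" and c: "c > 0"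
    and b: "\<And>u. norm (h u) \<le> C * exp (p * \<bar>u\<bar>) * exp (- c * exp \<bar>u\<bar>)"
  shows "super_exp_decay h"
proof (rule super_exp_decay.intro[OF m])
  fix A :: real
  have C: "C \<ge> 0"
    using order_trans[OF norm_ge_zero b[of 0]] by (simp add: zero_le_mult_iff)
  show "integrable lborel (\<lambda>t. exp (A * \<bar>t\<bar>) * norm (h t))"
  proof (rule Bochner_Integration.integrable_bound)
    show "integrable lborel (\<lambda>t. C * (exp ((A + p) * \<bar>t\<bar>) * exp (- (c / 2) * t\<^sup>2)))"
      by (intro integrable_mult_right gaussian_integrable_abs) (use c in simp)
    show "(\<lambda>t. exp (A * \<bar>t\<bar>) * norm (h t)) \<in> borel_measurable lborel"
      using m by measurable
    show "AE t in lborel. norm (exp (A * \<bar>t\<bar>) * norm (h t)) \<le> norm (C * (exp ((A + p) * \<bar>t\<bar>) * exp (- (c / 2) * t\<^sup>2)))"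
    proof (rule AE_I2)
      fix t :: real
      have "t\<^sup>2 / 2 \<le> exp \<bar>t\<bar>" using exp_lower_Taylor_quadratic[of "\<bar>t\<bar>"] by simp
      then have "c * (t\<^sup>2 / 2) \<le> c * exp \<bar>t\<bar>" using c by (intro mult_left_mono) auto
      then have e: "exp (- c * exp \<bar>t\<bar>) \<le> exp (- (c / 2) * t\<^sup>2)" by simp
      have "exp (A * \<bar>t\<bar>) * norm (h t) \<le> exp (A * \<bar>t\<bar>) * (C * exp (p * \<bar>t\<bar>) * exp (- (c / 2) * t\<^sup>2))"
        using C by (intro mult_left_mono order_trans[OF b] e) auto
      also have "\<dots> = C * (exp ((A + p) * \<bar>t\<bar>) * exp (- (c / 2) * t\<^sup>2))"
        by (simp add: distrib_right exp_add)
      finally show "norm (exp (A * \<bar>t\<bar>) * norm (h t)) \<le> norm (C * (exp ((A + p) * \<bar>t\<bar>) * exp (- (c / 2) * t\<^sup>2)))"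
        using C by (simp add: abs_mult)
    qed
  qed
qed

context periodic_cusp_function
begin

text \<open>Termwise integration of the Fourier expansion along the imaginary axis. The coefficients
  are O(n^A), so Re s >= A + 2 leaves the majorant 1/n^2. The scale \<open>X\<close> is free; later
  i X is the fixed point of the Fricke inversion. The entire function \<open>rGamma\<close> stands
  for division by Gamma.\<close>

lemma mellin_sums:
  assumes s: "Re s \<ge> real A + 2" and X: "X > 0"
  shows "(\<lambda>n. fourier_coeff h (Suc n) * of_nat (Suc n) powr (- s)) sums
    (of_real (2 * pi * X) powr s * rGamma s * (\<integral>u. h (\<i> * of_real (X * exp u)) * exp (s * of_real u) \<partial>lborel))"
proof -
  let ?I = "\<integral>u. h (\<i> * of_real (X * exp u)) * exp (s * of_real u) \<partial>lborel"
  define a where "a = (\<lambda>n. fourier_coeff h (Suc n))"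
  define l where "l = (\<lambda>n. 2 * pi * X * real (Suc n))"
  have l: "l n > 0" for n using X by (simp add: l_def)
  have s0: "Re s > 0" using s by linarith
  have s0': "Re (complex_of_real (Re s)) > 0" using s0 by simp
  define f where "f = (\<lambda>n u::real. a n * exp (s * of_real u - of_real (l n * exp u)))"
  have fi: "integrable lborel (f n)" "integral\<^sup>L lborel (f n) = a n * (of_real (l n) powr (- s) * Gamma s)" for n
    using Gamma_integral_exp_scaled[OF s0 l, of n] unfolding f_def by (auto simp: has_bochner_integral_iff)
  have nf: "norm (f n u) = norm (a n) * Re (exp (of_real (Re s) * of_real u - of_real (l n * exp u)))" for n u
    by (simp add: f_def norm_mult Re_exp)
  have nI: "(\<integral>u. norm (f n u) \<partial>lborel) = norm (a n) * Re (of_real (l n) powr (- of_real (Re s)) * Gamma (of_real (Re s)))" for n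
    unfolding nf using has_bochner_integral_Re[OF Gamma_integral_exp_scaled[OF s0' l, of n]]
    by (simp add: has_bochner_integral_iff)
  have hs: "(\<lambda>n. f n u) sums (h (\<i> * of_real (X * exp u)) * exp (s * of_real u))" for u
  proof -
    let ?z = "\<i> * complex_of_real (X * exp u)"
    have "?z \<in> upper_half_plane" using X by (simp add: upper_half_plane_def)
    from fourier_coeff_sums[OF this] have "(\<lambda>n. a n * exp (2 * of_real pi * \<i> * of_nat (Suc n) * ?z)) sums h ?z"
      unfolding a_def by (subst sums_Suc_iff) (simp add: fourier_coeff_0)
    then have "(\<lambda>n. a n * exp (2 * of_real pi * \<i> * of_nat (Suc n) * ?z) * exp (s * of_real u)) sums (h ?z * exp (s * of_real u))"
      by (rule sums_mult2)
    moreover have "a n * exp (2 * of_real pi * \<i> * of_nat (Suc n) * ?z) * exp (s * of_real u) = f n u" for n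
    proof -
      have "2 * of_real pi * \<i> * of_nat (Suc n) * ?z = - of_real (l n * exp u)"
        by (simp add: l_def algebra_simps)
      then show ?thesis by (simp add: f_def mult_exp_exp)
    qed
    ultimately show ?thesis by simp
  qed
  define C where "C = 2 * B * exp (2 * pi)"
  have C: "C \<ge> 0" using B_nonneg by (simp add: C_def)
  have ab: "norm (a n) \<le> C * real (Suc n) ^ A" for n
    unfolding a_def C_def by (rule fourier_coeff_bound) simp
  have sq: "summable (\<lambda>n. K * (1 / real (Suc n) ^ 2))" for K :: real
    using inverse_squares_sums by (intro summable_mult) (auto simp: sums_iff)
  have cancel: "real (Suc n) ^ A * (1 / real (Suc n) ^ (A + 2)) = 1 / real (Suc n) ^ 2" for n
    by (simp add: power_add power2_eq_square del: of_nat_Suc)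
  have ns: "summable (\<lambda>n. norm (f n u))" for u
  proof (rule summable_comparison_test'[OF sq])
    define x where "x = 2 * pi * X * exp u"
    have x: "x > 0" using X by (simp add: x_def)
    fix n :: nat
    have "(x * real (Suc n)) ^ (A + 2) \<le> fact (A + 2) * exp (x * real (Suc n))"
      by (rule power_le_fact_times_exp) (use x in simp)
    then have "exp (- (x * real (Suc n))) * (x * real (Suc n)) ^ (A + 2) \<le> exp (- (x * real (Suc n))) * (fact (A + 2) * exp (x * real (Suc n)))"
      by (rule mult_left_mono) simp
    also have "\<dots> = fact (A + 2)" by (simp add: exp_minus del: of_nat_Suc fact_Suc)
    finally have "exp (- (x * real (Suc n))) \<le> fact (A + 2) / (x * real (Suc n)) ^ (A + 2)"
      using x by (subst pos_le_divide_eq) (auto intro!: mult_pos_pos simp del: of_nat_Suc fact_Suc power_Suc)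
    also have "\<dots> = fact (A + 2) / x ^ (A + 2) * (1 / real (Suc n) ^ (A + 2))"
      by (simp only: power_mult_distrib times_divide_times_eq mult_1_right)
    finally have E: "exp (- (x * real (Suc n))) \<le> fact (A + 2) / x ^ (A + 2) * (1 / real (Suc n) ^ (A + 2))" .
    have "norm (f n u) = norm (a n) * exp (Re s * u - l n * exp u)"
      by (simp add: f_def norm_mult)
    also have "l n * exp u = x * real (Suc n)" by (simp only: x_def l_def mult_ac)
    also have "norm (a n) * exp (Re s * u - x * real (Suc n)) = norm (a n) * (exp (Re s * u) * exp (- (x * real (Suc n))))"
      by (simp only: mult_exp_exp diff_conv_add_uminus)
    also have "\<dots> \<le> (C * real (Suc n) ^ A) * (exp (Re s * u) * (fact (A + 2) / x ^ (A + 2) * (1 / real (Suc n) ^ (A + 2))))"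
      using C by (intro mult_mono[OF ab] mult_left_mono[OF E]) auto
    also have "\<dots> = C * exp (Re s * u) * fact (A + 2) / x ^ (A + 2) * (1 / real (Suc n) ^ 2)"
      unfolding cancel[symmetric] by (simp del: of_nat_Suc fact_Suc power_Suc)
    finally show "norm (norm (f n u)) \<le> C * exp (Re s * u) * fact (A + 2) / x ^ (A + 2) * (1 / real (Suc n) ^ 2)" by simp
  qed
  have "(\<lambda>n. integral\<^sup>L lborel (f n)) sums (\<integral>u. (\<Sum>n. f n u) \<partial>lborel)"
  proof (rule sums_integral[OF fi(1)])
    show "AE u in lborel. summable (\<lambda>n. norm (f n u))" using ns by simp
    show "summable (\<lambda>n. \<integral>u. norm (f n u) \<partial>lborel)"
    proof (rule summable_comparison_test'[OF sq])
      fix n :: nat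
      let ?G = "norm (Gamma (complex_of_real (Re s)))"
      have "real (Suc n) powr - Re s \<le> real (Suc n) powr - real (A + 2)" using s by (intro powr_mono) auto
      also have "\<dots> = 1 / real (Suc n) ^ (A + 2)" by (simp add: powr_minus_divide powr_realpow del: of_nat_Suc)
      finally have pq: "real (Suc n) powr - Re s \<le> 1 / real (Suc n) ^ (A + 2)" .
      have "l n powr - Re s = (2 * pi * X) powr - Re s * real (Suc n) powr - Re s"
        unfolding l_def by (rule powr_mult)
      then have p: "l n powr - Re s \<le> (2 * pi * X) powr - Re s * (1 / real (Suc n) ^ (A + 2))"
        using mult_left_mono[OF pq, of "(2 * pi * X) powr - Re s"] by simp
      have "norm (complex_of_real (l n) powr (- of_real (Re s)) * Gamma (of_real (Re s))) = l n powr - Re s * ?G"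
        using l[of n] by (simp add: norm_mult norm_powr_real_powr)
      then have "\<bar>Re (of_real (l n) powr (- of_real (Re s)) * Gamma (of_real (Re s)))\<bar> \<le> l n powr - Re s * ?G"
        by (metis abs_Re_le_cmod)
      also have "\<dots> \<le> (2 * pi * X) powr - Re s * (1 / real (Suc n) ^ (A + 2)) * ?G" by (intro mult_right_mono p) simp
      finally have "norm (\<integral>u. norm (f n u) \<partial>lborel) \<le> (C * real (Suc n) ^ A) * ((2 * pi * X) powr - Re s * (1 / real (Suc n) ^ (A + 2)) * ?G)"
        unfolding nI real_norm_def abs_mult using ab[of n] C by (intro mult_mono) auto
      also have "\<dots> = C * (2 * pi * X) powr - Re s * ?G * (1 / real (Suc n) ^ 2)"
        unfolding cancel[symmetric] by (simp only: mult_ac)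
      finally show "norm (\<integral>u. norm (f n u) \<partial>lborel) \<le> C * (2 * pi * X) powr - Re s * ?G * (1 / real (Suc n) ^ 2)" .
    qed
  qed
  moreover have "(\<Sum>n. f n u) = h (\<i> * of_real (X * exp u)) * exp (s * of_real u)" for u
    using hs[of u] by (simp add: sums_iff)
  ultimately have "(\<lambda>n. a n * (of_real (l n) powr (- s) * Gamma s)) sums ?I"
    unfolding fi(2) by simp
  then have "(\<lambda>n. of_real (2 * pi * X) powr s * rGamma s * (a n * (of_real (l n) powr (- s) * Gamma s))) sums
     (of_real (2 * pi * X) powr s * rGamma s * ?I)"
    by (rule sums_mult)
  moreover have "of_real (2 * pi * X) powr s * rGamma s * (a n * (of_real (l n) powr (- s) * Gamma s)) = a n * of_nat (Suc n) powr (- s)" for n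
  proof -
    have "of_real (l n) powr (- s) = (complex_of_real (2 * pi * X) * of_nat (Suc n)) powr (- s)"
      by (simp add: l_def)
    also have "\<dots> = of_real (2 * pi * X) powr (- s) * of_nat (Suc n) powr (- s)"
      using X by (intro powr_times_real) auto
    finally have p: "of_real (l n) powr (- s) = of_real (2 * pi * X) powr (- s) * of_nat (Suc n) powr (- s)" .
    have "of_real (2 * pi * X) powr s * of_real (2 * pi * X) powr (- s) = (1::complex)"
      using X by (simp add: powr_minus)
    moreover have "rGamma s * Gamma s = 1"
    proof -
      have "s \<notin> \<int>\<^sub>\<le>\<^sub>0" using s0 by (auto elim!: nonpos_Ints_cases)
      then show ?thesis by (simp add: rGamma_inverse_Gamma Gamma_eq_zero_iff)
    qed
    moreover have "of_real (2 * pi * X) powr s * rGamma s * (a n * (of_real (l n) powr (- s) * Gamma s)) =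
      (of_real (2 * pi * X) powr s * of_real (2 * pi * X) powr (- s)) * (rGamma s * Gamma s) * (a n * of_nat (Suc n) powr (- s))"
      unfolding p by (simp only: mult_ac)
    ultimately show ?thesis by simp
  qed
  ultimately have "(\<lambda>n. a n * of_nat (Suc n) powr (- s)) sums
     (of_real (2 * pi * X) powr s * rGamma s * ?I)"
    by (simp only:)
  then show ?thesis unfolding a_def .
qed

text \<open>The right-hand side is entire and represents the Dirichlet series for large Re s; any
  other such function agrees with it on a half-plane, hence everywhere, which settles the definite
  description. The shift by \<open>p\<close> will put the critical line on the imaginary
  axis.\<close>

lemma L_function_eq:
  assumes X: "X > 0" and P: "super_exp_decay (\<lambda>u. h (\<i> * of_real (X * exp u)) * exp (of_real (p * u)))"
  shows "L_function h s = of_real (2 * pi * X) powr s * rGamma s *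
    super_exp_decay.laplace (\<lambda>u. h (\<i> * of_real (X * exp u)) * exp (of_real (p * u))) (s - of_real p)"
proof -
  interpret P: super_exp_decay "\<lambda>u. h (\<i> * of_real (X * exp u)) * exp (of_real (p * u))" by (rule P)
  let ?a = "\<lambda>s n. fourier_coeff h (Suc n) * of_nat (Suc n) powr (- s)"
  let ?F = "\<lambda>s. of_real (2 * pi * X) powr s * rGamma s * P.laplace (s - of_real p)"
  let ?Q = "\<lambda>F. F holomorphic_on UNIV \<and> (\<exists>\<sigma>::real. \<forall>s. Re s > \<sigma> \<longrightarrow>
        ?a s sums F s)"
  have lap: "P.laplace (s - of_real p) = (\<integral>u. h (\<i> * of_real (X * exp u)) * exp (s * of_real u) \<partial>lborel)" for s
    unfolding P.laplace_def
    by (intro Bochner_Integration.integral_cong refl) (simp add: mult_exp_exp algebra_simps)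
  have "?Q ?F"
  proof (intro conjI exI allI impI)
    have "(\<lambda>s. P.laplace (s - of_real p)) holomorphic_on UNIV"
      by (rule holomorphic_on_compose_gen[OF _ P.laplace_holomorphic[of UNIV], unfolded o_def]) (auto intro!: holomorphic_intros)
    then show "?F holomorphic_on UNIV" using X by (intro holomorphic_intros) auto
    fix s assume "Re s > real A + 2"
    then show "?a s sums ?F s"
      unfolding lap by (intro mellin_sums X) simp
  qed
  moreover have "G = ?F" if Q: "?Q G" for G
  proof
    fix s
    obtain \<sigma> where \<sigma>: "\<And>s. Re s > \<sigma> \<Longrightarrow> ?a s sums G s"
      using Q by blast
    obtain \<tau> where \<tau>: "\<And>s. Re s > \<tau> \<Longrightarrow> ?a s sums ?F s"
      using \<open>?Q ?F\<close> by blast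
    show "G s = ?F s"
    proof (rule analytic_continuation_open[where f=G and g="?F" and z=s and s="{s. Re s > max \<sigma> \<tau>}" and s'=UNIV])
      show "open {s. Re s > max \<sigma> \<tau>}" by (rule open_halfspace_Re_gt)
      have "complex_of_real (max \<sigma> \<tau> + 1) \<in> {s. Re s > max \<sigma> \<tau>}" by (auto simp: max_def)
      then show "{s. Re s > max \<sigma> \<tau>} \<noteq> {}" by blast
      fix z assume "z \<in> {s. Re s > max \<sigma> \<tau>}"
      then show "G z = ?F z" using sums_unique2[OF \<sigma>[of z] \<tau>[of z]] by simp
    qed (use Q \<open>?Q ?F\<close> in auto)
  qed
  ultimately have "L_function h = ?F" unfolding L_function_def by (rule the_equality)
  then show ?thesis by simp
qed

end

section \<open>The Fricke involution and the behaviour at the cusps\<close>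

lemma power4_le_imp_le:
  fixes x y :: real
  assumes "x ^ 4 \<le> y ^ 4" "0 \<le> x" "0 \<le> y"
  shows "x \<le> y"
  using assms power_mono_iff[of x y 4] by simp

lemma frac_lin_translation: "frac_lin 1 1 0 1 w = w + 1"
  by (simp add: frac_lin_def)

lemma shimura_symbol_1 [simp]: "shimura_symbol c 1 = 1"
  by (simp add: shimura_symbol_def Jacobi_def)

lemma theta_eps_1 [simp]: "theta_eps 1 = 1"
  by (simp add: theta_eps_def)

lemma csqrt_quadrant:
  assumes "Im z > 0"
  shows "Re (csqrt z) > 0" "Im (csqrt z) > 0"
proof -
  have "Im ((csqrt z)\<^sup>2) > 0" using assms by simp
  then have p: "2 * (Re (csqrt z) * Im (csqrt z)) > 0" by (simp only: Im_power2 mult_ac)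
  then have "Re (csqrt z) \<noteq> 0" by auto
  then show r: "Re (csqrt z) > 0" using csqrt_principal[of z] by auto
  show "Im (csqrt z) > 0" using p r by (simp add: zero_less_mult_iff)
qed

text \<open>Both roots lie in the open first quadrant, so their quotient has positive real part and
  is the principal root.\<close>

lemma csqrt_quotient:
  assumes "Im z > 0" "Im w > 0"
  shows "csqrt (w / z) = csqrt w / csqrt z"
proof (rule csqrt_unique)
  show "(csqrt w / csqrt z)\<^sup>2 = w / z" by (simp add: power_divide)
  have "csqrt z \<noteq> 0" using assms by auto
  then have "(Re (csqrt z))\<^sup>2 + (Im (csqrt z))\<^sup>2 > 0" by (metis cmod_power2 norm_ge_zero power2_eq_square zero_less_mult_iff zero_less_norm_iff)
  moreover have "Re (csqrt w) * Re (csqrt z) + Im (csqrt w) * Im (csqrt z) > 0"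
    using csqrt_quadrant[OF assms(1)] csqrt_quadrant[OF assms(2)] by (intro add_pos_pos mult_pos_pos)
  ultimately have "Re (csqrt w / csqrt z) > 0" by (simp add: Re_divide)
  then show "0 < Re (csqrt w / csqrt z) \<or> Re (csqrt w / csqrt z) = 0 \<and> 0 \<le> Im (csqrt w / csqrt z)" by simp
qed

context half_integral_cusp_form
begin

text \<open>The fourth root of \<open>polynomial_growth_4\<close>, with the exponent (4 k + 2)/4
  rounded up to \<open>k + 1\<close>.\<close>

lemma periodic_cusp_function_form: "\<exists>B. periodic_cusp_function f (k + 1) B"
proof -
  from polynomial_growth_4 obtain B where B: "B \<ge> 0"
    "\<And>z. Im z > 0 \<Longrightarrow> norm (f z) ^ 4 \<le> B * (1 + (1 / Im z) ^ (4 * k + 2))" by blast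
  have "periodic_cusp_function f (k + 1) (1 + 2 * B)"
  proof
    show "f holomorphic_on upper_half_plane" by (rule holo)
    show "f (w + 1) = f w" if "w \<in> upper_half_plane" for w
      using transform[of 1 1 1 0 w] that by (simp add: frac_lin_translation)
    show "(f \<longlongrightarrow> 0) (filtercomap Im at_top)"
      using vanishes[of 1 1 0 0] by (simp add: frac_lin_def)
    fix z :: complex assume z: "Im z > 0"
    define t where "t = 1 / Im z"
    have t: "t > 0" using z by (simp add: t_def)
    let ?T = "t ^ (k + 1)"
    have T: "?T > 0" using t by simp
    have "t ^ (4 * k + 2) \<le> 1 + ?T ^ 4"
    proof (cases "t \<le> 1")
      case True
      then have "t ^ (4 * k + 2) \<le> 1" using t by (intro power_le_one) auto
      then show ?thesis using T by (smt (verit) zero_le_power)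
    next
      case False
      then have "t ^ (4 * k + 2) \<le> t ^ ((k + 1) * 4)" by (intro power_increasing) auto
      then show ?thesis by (simp only: power_mult)
    qed
    moreover have "1 + ?T ^ 4 + 1 \<le> 2 * (1 + ?T) ^ 4"
    proof -
      have "1 + ?T ^ 4 \<le> (1 + ?T) ^ 4"
      proof -
        have "(1 + x) ^ 4 = 1 + x ^ 4 + (4 * x + 6 * (x * x) + 4 * (x * x * x))" for x :: real
          by (simp add: power4_eq_xxxx algebra_simps)
        moreover have "0 \<le> 4 * ?T + 6 * (?T * ?T) + 4 * (?T * ?T * ?T)"
          using T by (intro add_nonneg_nonneg mult_nonneg_nonneg) auto
        ultimately show ?thesis by simp
      qed
      moreover have "1 \<le> (1 + ?T) ^ 4" using T by (intro one_le_power) auto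
      ultimately show ?thesis by simp
    qed
    ultimately have "1 + t ^ (4 * k + 2) \<le> 2 * (1 + ?T) ^ 4" by linarith
    then have "norm (f z) ^ 4 \<le> B * (2 * (1 + ?T) ^ 4)"
      using B(2)[OF z] B(1) mult_left_mono[of "1 + t ^ (4 * k + 2)" "2 * (1 + ?T) ^ 4" B] by (simp add: t_def)
    also have "\<dots> = (2 * B) * (1 + ?T) ^ 4" by simp
    also have "\<dots> \<le> (1 + 2 * B) ^ 4 * (1 + ?T) ^ 4"
    proof (rule mult_right_mono)
      have "(1 + 2 * B) ^ 1 \<le> (1 + 2 * B) ^ 4" using B(1) by (intro power_increasing) auto
      then show "2 * B \<le> (1 + 2 * B) ^ 4" by simp
    qed (use T in simp)
    also have "\<dots> = ((1 + 2 * B) * (1 + ?T)) ^ 4" by (simp add: power_mult_distrib)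
    finally have "norm (f z) \<le> (1 + 2 * B) * (1 + ?T)"
      by (rule power4_le_imp_le) (use B(1) T in auto)
    then show "norm (f z) \<le> (1 + 2 * B) * (1 + (1 / Im z) ^ (k + 1))" by (simp add: t_def)
  qed
  then show ?thesis by blast
qed

section \<open>The Fricke image as a periodic cusp function\<close>

abbreviation "g \<equiv> fricke k M f"

definition fricke_const :: complex where
  "fricke_const = csqrt \<i> powi (2 * int k + 1) * of_real (real M powr (- real k / 2 - 1 / 4))"

lemma fricke_eq: "g z = fricke_const * csqrt z powi (- 2 * int k - 1) * f (- 1 / (of_nat M * z))"
  by (simp add: fricke_def fricke_const_def)

lemma Im_inversion: "Im (- 1 / (of_nat M * z)) = Im z / (M * (norm z)\<^sup>2)"
proof -
  have "- 1 / (of_nat M * z) = of_real (1 / M) * (- inverse z)" by (simp add: field_simps)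
  then show ?thesis by (simp add: cmod_power2 del: of_real_divide)
qed

lemma inversion_in_upper_half_plane:
  assumes "z \<in> upper_half_plane"
  shows "- 1 / (of_nat M * z) \<in> upper_half_plane"
  unfolding upper_half_plane_def mem_Collect_eq Im_inversion
  using assms M_pos by (auto simp: upper_half_plane_def intro!: divide_pos_pos mult_pos_pos)

lemma fricke_holomorphic: "g holomorphic_on upper_half_plane"
proof -
  have "(\<lambda>z. f (- 1 / (of_nat M * z))) holomorphic_on upper_half_plane"
  proof (rule holomorphic_on_compose_gen[OF _ holo, unfolded o_def])
    show "(\<lambda>z. - 1 / (of_nat M * z)) holomorphic_on upper_half_plane"
      by (intro holomorphic_intros) (use M_pos in \<open>auto simp: upper_half_plane_def\<close>)
  qed (use inversion_in_upper_half_plane in auto)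
  then show ?thesis unfolding fricke_eq[abs_def]
    by (intro holomorphic_intros) (auto simp: upper_half_plane_def complex_nonpos_Reals_iff)
qed

text \<open>Conjugation by the inversion turns the translation by 1 into the matrix (1, 0; -M, 1) of
  level \<open>M\<close>. Its entry d = 1 makes the symbol and \<open>theta_eps\<close> trivial, and
  \<open>csqrt_quotient\<close> makes the half-integral powers match.\<close>

lemma fricke_periodic:
  assumes w: "w \<in> upper_half_plane"
  shows "g (w + 1) = g w"
proof -
  let ?v = "- 1 / (of_nat M * w)"
  have Iw: "Im w > 0" "Im (w + 1) > 0" using w by (auto simp: upper_half_plane_def)
  then have w0: "w \<noteq> 0" "w + 1 \<noteq> 0" by (metis less_irrefl zero_complex.sel(2))+
  have q: "of_int (- int M) * ?v + of_int 1 = (w + 1) / w" using M_pos w0 by (simp add: field_simps)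
  have fl: "frac_lin 1 0 (- int M) 1 ?v = - 1 / (of_nat M * (w + 1))"
    unfolding frac_lin_def q using M_pos w0 by (simp add: field_simps)
  have "f (- 1 / (of_nat M * (w + 1))) = csqrt ((w + 1) / w) powi (2 * int k + 1) * f ?v"
    using transform[of 1 1 0 "- int M" ?v] inversion_in_upper_half_plane[OF w] unfolding fl q by simp
  also have "csqrt ((w + 1) / w) = csqrt (w + 1) / csqrt w" by (rule csqrt_quotient[OF Iw])
  finally have e: "f (- 1 / (of_nat M * (w + 1))) = (csqrt (w + 1) / csqrt w) powi (2 * int k + 1) * f ?v" .
  have n: "csqrt (w + 1) \<noteq> 0" "csqrt w \<noteq> 0" using w0 by auto
  have m: "- 2 * int k - 1 = - (2 * int k + 1)" by simp
  have "csqrt (w + 1) powi (- 2 * int k - 1) * (csqrt (w + 1) / csqrt w) powi (2 * int k + 1) = csqrt w powi (- 2 * int k - 1)"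
    unfolding m power_int_minus power_int_divide_distrib using n by (simp add: field_simps)
  then show ?thesis unfolding fricke_eq e by (simp add: mult.assoc)
qed

text \<open>This is the vanishing of \<open>f\<close> at the cusp 0, through the matrix (0, -1; 1,
  0), after rescaling by \<open>M\<close>. Absolute values are compared, so that branches of the
  root drop out.\<close>

lemma fricke_vanishes: "(g \<longlongrightarrow> 0) (filtercomap Im at_top)"
proof -
  define H where "H = (\<lambda>z. csqrt z powi (- 2 * int k - 1) * f (- 1 / z))"
  have H: "(H \<longlongrightarrow> 0) (filtercomap Im at_top)"
    using vanishes[of 0 0 "- 1" 1] by (simp add: frac_lin_def H_def)
  have "filterlim (\<lambda>z. of_nat M * z) (filtercomap Im at_top) (filtercomap Im at_top)"
    unfolding filterlim_filtercomap_iff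
  proof -
    have "filterlim (\<lambda>z. real M * Im z) at_top (filtercomap Im at_top)"
      by (rule filterlim_tendsto_pos_mult_at_top[OF tendsto_const _ filterlim_filtercomap]) (use M_pos in simp)
    then show "filterlim (Im \<circ> (\<lambda>z. of_nat M * z)) at_top (filtercomap Im at_top)" by (simp add: o_def)
  qed
  then have "((\<lambda>z. H (of_nat M * z)) \<longlongrightarrow> 0) (filtercomap Im at_top)" by (rule filterlim_compose[OF H])
  then have "((\<lambda>z. norm fricke_const * norm (csqrt (of_nat M) powi (2 * int k + 1)) * norm (H (of_nat M * z))) \<longlongrightarrow> 0) (filtercomap Im at_top)"
    by (intro tendsto_mult_right_zero tendsto_norm_zero)
  moreover have "norm fricke_const * norm (csqrt (of_nat M) powi (2 * int k + 1)) * norm (H (of_nat M * z)) = norm (g z)" for z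
  proof -
    have m: "- 2 * int k - 1 = - (2 * int k + 1)" by simp
    have "norm (csqrt (of_nat M * z)) = norm (csqrt (of_nat M)) * norm (csqrt z)"
      by (simp add: norm_mult real_sqrt_mult)
    then have "norm (csqrt (of_nat M) powi (2 * int k + 1)) * norm (csqrt (of_nat M * z) powi (- 2 * int k - 1)) = norm (csqrt z powi (- 2 * int k - 1))"
      unfolding m power_int_minus norm_inverse norm_power_int using M_pos
      by (simp add: power_int_mult_distrib)
    then have "norm (csqrt z powi (- 2 * int k - 1)) = norm (csqrt (of_nat M) powi (2 * int k + 1)) * norm (csqrt (of_nat M * z) powi (- 2 * int k - 1))" ..
    then show ?thesis unfolding fricke_eq H_def norm_mult by (simp only: mult_ac)
  qed
  ultimately have "((\<lambda>z. norm (g z)) \<longlongrightarrow> 0) (filtercomap Im at_top)" by simp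
  then show ?thesis by (rule tendsto_norm_zero_cancel)
qed

lemma norm_csqrt_powi: "norm (csqrt z powi (- 2 * int k - 1)) = 1 / sqrt (norm z) ^ (2 * k + 1)"
proof -
  have m: "- 2 * int k - 1 = - int (2 * k + 1)" by simp
  show ?thesis unfolding m power_int_minus power_int_of_nat
    by (simp only: norm_inverse norm_power norm_csqrt) (simp only: inverse_eq_divide)
qed

text \<open>For Im >= 1 the decay at infinity suffices. Below, periodicity moves Re z into [0, 1),
  so |z|^2 <= 2 and the inverted point has height at least y/(2 M). Then \<open>f\<close>
  contributes y^-(k+1) and the power of \<open>csqrt z\<close> at most y^-(2k+1), together
  y^-(3k+2).\<close>

lemma periodic_cusp_function_fricke: "\<exists>B. periodic_cusp_function g (3 * k + 2) B"
proof -
  obtain Bf where "periodic_cusp_function f (k + 1) Bf" using periodic_cusp_function_form by blast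
  then interpret f: periodic_cusp_function f "k + 1" Bf .
  have per1: "g (w + of_real 1) = g w" if "w \<in> upper_half_plane" for w
    using fricke_periodic[OF that] by simp
  from periodic_holomorphic_decay[OF fricke_holomorphic zero_less_one per1 fricke_vanishes, of 1]
  obtain C where C: "C \<ge> 0" "\<And>w. Im w \<ge> 1 \<Longrightarrow> norm (g w) \<le> C * exp (- 2 * pi * Im w)" by auto
  define K where "K = norm fricke_const * (Bf * (1 + (2 * real M) ^ (k + 1)))"
  have K: "K \<ge> 0" using f.B_nonneg by (simp add: K_def)
  have "periodic_cusp_function g (3 * k + 2) (C + K)"
  proof
    show "g holomorphic_on upper_half_plane" by (rule fricke_holomorphic)
    show "g (w + 1) = g w" if "w \<in> upper_half_plane" for w by (rule fricke_periodic[OF that])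
    show "(g \<longlongrightarrow> 0) (filtercomap Im at_top)" by (rule fricke_vanishes)
    fix z0 :: complex assume z0: "Im z0 > 0"
    let ?R = "(C + K) * (1 + (1 / Im z0) ^ (3 * k + 2))"
    show "norm (g z0) \<le> ?R"
    proof (cases "Im z0 \<ge> 1")
      case True
      have "norm (g z0) \<le> C * exp (- 2 * pi * Im z0)" by (rule C(2)[OF True])
      also have "\<dots> \<le> C * 1" using C(1) z0 by (intro mult_left_mono) auto
      also have "\<dots> \<le> ?R" using C(1) K z0 by (intro mult_mono) auto
      finally show ?thesis .
    next
      case False
      define z where "z = z0 + of_int (- \<lfloor>Re z0\<rfloor>) * of_real 1"
      have gz: "g z = g z0" unfolding z_def
        by (rule periodic_of_int[where h=g and L=1, OF per1]) (use z0 in \<open>auto simp: upper_half_plane_def\<close>)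
      define y where "y = Im z"
      have Iz: "Im z = Im z0" by (simp add: z_def)
      have y: "0 < y" "y < 1" using z0 False by (auto simp: y_def Iz)
      have "Re z = Re z0 - of_int \<lfloor>Re z0\<rfloor>" by (simp add: z_def)
      then have Rz: "0 \<le> Re z" "Re z < 1"
        using of_int_floor_le[of "Re z0"] real_of_int_floor_add_one_gt[of "Re z0"] by linarith+
      have "(Re z)\<^sup>2 \<le> 1" "y\<^sup>2 \<le> 1" using Rz y by (auto intro!: power_le_one)
      then have nz2: "(norm z)\<^sup>2 \<le> 2" by (simp add: cmod_power2 y_def)
      have nzy: "y \<le> norm z" using y abs_Im_le_cmod[of z] by (simp add: y_def)
      have z_in: "z \<in> upper_half_plane" using y by (simp add: upper_half_plane_def y_def)
      have "1 / Im (- 1 / (of_nat M * z)) = M * (norm z)\<^sup>2 / y"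
        unfolding Im_inversion by (simp add: y_def)
      also have "\<dots> \<le> 2 * real M * (1 / y)" using nz2 y M_pos by (simp add: divide_right_mono)
      finally have "(1 / Im (- 1 / (of_nat M * z))) ^ (k + 1) \<le> (2 * real M * (1 / y)) ^ (k + 1)"
        using inversion_in_upper_half_plane[OF z_in] by (intro power_mono) (auto simp: upper_half_plane_def)
      also have "\<dots> = (2 * real M) ^ (k + 1) * (1 / y) ^ (k + 1)" by (simp only: power_mult_distrib)
      finally have *: "(1 / Im (- 1 / (of_nat M * z))) ^ (k + 1) \<le> (2 * real M) ^ (k + 1) * (1 / y) ^ (k + 1)" .
      have "1 + (1 / Im (- 1 / (of_nat M * z))) ^ (k + 1) \<le> 1 * (1 / y) ^ (k + 1) + (2 * real M) ^ (k + 1) * (1 / y) ^ (k + 1)"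
      proof -
        have "1 \<le> (1 / y) ^ (k + 1)" by (rule one_le_power) (use y in simp)
        then show ?thesis using * by linarith
      qed
      then have h: "1 + (1 / Im (- 1 / (of_nat M * z))) ^ (k + 1) \<le> (1 + (2 * real M) ^ (k + 1)) * (1 / y) ^ (k + 1)"
        by (simp only: distrib_right)
      have "Im (- 1 / (of_nat M * z)) > 0"
        using inversion_in_upper_half_plane[OF z_in] unfolding upper_half_plane_def mem_Collect_eq .
      then have "norm (f (- 1 / (of_nat M * z))) \<le> Bf * ((1 + (2 * real M) ^ (k + 1)) * (1 / y) ^ (k + 1))"
        by (rule order_trans[OF f.growth mult_left_mono[OF h f.B_nonneg]])
      then have fb: "norm (f (- 1 / (of_nat M * z))) \<le> Bf * (1 + (2 * real M) ^ (k + 1)) * (1 / y) ^ (k + 1)"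
        by (simp only: mult.assoc)
      have "y * y \<le> 1 * norm z" using y nzy by (intro mult_mono) auto
      then have "y \<le> sqrt (norm z)" using y by (intro real_le_rsqrt) (simp add: power2_eq_square)
      then have "y ^ (2 * k + 1) \<le> sqrt (norm z) ^ (2 * k + 1)" using y by (intro power_mono) auto
      then have cb: "norm (csqrt z powi (- 2 * int k - 1)) \<le> (1 / y) ^ (2 * k + 1)"
        unfolding norm_csqrt_powi power_one_over using y by (intro frac_le) auto
      have "norm (g z) \<le> norm fricke_const * (1 / y) ^ (2 * k + 1) * (Bf * (1 + (2 * real M) ^ (k + 1)) * (1 / y) ^ (k + 1))"
        unfolding fricke_eq norm_mult using y by (intro mult_mono mult_left_mono cb fb) auto
      also have "\<dots> = K * ((1 / y) ^ (2 * k + 1) * (1 / y) ^ (k + 1))" by (simp only: K_def mult_ac)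
      also have "(1 / y) ^ (2 * k + 1) * (1 / y) ^ (k + 1) = (1 / y) ^ (3 * k + 2)"
        by (subst power_add[symmetric]) (rule arg_cong[where f="power _"], simp)
      also have "K * (1 / y) ^ (3 * k + 2) \<le> ?R"
        unfolding y_def Iz using C(1) K z0 by (intro mult_mono) auto
      finally show ?thesis unfolding gz .
    qed
  qed
  then show ?thesis by blast
qed

text \<open>The point i X is fixed by z -> -1/(M z), and \<open>p\<close> is half the weight, the
  abscissa of the critical line.\<close>

definition X :: real where "X = 1 / sqrt (real M)"
definition p :: real where "p = real k / 2 + 1 / 4"

lemma X_pos: "X > 0" using M_pos by (simp add: X_def)
lemma p_pos: "p > 0" by (simp add: p_def)

definition P :: "complex \<Rightarrow> complex" where
  "P z = f (\<i> * of_real X * exp z) * exp (of_real p * z)"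

lemma P_of_real: "P (of_real u) = f (\<i> * of_real (X * exp u)) * exp (of_real (p * u))"
  by (simp add: P_def exp_of_real mult.assoc)

text \<open>On the imaginary axis the constant i^(k+1/2) cancels the phase of z^(-k-1/2), and M^(-p)
  cancels X^(-2p); only exp(-2 p u) remains.\<close>

lemma fricke_axis: "g (\<i> * of_real (X * exp u)) = exp (of_real (- 2 * p * u)) * f (\<i> * of_real (X * exp (- u)))"
proof -
  let ?q = "csqrt \<i> * of_real (sqrt (X * exp u))"
  have sM: "sqrt (real M) > 0" using M_pos by simp
  have "- 1 / (of_nat M * (\<i> * of_real (X * exp u))) = \<i> * of_real (1 / (real M * (X * exp u)))"
    using M_pos X_pos by (simp add: field_simps)
  also have "1 / (real M * (X * exp u)) = X * exp (- u)"
    using sM real_sqrt_pow2[of "real M"] by (simp add: X_def exp_minus field_simps power2_eq_square)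
  finally have arg: "- 1 / (of_nat M * (\<i> * of_real (X * exp u))) = \<i> * of_real (X * exp (- u))" .
  have m: "- 2 * int k - 1 = - (2 * int k + 1)" by simp
  have Xu: "X * exp u > 0" using X_pos by simp
  have "csqrt (\<i> * of_real (X * exp u)) = ?q"
  proof (rule csqrt_unique)
    show "(?q)\<^sup>2 = \<i> * of_real (X * exp u)"
      using Xu unfolding power_mult_distrib power2_csqrt by (simp flip: of_real_power)
    have "Re (?q) > 0"
      using csqrt_quadrant[of \<i>] Xu by (simp del: csqrt_ii)
    then show "0 < Re (?q) \<or> Re (?q) = 0 \<and> 0 \<le> Im (?q)" by simp
  qed
  then have "csqrt \<i> powi (2 * int k + 1) * csqrt (\<i> * of_real (X * exp u)) powi (- 2 * int k - 1)
     = inverse (of_real (sqrt (X * exp u)) powi (2 * int k + 1))"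
    unfolding m power_int_minus by (simp add: power_int_mult_distrib del: csqrt_ii)
  also have "\<dots> = of_real ((X * exp u) powr (- 2 * p))"
  proof -
    have "2 * int k + 1 = int (2 * k + 1)" by simp
    then have "sqrt (X * exp u) powi (2 * int k + 1) = sqrt (X * exp u) powr real (2 * k + 1)"
      using Xu by (simp only: power_int_of_nat powr_realpow real_sqrt_gt_zero)
    also have "\<dots> = (X * exp u) powr (2 * p)"
    proof -
      have p2: "2 * p = 1 / 2 * real (2 * k + 1)" by (simp add: p_def field_simps)
      show ?thesis unfolding p2 powr_powr[symmetric] using Xu by (simp only: powr_half_sqrt less_imp_le)
    qed
    finally show ?thesis by (simp add: powr_minus flip: of_real_power_int of_real_inverse)
  qed
  finally have c: "csqrt \<i> powi (2 * int k + 1) * csqrt (\<i> * of_real (X * exp u)) powi (- 2 * int k - 1) = of_real ((X * exp u) powr (- 2 * p))" .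
  have "real M powr (- real k / 2 - 1 / 4) * (X * exp u) powr (- 2 * p) = exp (- 2 * p * u)"
  proof -
    have "real M powr (- real k / 2 - 1 / 4) = sqrt (real M) powr (- 2 * p)"
    proof -
      have p2: "- real k / 2 - 1 / 4 = 1 / 2 * (- 2 * p)" by (simp add: p_def)
      show ?thesis unfolding p2 powr_powr[symmetric] by (simp only: powr_half_sqrt of_nat_0_le_iff)
    qed
    moreover have "X = inverse (sqrt (real M))" by (simp add: X_def inverse_eq_divide)
    ultimately have "real M powr (- real k / 2 - 1 / 4) * (X * exp u) powr (- 2 * p) =
       (sqrt (real M) * (inverse (sqrt (real M)) * exp u)) powr (- 2 * p)"
      by (simp add: powr_mult)
    also have "sqrt (real M) * (inverse (sqrt (real M)) * exp u) = exp u" using sM by simp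
    finally show ?thesis by (simp add: exp_powr_real mult.commute)
  qed
  then have d: "of_real (real M powr (- real k / 2 - 1 / 4)) * of_real ((X * exp u) powr (- 2 * p)) = complex_of_real (exp (- 2 * p * u))"
    by (simp only: of_real_mult[symmetric])
  have "g (\<i> * of_real (X * exp u)) = of_real (real M powr (- real k / 2 - 1 / 4)) *
      (csqrt \<i> powi (2 * int k + 1) * csqrt (\<i> * of_real (X * exp u)) powi (- 2 * int k - 1)) * f (\<i> * of_real (X * exp (- u)))"
    unfolding fricke_def arg by (simp only: mult_ac)
  also have "\<dots> = of_real (exp (- 2 * p * u)) * f (\<i> * of_real (X * exp (- u)))"
    unfolding c d by simp
  finally show ?thesis by (simp only: exp_of_real)
qed

lemma P_neg_of_real: "P (- of_real u) = g (\<i> * of_real (X * exp u)) * exp (of_real (p * u))"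
proof -
  have "P (- of_real u) = f (\<i> * of_real (X * exp (- u))) * exp (of_real (p * (- u)))"
    using P_of_real[of "- u"] by simp
  then show ?thesis unfolding fricke_axis by (simp add: mult_exp_exp mult_ac)
qed

text \<open>For u >= 0 the decay of \<open>f\<close> at infinity controls P(u) and that of
  \<open>g\<close> controls P(-u), which covers both ends of the line.\<close>

lemma super_exp_decay_P: "super_exp_decay (\<lambda>u. P (of_real u))" "super_exp_decay (\<lambda>u. P (- of_real u))"
proof -
  obtain Bf where "periodic_cusp_function f (k + 1) Bf" using periodic_cusp_function_form by blast
  then interpret f: periodic_cusp_function f "k + 1" Bf .
  obtain Bg where "periodic_cusp_function g (3 * k + 2) Bg" using periodic_cusp_function_fricke by blast
  then interpret g: periodic_cusp_function g "3 * k + 2" Bg .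
  from f.decay[OF X_pos] obtain C1 where C1: "C1 \<ge> 0" "\<And>w. Im w \<ge> X \<Longrightarrow> norm (f w) \<le> C1 * exp (- 2 * pi * Im w)" by auto
  from g.decay[OF X_pos] obtain C2 where C2: "C2 \<ge> 0" "\<And>w. Im w \<ge> X \<Longrightarrow> norm (g w) \<le> C2 * exp (- 2 * pi * Im w)" by auto
  let ?C = "C1 + C2"
  have pos: "norm (P (of_real u)) \<le> ?C * exp (p * \<bar>u\<bar>) * exp (- (2 * pi * X) * exp \<bar>u\<bar>)"
    "norm (P (- of_real u)) \<le> ?C * exp (p * \<bar>u\<bar>) * exp (- (2 * pi * X) * exp \<bar>u\<bar>)" if u: "u \<ge> 0" for u
  proof -
    have Xu: "X \<le> X * exp u" using X_pos u by simp
    have "norm (f (\<i> * of_real (X * exp u))) \<le> C1 * exp (- 2 * pi * (X * exp u))"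
      using C1(2)[of "\<i> * of_real (X * exp u)"] Xu by simp
    also have "\<dots> \<le> ?C * exp (- 2 * pi * (X * exp u))" using C2(1) by (intro mult_right_mono) auto
    finally have "norm (P (of_real u)) \<le> (?C * exp (- 2 * pi * (X * exp u))) * exp (p * u)"
      unfolding P_of_real norm_mult using C1(1) C2(1) by (intro mult_mono) auto
    then show "norm (P (of_real u)) \<le> ?C * exp (p * \<bar>u\<bar>) * exp (- (2 * pi * X) * exp \<bar>u\<bar>)" using u by (simp add: mult_ac)
    have "norm (g (\<i> * of_real (X * exp u))) \<le> C2 * exp (- 2 * pi * (X * exp u))"
      using C2(2)[of "\<i> * of_real (X * exp u)"] Xu by simp
    also have "\<dots> \<le> ?C * exp (- 2 * pi * (X * exp u))" using C1(1) by (intro mult_right_mono) auto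
    finally have "norm (P (- of_real u)) \<le> (?C * exp (- 2 * pi * (X * exp u))) * exp (p * u)"
      unfolding P_neg_of_real norm_mult using C1(1) C2(1) by (intro mult_mono) auto
    then show "norm (P (- of_real u)) \<le> ?C * exp (p * \<bar>u\<bar>) * exp (- (2 * pi * X) * exp \<bar>u\<bar>)" using u by (simp add: mult_ac)
  qed
  have b1: "norm (P (of_real u)) \<le> ?C * exp (p * \<bar>u\<bar>) * exp (- (2 * pi * X) * exp \<bar>u\<bar>)" for u
    using pos(1)[of u] pos(2)[of "- u"] by (cases "u \<ge> 0") auto
  have b2: "norm (P (- of_real u)) \<le> ?C * exp (p * \<bar>u\<bar>) * exp (- (2 * pi * X) * exp \<bar>u\<bar>)" for u
    using b1[of "- u"] by simp
  have c: "continuous_on UNIV (\<lambda>u::real. f (\<i> * of_real (X * exp u)))"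
    by (rule continuous_on_compose2[OF holomorphic_on_imp_continuous_on[OF holo]])
      (auto intro!: continuous_intros simp: upper_half_plane_def X_pos)
  then have c1: "continuous_on UNIV (\<lambda>u::real. P (of_real u))"
    unfolding P_of_real by (intro continuous_intros) auto
  have c2: "continuous_on UNIV (\<lambda>u::real. P (- of_real u))"
    using continuous_on_compose2[OF c1, of UNIV uminus] by (simp add: continuous_on_minus)
  show "super_exp_decay (\<lambda>u. P (of_real u))"
    by (rule double_exp_decay_imp_super_exp_decay[OF borel_measurable_continuous_onI[OF c1] _ b1]) (use X_pos in simp)
  show "super_exp_decay (\<lambda>u. P (- of_real u))"
    by (rule double_exp_decay_imp_super_exp_decay[OF borel_measurable_continuous_onI[OF c2] _ b2]) (use X_pos in simp)
qed

lemma L_function_P: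
  "L_function f s = of_real (2 * pi * X) powr s * rGamma s * super_exp_decay.laplace (\<lambda>u. P (of_real u)) (s - of_real p)"
  "L_function g s = of_real (2 * pi * X) powr s * rGamma s * super_exp_decay.laplace (\<lambda>u. P (- of_real u)) (s - of_real p)"
proof -
  obtain Bf where "periodic_cusp_function f (k + 1) Bf" using periodic_cusp_function_form by blast
  then interpret f: periodic_cusp_function f "k + 1" Bf .
  obtain Bg where "periodic_cusp_function g (3 * k + 2) Bg" using periodic_cusp_function_fricke by blast
  then interpret g: periodic_cusp_function g "3 * k + 2" Bg .
  show "L_function f s = of_real (2 * pi * X) powr s * rGamma s * super_exp_decay.laplace (\<lambda>u. P (of_real u)) (s - of_real p)"
    using super_exp_decay_P(1) unfolding P_of_real by (rule f.L_function_eq[OF X_pos])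
  show "L_function g s = of_real (2 * pi * X) powr s * rGamma s * super_exp_decay.laplace (\<lambda>u. P (- of_real u)) (s - of_real p)"
    using super_exp_decay_P(2) unfolding P_neg_of_real by (rule g.L_function_eq[OF X_pos])
qed

text \<open>The exponentials of the Fourier expansion are real on the imaginary axis.\<close>

lemma P_of_real_real_or_imaginary:
  assumes "(\<forall>n\<ge>1. Im (fourier_coeff f n) = 0) \<or> (\<forall>n\<ge>1. Re (fourier_coeff f n) = 0)"
  shows "(\<forall>u. Im (P (of_real u)) = 0) \<or> (\<forall>u. Re (P (of_real u)) = 0)"
proof -
  obtain Bf where "periodic_cusp_function f (k + 1) Bf" using periodic_cusp_function_form by blast
  then interpret f: periodic_cusp_function f "k + 1" Bf .
  have s: "(\<lambda>n. fourier_coeff f n * of_real (exp (- 2 * pi * n * (X * exp u)))) sums f (\<i> * of_real (X * exp u))" for u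
  proof -
    have "exp (2 * of_real pi * \<i> * of_nat n * (\<i> * of_real (X * exp u))) = complex_of_real (exp (- 2 * pi * n * (X * exp u)))" for n
    proof -
      have "2 * of_real pi * \<i> * of_nat n * (\<i> * of_real (X * exp u)) = complex_of_real (- 2 * pi * n * (X * exp u))"
        by (simp add: complex_eq_iff)
      then show ?thesis by (simp only: exp_of_real)
    qed
    then show ?thesis
      using f.fourier_coeff_sums[of "\<i> * of_real (X * exp u)"] X_pos by (simp add: upper_half_plane_def)
  qed
  have ex: "exp (of_real (p * u)) = complex_of_real (exp (p * u))" for u by (simp only: exp_of_real)
  from assms show ?thesis
  proof
    assume a: "\<forall>n\<ge>1. Im (fourier_coeff f n) = 0"
    have "Im (fourier_coeff f n) = 0" for n using a f.fourier_coeff_0 by (cases n) auto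
    then have "(\<lambda>n. 0) sums Im (f (\<i> * of_real (X * exp u)))" for u using sums_Im[OF s[of u]] by simp
    then have "Im (f (\<i> * of_real (X * exp u))) = 0" for u using sums_unique2[OF sums_zero] by metis
    then show ?thesis unfolding P_of_real ex by simp
  next
    assume a: "\<forall>n\<ge>1. Re (fourier_coeff f n) = 0"
    have "Re (fourier_coeff f n) = 0" for n using a f.fourier_coeff_0 by (cases n) auto
    then have "(\<lambda>n. 0) sums Re (f (\<i> * of_real (X * exp u)))" for u using sums_Re[OF s[of u]] by simp
    then have "Re (f (\<i> * of_real (X * exp u))) = 0" for u using sums_unique2[OF sums_zero] by metis
    then show ?thesis unfolding P_of_real ex by simp
  qed
qed

section \<open>Bounds for \<open>P\<close> in the strip and near its boundary points\<close>

lemma Im_strip: "Im (\<i> * of_real X * exp z) = X * exp (Re z) * cos (Im z)"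
  by (simp add: Re_exp)

lemma cos_strip_pos: "\<bar>Im z\<bar> < pi / 2 \<Longrightarrow> cos (Im z) > 0"
  by (intro cos_gt_zero_pi) auto

lemma P_holomorphic: "P holomorphic_on {z. \<bar>Im z\<bar> < pi / 2}"
proof -
  have "(\<lambda>z. f (\<i> * of_real X * exp z)) holomorphic_on {z. \<bar>Im z\<bar> < pi / 2}"
  proof (rule holomorphic_on_compose_gen[OF _ holo, unfolded o_def])
    show "(\<lambda>z. \<i> * of_real X * exp z) ` {z. \<bar>Im z\<bar> < pi / 2} \<subseteq> upper_half_plane"
      unfolding upper_half_plane_def using X_pos cos_strip_pos
      by (intro image_subsetI, unfold mem_Collect_eq Im_strip) (intro mult_pos_pos, auto)
  qed (intro holomorphic_intros)
  then show ?thesis unfolding P_def[abs_def] by (intro holomorphic_intros)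
qed

end

lemma sin_ge_half:
  fixes d :: real
  assumes "0 \<le> d" "d \<le> 1"
  shows "d / 2 \<le> sin d"
proof -
  have "sin 0 - 0 / 2 \<le> sin d - d / 2"
  proof (rule DERIV_nonneg_imp_nondecreasing[OF assms(1)])
    fix x :: real assume x: "0 \<le> x" "x \<le> d"
    have "cos (pi / 3) \<le> cos x" by (rule cos_monotone_0_pi_le) (use x assms pi_gt3 in auto)
    then have "0 \<le> cos x - 1 / 2" by (simp add: cos_60)
    moreover have "((\<lambda>x. sin x - x / 2) has_real_derivative cos x - 1 / 2) (at x)"
      by (auto intro!: derivative_eq_intros)
    ultimately show "\<exists>y. ((\<lambda>x. sin x - x / 2) has_real_derivative y) (at x) \<and> 0 \<le> y" by blast
  qed
  then show ?thesis by simp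
qed

context half_integral_cusp_form
begin

text \<open>At distance \<open>d\<close> from the boundary of the strip cos(Im z) >= sin d >= d/2,
  so the argument of \<open>f\<close> has height at least X exp(-|Re z|) d/2, and the polynomial
  growth of \<open>f\<close> applies.\<close>

lemma P_strip_bound:
  "\<exists>C\<ge>0. \<forall>d z. 0 < d \<longrightarrow> d \<le> 1 \<longrightarrow> \<bar>Im z\<bar> \<le> pi / 2 - d \<longrightarrow>
     norm (P z) \<le> C * (1 / d) ^ (k + 1) * exp ((real k + 1 + p) * \<bar>Re z\<bar>)"
proof -
  obtain Bf where "periodic_cusp_function f (k + 1) Bf" using periodic_cusp_function_form by blast
  then interpret f: periodic_cusp_function f "k + 1" Bf .
  define C where "C = Bf * (1 + (2 / X) ^ (k + 1))"
  have C: "C \<ge> 0" using f.B_nonneg X_pos by (auto simp: C_def)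
  show ?thesis
  proof (intro exI[of _ C] conjI C allI impI)
    fix d :: real and z :: complex
    assume d: "0 < d" "d \<le> 1" and z: "\<bar>Im z\<bar> \<le> pi / 2 - d"
    have "cos (pi / 2 - d) \<le> cos \<bar>Im z\<bar>" by (rule cos_monotone_0_pi_le) (use z d in auto)
    then have cs: "d / 2 \<le> cos (Im z)" using sin_ge_half[of d] d by (simp add: cos_diff)
    define y where "y = Im (\<i> * of_real X * exp z)"
    have y: "y = X * exp (Re z) * cos (Im z)" unfolding y_def by (rule Im_strip)
    have qy: "X * exp (- \<bar>Re z\<bar>) * (d / 2) \<le> y"
      unfolding y using X_pos cs d by (intro mult_mono) auto
    have p0: "X * exp (- \<bar>Re z\<bar>) * (d / 2) > 0" using X_pos d by simp
    then have y0: "y > 0" using qy by linarith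
    have "1 / y \<le> 1 / (X * exp (- \<bar>Re z\<bar>) * (d / 2))" by (rule frac_le[OF _ order_refl p0 qy]) simp
    then have "1 / y \<le> 2 / X * (1 / d) * exp \<bar>Re z\<bar>" by (simp add: exp_minus field_simps)
    then have "(1 / y) ^ (k + 1) \<le> (2 / X * (1 / d) * exp \<bar>Re z\<bar>) ^ (k + 1)" using y0 by (intro power_mono) auto
    also have "\<dots> = (2 / X) ^ (k + 1) * ((1 / d) ^ (k + 1) * exp ((real k + 1) * \<bar>Re z\<bar>))"
      by (simp only: power_mult_distrib mult.assoc exp_of_nat_mult[symmetric]) simp
    finally have t: "(1 / y) ^ (k + 1) \<le> (2 / X) ^ (k + 1) * ((1 / d) ^ (k + 1) * exp ((real k + 1) * \<bar>Re z\<bar>))" .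
    have "1 * 1 \<le> (1 / d) ^ (k + 1) * exp ((real k + 1) * \<bar>Re z\<bar>)"
      using d by (intro mult_mono one_le_power) auto
    then have "1 + (1 / y) ^ (k + 1) \<le> (1 + (2 / X) ^ (k + 1)) * ((1 / d) ^ (k + 1) * exp ((real k + 1) * \<bar>Re z\<bar>))"
      using t unfolding distrib_right by linarith
    then have "norm (f (\<i> * of_real X * exp z)) \<le> Bf * ((1 + (2 / X) ^ (k + 1)) * ((1 / d) ^ (k + 1) * exp ((real k + 1) * \<bar>Re z\<bar>)))"
      using f.growth[of "\<i> * of_real X * exp z"] f.B_nonneg y0 unfolding y_def[symmetric]
      by (meson mult_left_mono order_trans)
    then have fb: "norm (f (\<i> * of_real X * exp z)) \<le> C * (1 / d) ^ (k + 1) * exp ((real k + 1) * \<bar>Re z\<bar>)"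
      by (simp only: C_def mult.assoc)
    have "p * Re z \<le> p * \<bar>Re z\<bar>" using p_pos by (intro mult_left_mono) auto
    then have eb: "norm (exp (of_real p * z)) \<le> exp (p * \<bar>Re z\<bar>)" by simp
    have "norm (P z) \<le> (C * (1 / d) ^ (k + 1) * exp ((real k + 1) * \<bar>Re z\<bar>)) * exp (p * \<bar>Re z\<bar>)"
      unfolding P_def norm_mult using C d by (intro mult_mono fb eb) auto
    also have "\<dots> = C * (1 / d) ^ (k + 1) * exp ((real k + 1 + p) * \<bar>Re z\<bar>)"
      by (simp only: mult.assoc mult_exp_exp distrib_right)
    finally show "norm (P z) \<le> C * (1 / d) ^ (k + 1) * exp ((real k + 1 + p) * \<bar>Re z\<bar>)" .
  qed
qed

text \<open>The point differs from e/c by \<open>z\<close> with c |z| <= 6 d and Im z >= d/(6 c).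
  The height in \<open>cusp_decay_4\<close> is thus at least 1/(216 c d), where 216 = 6 * 36, and
  the fourth root of exp(-2 pi/(216 c d M)) gives the constant 432.\<close>

lemma cusp_decay_rational:
  fixes e :: int
  assumes e: "e = 1 \<or> e = - 1" and c: "M = c\<^sup>2" "c > 0"
  shows "\<exists>C\<ge>0. \<forall>d w. 0 < d \<longrightarrow> d \<le> 1 / (216 * real c) \<longrightarrow> \<bar>w\<bar> \<le> d \<longrightarrow>
    norm (f (of_real (exp w / real c) * (of_int e * of_real (cos d) + \<i> * of_real (sin d))))
      \<le> C * (1 / d) ^ (k + 1) * exp (- (pi / (432 * real c * real M)) / d)"
proof -
  from cusp_decay_4[OF e, of "int c"] c obtain B where B: "B \<ge> 0"
    "\<And>z. 1 \<le> Im z / (real c * norm z)\<^sup>2 \<Longrightarrow>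
    norm (f (of_int e / of_nat c + z)) ^ 4 * (real c * norm z) ^ (4 * k + 2)
      \<le> B * exp (- 2 * pi * (Im z / (real c * norm z)\<^sup>2) / M)" by auto
  have cr: "real c \<ge> 1" using c by simp
  show ?thesis
  proof (intro exI[of _ "(1 + B) * 6 ^ (k + 1)"] conjI allI impI)
    show "(1 + B) * 6 ^ (k + 1) \<ge> 0" using B(1) by simp
    fix d w :: real assume d: "0 < d" "d \<le> 1 / (216 * real c)" and w: "\<bar>w\<bar> \<le> d"
    let ?E = "exp (- (pi / (432 * real c * real M)) / d)"
    have "1 / (216 * real c) \<le> 1" using cr by simp
    then have d1: "d \<le> 1" using d by linarith
    let ?z = "of_real (exp w / real c) * (of_int e * of_real (cos d) + \<i> * of_real (sin d))"
    define z where "z = ?z - of_int e / of_nat c"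
    have ez: "of_int e / of_nat c + z = ?z" by (simp add: z_def)
    have e2: "(of_int e)\<^sup>2 = (1::real)" using e by auto
    have Imz: "Im z = exp w * sin d / real c" by (simp add: z_def)
    have Rez: "Re z = of_int e * (exp w * cos d - 1) / real c" by (simp add: z_def diff_divide_distrib algebra_simps)
    have n2: "(real c * norm z)\<^sup>2 = (exp w * cos d - 1)\<^sup>2 + (exp w * sin d)\<^sup>2"
    proof -
      have "(real c * norm z)\<^sup>2 = (real c * Re z)\<^sup>2 + (real c * Im z)\<^sup>2"
        by (simp add: power_mult_distrib cmod_power2 distrib_left)
      also have "real c * Im z = exp w * sin d" using cr by (simp add: Imz)
      also have "real c * Re z = of_int e * (exp w * cos d - 1)" using cr by (simp add: Rez)
      finally show ?thesis by (simp add: power_mult_distrib e2)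
    qed
    have w1: "\<bar>w\<bar> \<le> 1" using w d1 by linarith
    have ew: "\<bar>exp w - 1\<bar> \<le> 2 * d"
    proof (cases "w \<ge> 0")
      case True
      then have "exp w \<le> 1 + w + w\<^sup>2" using w1 by (intro exp_bound) auto
      moreover have "w\<^sup>2 \<le> 1 * w" unfolding power2_eq_square using True w1 by (intro mult_right_mono) auto
      ultimately show ?thesis using True w by auto
    next
      case False
      then have "exp w \<le> 1" by simp
      moreover have "1 + w \<le> exp w" by (rule exp_ge_add_one_self)
      ultimately show ?thesis using w d by linarith
    qed
    have ew3: "exp w \<le> 3" using ew d1 by linarith
    have ewl: "1 / 3 \<le> exp w"
    proof -
      have "exp (- w) \<le> 3" using ew w1 exp_le order_trans[of "exp (- w)" "exp 1" 3] by (simp add: abs_le_iff)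
      then show ?thesis by (simp add: exp_minus field_simps)
    qed
    have sd: "0 < sin d" "sin d \<le> d" "d / 2 \<le> sin d"
      using d d1 pi_gt3 sin_x_le_x[of d] sin_ge_half[of d] by (auto intro!: sin_gt_zero)
    have cd: "0 \<le> cos d" "cos d \<le> 1" using d d1 pi_gt3 by (auto intro!: cos_ge_zero)
    have "1 - cos d \<le> d"
    proof -
      have "cos d * cos d \<le> cos d * 1" using cd by (intro mult_left_mono) auto
      moreover have "sin d * sin d \<le> d * 1" using sd d1 d by (intro mult_mono) auto
      moreover have "sin d * sin d + cos d * cos d = 1" using sin_cos_squared_add[of d] by (simp add: power2_eq_square)
      ultimately show ?thesis by linarith
    qed
    then have "exp w * (1 - cos d) \<le> 3 * d" using ew3 cd d by (intro mult_mono) auto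
    moreover have "exp w * (1 - cos d) \<ge> 0" using cd by simp
    moreover have "exp w * cos d - 1 = (exp w - 1) - exp w * (1 - cos d)" by (simp add: algebra_simps)
    ultimately have "\<bar>exp w * cos d - 1\<bar> \<le> 5 * d" using ew by linarith
    then have "(exp w * cos d - 1)\<^sup>2 \<le> (5 * d)\<^sup>2" using abs_le_square_iff[of "exp w * cos d - 1" "5 * d"] d by simp
    moreover have "exp w * sin d \<le> 3 * d" using ew3 sd by (intro mult_mono) auto
    then have "(exp w * sin d)\<^sup>2 \<le> (3 * d)\<^sup>2" using sd by (intro power_mono) auto
    moreover have "(5 * d)\<^sup>2 = 25 * d\<^sup>2" "(3 * d)\<^sup>2 = 9 * d\<^sup>2" by (simp_all add: power_mult_distrib)
    ultimately have n36: "(real c * norm z)\<^sup>2 \<le> 36 * d\<^sup>2" unfolding n2 using zero_le_power2[of d] by linarith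
    have Il: "d / (6 * real c) \<le> Im z"
    proof -
      have "1 / 3 * (d / 2) \<le> exp w * sin d" using ewl sd d by (intro mult_mono) auto
      then have "1 / 3 * (d / 2) / real c \<le> Im z" unfolding Imz using cr by (intro divide_right_mono) auto
      then show ?thesis by (simp add: field_simps)
    qed
    have Ip: "Im z > 0" using sd cr by (simp add: Imz)
    then have z0: "z \<noteq> 0" by auto
    have np: "(real c * norm z)\<^sup>2 > 0" using z0 cr by simp
    have ratio: "1 / (216 * real c * d) \<le> Im z / (real c * norm z)\<^sup>2"
    proof -
      have "1 / (216 * real c * d) = (d / (6 * real c)) / (36 * d\<^sup>2)" using d cr by (simp add: field_simps power2_eq_square)
      also have "\<dots> \<le> Im z / (real c * norm z)\<^sup>2" by (rule frac_le) (use Ip Il np n36 in auto)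
      finally show ?thesis .
    qed
    have "216 * real c * d \<le> 1" using d(2) cr by (simp add: field_simps)
    then have "1 \<le> 1 / (216 * real c * d)" using d cr by simp
    with ratio have "1 \<le> Im z / (real c * norm z)\<^sup>2" by linarith
    from B(2)[OF this] have b: "norm (f ?z) ^ 4 * (real c * norm z) ^ (4 * k + 2) \<le> B * exp (- 2 * pi * (Im z / (real c * norm z)\<^sup>2) / M)"
      unfolding ez .
    have "d / 6 \<le> real c * Im z" using Il cr by (simp add: field_simps)
    also have "\<dots> \<le> real c * norm z" using abs_Im_le_cmod[of z] by (intro mult_left_mono) auto
    finally have "(d / 6) ^ (4 * k + 2) \<le> (real c * norm z) ^ (4 * k + 2)" using d by (intro power_mono) auto
    \<comment> \<open>Two extra powers of d/6 make the exponent a multiple of 4, so that the fourth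
      root can be taken.\<close>
    moreover have "(d / 6) ^ (4 * k + 4) \<le> (d / 6) ^ (4 * k + 2)" using d d1 by (intro power_decreasing) auto
    moreover have pw: "((d / 6) ^ (k + 1)) ^ 4 = (d / 6) ^ (4 * k + 4)"
      unfolding power_mult[symmetric] by (rule arg_cong[where f="power _"]) simp
    ultimately have "norm (f ?z) ^ 4 * (d / 6) ^ (4 * k + 4) \<le> norm (f ?z) ^ 4 * (real c * norm z) ^ (4 * k + 2)"
      by (intro mult_left_mono) auto
    also note b
    also have "B * exp (- 2 * pi * (Im z / (real c * norm z)\<^sup>2) / M) \<le> B * exp (- 2 * pi * (1 / (216 * real c * d)) / M)"
    proof -
      have "exp (- 2 * pi * R / m) \<le> exp (- 2 * pi * r / m)" if "r \<le> R" "m > 0" for R r m :: real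
        using that by (simp add: divide_right_mono)
      from this[OF ratio, of M] show ?thesis using B(1) M_pos by (intro mult_left_mono) auto
    qed
    finally have "norm (f ?z) ^ 4 * ((d / 6) ^ (k + 1)) ^ 4 \<le> B * exp (- 2 * pi * (1 / (216 * real c * d)) / M)"
      unfolding pw .
    \<comment> \<open>B <= (1 + B)^4 turns the constant into a fourth power as well.\<close>
    also have "\<dots> \<le> (1 + B) ^ 4 * ?E ^ 4"
    proof -
      have "(1 + B) ^ 1 \<le> (1 + B) ^ 4" using B(1) by (intro power_increasing) auto
      moreover have "?E ^ 4 = exp (- 2 * pi * (1 / (216 * real c * d)) / M)"
        unfolding exp_of_nat_mult[symmetric] using d cr M_pos by (simp add: field_simps)
      ultimately show ?thesis by (intro mult_mono) auto
    qed
    finally have "(norm (f ?z) * (d / 6) ^ (k + 1)) ^ 4 \<le> ((1 + B) * ?E) ^ 4"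
      by (simp only: power_mult_distrib)
    then have "norm (f ?z) * (d / 6) ^ (k + 1) \<le> (1 + B) * ?E"
      by (rule power4_le_imp_le) (use B(1) d in \<open>auto intro!: mult_nonneg_nonneg\<close>)
    then have "norm (f ?z) \<le> (1 + B) * ?E / (d / 6) ^ (k + 1)"
      using d by (subst pos_le_divide_eq) auto
    also have "\<dots> = (1 + B) * 6 ^ (k + 1) * (1 / d) ^ (k + 1) * ?E"
      by (simp add: power_divide field_simps)
    finally show "norm (f ?z) \<le> (1 + B) * 6 ^ (k + 1) * (1 / d) ^ (k + 1) * ?E" .
  qed
qed

text \<open>For z = v + i (pi/2 - d) the numbers i exp z and i exp(-z) are exp(v) (-cos d + i sin d)
  and exp(-v) (cos d + i sin d). As X = 1/c for M = c^2, the arguments of \<open>f\<close> in P(z)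
  and P(-z) approach the cusps -1/c and 1/c; both occur because \<open>Psi\<close> combines P(z)
  with P(-z).\<close>

lemma P_cusp_decay:
  assumes c: "M = c\<^sup>2" "c > 0"
  shows "\<exists>C\<ge>0. \<forall>d v. 0 < d \<longrightarrow> d \<le> 1 / (216 * real c) \<longrightarrow> \<bar>v\<bar> \<le> d \<longrightarrow>
    norm (P (of_real v + \<i> * of_real (pi / 2 - d))) \<le> C * (1 / d) ^ (k + 1) * exp (- (pi / (432 * real c * real M)) / d) \<and>
    norm (P (- (of_real v + \<i> * of_real (pi / 2 - d)))) \<le> C * (1 / d) ^ (k + 1) * exp (- (pi / (432 * real c * real M)) / d)"
proof -
  have "sqrt (real M) = real c" using c by simp
  then have X: "X = 1 / real c" by (simp only: X_def)
  let ?E = "\<lambda>d. (1 / d) ^ (k + 1) * exp (- (pi / (432 * real c * real M)) / d)"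
  let ?Z = "\<lambda>e w d. of_real (exp w / real c) * (of_int e * of_real (cos d) + \<i> * of_real (sin d))"
  from cusp_decay_rational[of "- 1", OF _ c] obtain C1 where C1: "C1 \<ge> 0"
    "\<And>d w. 0 < d \<Longrightarrow> d \<le> 1 / (216 * real c) \<Longrightarrow> \<bar>w\<bar> \<le> d \<Longrightarrow> norm (f (?Z (- 1) w d)) \<le> C1 * ?E d"
    unfolding mult.assoc by blast
  from cusp_decay_rational[of 1, OF _ c] obtain C2 where C2: "C2 \<ge> 0"
    "\<And>d w. 0 < d \<Longrightarrow> d \<le> 1 / (216 * real c) \<Longrightarrow> \<bar>w\<bar> \<le> d \<Longrightarrow> norm (f (?Z 1 w d)) \<le> C2 * ?E d"
    unfolding mult.assoc by blast
  let ?C = "(C1 + C2) * exp p"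
  show ?thesis
  proof (intro exI[of _ ?C] conjI allI impI)
    show "?C \<ge> 0" using C1 C2 by simp
    fix d v :: real assume d: "0 < d" "d \<le> 1 / (216 * real c)" and v: "\<bar>v\<bar> \<le> d"
    let ?u = "of_real v + \<i> * of_real (pi / 2 - d)"
    have "1 / (216 * real c) \<le> 1" using c(2) by simp
    then have v1: "\<bar>v\<bar> \<le> 1" using d v by linarith
    have ev: "exp (p * x) \<le> exp p" if "\<bar>x\<bar> \<le> 1" for x using that p_pos by simp
    have E0: "?E d \<ge> 0" using d by simp
    have CE: "0 \<le> (C1 + C2) * ?E d" by (intro mult_nonneg_nonneg E0) (use C1(1) C2(1) in simp)
    have 1: "\<i> * of_real X * exp ?u = ?Z (- 1) v d"
      unfolding X by (simp add: complex_eq_iff Re_exp Im_exp cos_diff sin_diff)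
    have 2: "\<i> * of_real X * exp (- ?u) = ?Z 1 (- v) d"
      unfolding X by (simp add: complex_eq_iff Re_exp Im_exp cos_diff sin_diff)
    have "norm (P ?u) = norm (f (?Z (- 1) v d)) * exp (p * v)"
      unfolding P_def 1 norm_mult by simp
    also have "\<dots> \<le> ((C1 + C2) * ?E d) * exp p"
    proof (rule mult_mono[OF _ ev[OF v1] CE exp_ge_zero])
      show "norm (f (?Z (- 1) v d)) \<le> (C1 + C2) * ?E d"
        using C1(2)[OF d v] mult_nonneg_nonneg[OF C2(1) E0] unfolding distrib_right by linarith
    qed
    finally show "norm (P ?u) \<le> ?C * (1 / d) ^ (k + 1) * exp (- (pi / (432 * real c * real M)) / d)"
      by (simp only: mult_ac)
    have "norm (P (- ?u)) = norm (f (?Z 1 (- v) d)) * exp (p * (- v))"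
      unfolding P_def 2 norm_mult by simp
    also have "\<dots> \<le> ((C1 + C2) * ?E d) * exp p"
    proof (rule mult_mono[OF _ ev CE exp_ge_zero])
      have "\<bar>- v\<bar> \<le> d" using v by simp
      then show "norm (f (?Z 1 (- v) d)) \<le> (C1 + C2) * ?E d"
        using C2(2)[OF d, of "- v"] mult_nonneg_nonneg[OF C1(1) E0] unfolding distrib_right by linarith
    qed (use v1 in simp)
    finally show "norm (P (- ?u)) \<le> ?C * (1 / d) ^ (k + 1) * exp (- (pi / (432 * real c * real M)) / d)"
      by (simp only: mult_ac)
  qed
qed

end

section \<open>Sign changes of the Fourier transform\<close>

text \<open>\<open>Psi\<close> is the function whose Fourier transform is studied; \<open>cusp_bound\<close> is its exponential decay at the cusp that
  corresponds to the boundary point \<open>\<i> pi / 2\<close> of the strip.\<close>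

locale sign_change_setup =
  fixes Psi :: "complex \<Rightarrow> complex" and eta :: real and A C0 c0 d0 :: real and K :: nat
  assumes hol: "Psi holomorphic_on {z. \<bar>Im z\<bar> < pi / 2}"
    and decay: "super_exp_decay (\<lambda>u. Psi (of_real u))"
    and eta: "eta = 1 \<or> eta = - 1"
    and parity: "\<And>u. Psi (- of_real u) = of_real eta * Psi (of_real u)"
    and real_or_imaginary: "(\<forall>u. Im (Psi (of_real u)) = 0) \<or> (\<forall>u. Re (Psi (of_real u)) = 0)"
    and A: "A \<ge> 0" and C0: "C0 \<ge> 0" and c0: "c0 > 0" and d0: "0 < d0" "d0 \<le> 1"
    and strip_bound: "\<And>d z. 0 < d \<Longrightarrow> d \<le> 1 \<Longrightarrow> \<bar>Im z\<bar> \<le> pi / 2 - d \<Longrightarrow>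
       norm (Psi z) \<le> C0 * (1 / d) ^ K * exp (A * \<bar>Re z\<bar>)"
    and cusp_bound: "\<And>d v. 0 < d \<Longrightarrow> d \<le> d0 \<Longrightarrow> \<bar>v\<bar> \<le> d \<Longrightarrow>
       norm (Psi (of_real v + \<i> * of_real (pi / 2 - d))) \<le> C0 * (1 / d) ^ K * exp (- c0 / d)"
begin

sublocale super_exp_decay "\<lambda>u. Psi (of_real u)" by (rule decay)

definition Phi :: "complex \<Rightarrow> complex" where "Phi = laplace"

lemma xi_eq: "xi t = Phi (\<i> * of_real t)"
  by (simp add: xi_def Phi_def)

text \<open>Cauchy's inequalities are applied on circles of radius theta d, at the cost
  exp(theta^2/(4 d)). With theta^2 <= c0 and theta^2 <= 1/16 the cusp decay keeps the rate c0 - c0/4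
  = 3 c0/4, and the Gaussian tail 9/128 - 1/64 = 7/128; \<open>c2\<close> is the smaller of the
  two.\<close>

definition theta :: real where "theta = min (1 / 4) (sqrt c0)"
definition c2 :: real where "c2 = min (3 / 4 * c0) (7 / 128)"
text \<open>The bound that holds on those circles. Of the power (1/d)^(K + 2), \<open>K\<close>
  comes from \<open>strip_bound\<close> and 2 from the Gaussian normalisation sqrt(pi/d^3) <=
  2/d^2.\<close>

definition V :: "real \<Rightarrow> real" where
  "V d = 4 * C0 * exp A * (\<integral>v. exp (A * \<bar>v\<bar>) * exp (- (1/8) * v\<^sup>2) \<partial>lborel) * (1 / d) ^ (K + 2) * exp (- c2 / d)"

lemma theta: "0 < theta" "theta \<le> 1 / 4" "theta\<^sup>2 \<le> c0" "theta\<^sup>2 \<le> 1 / 16"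
proof -
  show 1: "0 < theta" "theta \<le> 1 / 4" using c0 by (auto simp: theta_def)
  have "theta\<^sup>2 \<le> (sqrt c0)\<^sup>2" using 1 by (intro power_mono) (auto simp: theta_def)
  then show "theta\<^sup>2 \<le> c0" using c0 by simp
  have "theta\<^sup>2 \<le> (1 / 4)\<^sup>2" using 1 by (intro power_mono) auto
  then show "theta\<^sup>2 \<le> 1 / 16" by (simp add: power_divide)
qed

lemma c2: "c2 > 0" using c0 by (simp add: c2_def)

lemma gaussian_moment_integral_nonneg: "0 \<le> (\<integral>v. exp (A * \<bar>v\<bar>) * exp (- (1/8) * v\<^sup>2) \<partial>lborel)"
  by (rule Bochner_Integration.integral_nonneg) simp

lemma V_nonneg: "d > 0 \<Longrightarrow> V d \<ge> 0"
  unfolding V_def using C0 gaussian_moment_integral_nonneg by (intro mult_nonneg_nonneg) auto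

text \<open>After the contour shift by pi/2 - d the Gaussian is centred up to theta d, so
  \<open>gaussian_average_bound\<close> applies with the cusp bound for |v| <= d and the strip bound
  elsewhere.\<close>

lemma laplace_gauss_bound:
  assumes d: "0 < d" "d \<le> d0" and b: "norm (of_real (pi / 2 - d) - b) = theta * d"
  shows "norm (super_exp_decay.laplace (\<lambda>t. xi t * of_real (exp (- (d ^ 3) * t\<^sup>2))) b) \<le> V d"
proof -
  have d1: "d \<le> 1" using d d0 by linarith
  have l: "d ^ 3 > 0" using d by simp
  let ?a = "pi / 2 - d"
  let ?L = "super_exp_decay.laplace (\<lambda>t. xi t * of_real (exp (- (d ^ 3) * t\<^sup>2))) b"
  let ?J = "\<integral>u. Psi (of_real u + \<i> * of_real ?a) * exp ((b - of_real ?a + \<i> * of_real u)\<^sup>2 / (4 * of_real (d ^ 3))) \<partial>lborel"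
  let ?I = "\<integral>v. exp (A * \<bar>v\<bar>) * exp (- (1/8) * v\<^sup>2) \<partial>lborel"
  have a0: "?a \<ge> 0" using d1 pi_gt3 by linarith
  have strip: "open {z::complex. \<bar>Im z\<bar> < pi / 2}" "convex {z::complex. \<bar>Im z\<bar> < pi / 2}"
  proof -
    have e: "{z::complex. \<bar>Im z\<bar> < pi / 2} = {z. Im z < pi / 2} \<inter> {z. Im z > - (pi / 2)}" by (auto simp: abs_less_iff)
    show "open {z::complex. \<bar>Im z\<bar> < pi / 2}" unfolding e
      by (intro open_Int open_halfspace_Im_lt open_halfspace_Im_gt)
    show "convex {z::complex. \<bar>Im z\<bar> < pi / 2}" unfolding e
      by (intro convex_Int convex_halfspace_Im_lt convex_halfspace_Im_gt)
  qed
  have rho: "norm (b - of_real ?a) \<le> theta * d" using b by (simp add: norm_minus_commute)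
  define E where "E = C0 * (1 / d) ^ K * exp (- c0 / d)"
  define C where "C = C0 * (1 / d) ^ K"
  have C: "C \<ge> 0" using C0 d by (simp add: C_def)
  have Cd: "norm (Psi z) \<le> C * exp (A * \<bar>Re z\<bar>)" if "\<bar>Im z\<bar> \<le> ?a" for z
    unfolding C_def using strip_bound[OF d(1) d1 that] .
  have "?L
     = of_real (sqrt (pi / d ^ 3)) * (\<integral>u. Psi (of_real u) * exp ((b + \<i> * of_real u)\<^sup>2 / (4 * of_real (d ^ 3))) \<partial>lborel)"
    by (rule laplace_xi_gauss[OF l])
  also have "(\<integral>u. Psi (of_real u) * exp ((b + \<i> * of_real u)\<^sup>2 / (4 * of_real (d ^ 3))) \<partial>lborel)
     = ?J"
  proof (rule gaussian_contour_shift[OF strip hol _ a0 _ A l])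
    show "{z. 0 \<le> Im z \<and> Im z \<le> ?a} \<subseteq> {z. \<bar>Im z\<bar> < pi / 2}" using d by auto
    show "norm (Psi z) \<le> C * exp (A * \<bar>Re z\<bar>)" if "0 \<le> Im z" "Im z \<le> ?a" for z
      using that by (intro Cd) auto
  qed
  finally have e: "?L
     = of_real (sqrt (pi / d ^ 3)) * ?J" .
  have i: "norm ?J
     \<le> exp (theta\<^sup>2 / (4 * d)) * (E + C * exp (- 9 / (128 * d))) * exp A * ?I"
  proof (rule gaussian_average_bound[OF A d(1) d1 theta(1,2) rho])
    show "norm (Psi (of_real v + \<i> * of_real ?a)) \<le> E" if "\<bar>v\<bar> \<le> d" for v
      unfolding E_def by (rule cusp_bound[OF d that])
    show "norm (Psi (of_real v + \<i> * of_real ?a)) \<le> C * exp (A * \<bar>v\<bar>)" for v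
      using Cd[of "of_real v + \<i> * of_real ?a"] a0 by simp
  qed
  have "exp (theta\<^sup>2 / (4 * d)) * (E + C * exp (- 9 / (128 * d))) = C * (exp (theta\<^sup>2 / (4 * d) - c0 / d) + exp (theta\<^sup>2 / (4 * d) - 9 / (128 * d)))"
  proof -
    have "exp (theta\<^sup>2 / (4 * d)) * (E + C * exp (- 9 / (128 * d))) =
        C * (exp (theta\<^sup>2 / (4 * d)) * exp (- c0 / d) + exp (theta\<^sup>2 / (4 * d)) * exp (- 9 / (128 * d)))"
      by (simp add: E_def C_def algebra_simps)
    then show ?thesis unfolding mult_exp_exp by simp
  qed
  also have "\<dots> \<le> C * (exp (- c2 / d) + exp (- c2 / d))"
  proof (intro mult_left_mono add_mono C)
    have "theta\<^sup>2 / (4 * d) - c0 / d = (theta\<^sup>2 / 4 - c0) / d" by (simp add: diff_divide_distrib)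
    also have "\<dots> \<le> - c2 / d" using theta(3) d(1) by (intro divide_right_mono) (auto simp: c2_def)
    finally show "exp (theta\<^sup>2 / (4 * d) - c0 / d) \<le> exp (- c2 / d)" by simp
    have "theta\<^sup>2 / (4 * d) - 9 / (128 * d) = (theta\<^sup>2 / 4 - 9 / 128) / d" by (simp add: diff_divide_distrib)
    also have "\<dots> \<le> - c2 / d" using theta(4) d(1) by (intro divide_right_mono) (auto simp: c2_def)
    finally show "exp (theta\<^sup>2 / (4 * d) - 9 / (128 * d)) \<le> exp (- c2 / d)" by simp
  qed
  finally have ii: "exp (theta\<^sup>2 / (4 * d)) * (E + C * exp (- 9 / (128 * d))) \<le> 2 * C * exp (- c2 / d)" by simp
  have sq: "sqrt (pi / d ^ 3) \<le> 2 * (1 / d)\<^sup>2"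
  proof (rule real_le_lsqrt)
    have "pi / d ^ 3 \<le> 4 / d ^ 3" using d pi_less_4 by (intro divide_right_mono) auto
    also have "\<dots> \<le> 4 / d ^ 4" using d d1 power_decreasing[of 3 4 d] by (intro divide_left_mono) auto
    also have "\<dots> = (2 * (1 / d)\<^sup>2)\<^sup>2" by (simp add: power_mult_distrib power_divide power_mult[symmetric])
    finally show "pi / d ^ 3 \<le> (2 * (1 / d)\<^sup>2)\<^sup>2" .
  qed (use d in auto)
  have "norm (?L)
     = sqrt (pi / d ^ 3) * norm ?J"
    unfolding e norm_mult norm_of_real using d by simp
  also have "\<dots> \<le> (2 * (1 / d)\<^sup>2) * ((2 * C * exp (- c2 / d)) * exp A * ?I)"
  proof (intro mult_mono sq)
    have "exp (theta\<^sup>2 / (4 * d)) * (E + C * exp (- 9 / (128 * d))) * exp A * ?I \<le> (2 * C * exp (- c2 / d)) * exp A * ?I"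
      by (intro mult_right_mono ii gaussian_moment_integral_nonneg) auto
    then show "norm ?J
      \<le> (2 * C * exp (- c2 / d)) * exp A * ?I" using i by linarith
  qed (use d in auto)
  also have "\<dots> = V d"
    by (simp add: V_def C_def power_add power2_eq_square mult_ac)
  finally show ?thesis .
qed

text \<open>Expanding the product over subsets of \<open>S\<close> leaves moments of even order,
  each bounded by Cauchy's inequality. Absolute values turn the coefficients -1/s^2 into 1/s^2, and
  \<open>sum_subsets_fact_le\<close> sums the result.\<close>

lemma prod_moment_bound:
  assumes d: "0 < d" "d \<le> d0" and S: "finite S" and b: "b \<ge> 0"
    and Cp: "\<And>x. x \<ge> 0 \<Longrightarrow> (\<Prod>s\<in>S. 1 + x\<^sup>2 / s\<^sup>2) \<le> Cp * exp (b * sqrt x)"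
  shows "integrable lborel (\<lambda>t. xi t * of_real (exp (- (d ^ 3) * t\<^sup>2)) * of_real (\<Prod>s\<in>S. 1 - t\<^sup>2 / s\<^sup>2) * exp (of_real (pi / 2 - d) * of_real t))"
    and "norm (\<integral>t. xi t * of_real (exp (- (d ^ 3) * t\<^sup>2)) * of_real (\<Prod>s\<in>S. 1 - t\<^sup>2 / s\<^sup>2) * exp (of_real (pi / 2 - d) * of_real t) \<partial>lborel)
     \<le> 2 * Cp * exp (b\<^sup>2 / (2 * (theta * d))) * V d"
proof -
  let ?p = "\<lambda>t. \<Prod>s\<in>S. 1 - t\<^sup>2 / s\<^sup>2"
  have l: "d ^ 3 > 0" using d by simp
  interpret G: super_exp_decay "\<lambda>t. xi t * of_real (exp (- (d ^ 3) * t\<^sup>2))"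
    by (rule super_exp_decay_xi_gauss[OF l])
  let ?G = "\<lambda>t. xi t * of_real (exp (- (d ^ 3) * t\<^sup>2))" and ?w = "complex_of_real (pi / 2 - d)"
  have r: "theta * d > 0" using theta d by simp
  define m where "m = (\<lambda>n. \<integral>t. ?G t * of_real t ^ n * exp (?w * of_real t) \<partial>lborel)"
  have mb: "norm (m n) \<le> fact n * V d / (theta * d) ^ n" for n
    unfolding m_def by (rule G.moment_bound[OF r laplace_gauss_bound[OF d]])
  have ex: "of_real (?p t) = (\<Sum>B\<in>Pow S. of_real (\<Prod>s\<in>B. - 1 / s\<^sup>2) * complex_of_real t ^ (2 * card B))" for t
  proof -
    have "(\<Prod>s\<in>S. (- 1 / s\<^sup>2) * t\<^sup>2 + 1) = (\<Sum>B\<in>Pow S. (\<Prod>s\<in>B. (- 1 / s\<^sup>2) * t\<^sup>2) * (\<Prod>s\<in>S-B. 1))"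
      by (rule prod_add[OF S])
    also have "\<dots> = (\<Sum>B\<in>Pow S. (\<Prod>s\<in>B. - 1 / s\<^sup>2) * t ^ (2 * card B))"
      by (intro sum.cong refl) (simp only: prod.distrib prod_constant power_mult power_one mult_1_right)
    also have "(\<Prod>s\<in>S. (- 1 / s\<^sup>2) * t\<^sup>2 + 1) = (?p t)" by (intro prod.cong refl) simp
    finally have "complex_of_real (?p t) = of_real (\<Sum>B\<in>Pow S. (\<Prod>s\<in>B. - 1 / s\<^sup>2) * t ^ (2 * card B))" by (rule arg_cong)
    then show ?thesis by (simp only: of_real_sum of_real_mult of_real_power)
  qed
  have ex2: "?G t * of_real (?p t) * exp (?w * of_real t) =
     (\<Sum>B\<in>Pow S. of_real (\<Prod>s\<in>B. - 1 / s\<^sup>2) * (?G t * of_real t ^ (2 * card B) * exp (?w * of_real t)))" for t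
    unfolding ex sum_distrib_left sum_distrib_right by (intro sum.cong refl) (simp only: mult_ac)
  have int: "integrable lborel (\<lambda>t. of_real (\<Prod>s\<in>B. - 1 / s\<^sup>2) * (?G t * of_real t ^ (2 * card B) * exp (?w * of_real t)))" for B
    by (intro integrable_mult_right G.integrable_power_exp)
  show "integrable lborel (\<lambda>t. ?G t * of_real (?p t) * exp (?w * of_real t))"
    unfolding ex2 by (intro Bochner_Integration.integrable_sum int)
  have "(\<integral>t. ?G t * of_real (?p t) * exp (?w * of_real t) \<partial>lborel) = (\<Sum>B\<in>Pow S. of_real (\<Prod>s\<in>B. - 1 / s\<^sup>2) * m (2 * card B))"
    unfolding ex2 m_def by (subst Bochner_Integration.integral_sum[OF int]) (simp only: integral_mult_right_zero)
  also have "norm \<dots> \<le> (\<Sum>B\<in>Pow S. (\<Prod>s\<in>B. 1 / s\<^sup>2) * (fact (2 * card B) * V d / (theta * d) ^ (2 * card B)))"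
  proof (rule sum_norm_le)
    fix B assume "B \<in> Pow S"
    have "norm (complex_of_real (\<Prod>s\<in>B. - 1 / s\<^sup>2)) = (\<Prod>s\<in>B. 1 / s\<^sup>2)"
      unfolding norm_of_real abs_prod by simp
    then show "norm (of_real (\<Prod>s\<in>B. - 1 / s\<^sup>2) * m (2 * card B)) \<le> (\<Prod>s\<in>B. 1 / s\<^sup>2) * (fact (2 * card B) * V d / (theta * d) ^ (2 * card B))"
      unfolding norm_mult by (simp only:) (intro mult_left_mono mb prod_nonneg, simp)
  qed
  also have "\<dots> = (\<Sum>B\<in>Pow S. (\<Prod>s\<in>B. 1 / s\<^sup>2) * (fact (2 * card B) / (theta * d) ^ (2 * card B))) * V d"
    unfolding sum_distrib_right by (intro sum.cong refl) simp
  also have "\<dots> \<le> (2 * Cp * exp (b\<^sup>2 / (2 * (theta * d)))) * V d"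
  proof (intro mult_right_mono sum_subsets_fact_le S r b V_nonneg d)
    show "(\<Prod>s\<in>S. 1 + 1 / s\<^sup>2 * x\<^sup>2) \<le> Cp * exp (b * sqrt x)" if "x \<ge> 0" for x
      using Cp[OF that] by simp
  qed auto
  finally show "norm (\<integral>t. ?G t * of_real (?p t) * exp (?w * of_real t) \<partial>lborel)
     \<le> 2 * Cp * exp (b\<^sup>2 / (2 * (theta * d))) * V d" .
qed

end

text \<open>The points with a punctured neighbourhood where Q > 0, and those where Q < 0, form
  disjoint open sets covering the interval, so connectedness leaves one of them. Punctured
  neighbourhoods admit zeros of even order; at such points the weak inequality follows by
  continuity.\<close>

lemma constant_sign_if_locally_constant_sign:
  fixes Q :: "real \<Rightarrow> real"
  assumes cont: "continuous_on UNIV Q"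
    and loc: "\<And>t. a < t \<Longrightarrow> t < b \<Longrightarrow> \<exists>e>0. (\<forall>s. 0 < \<bar>s - t\<bar> \<and> \<bar>s - t\<bar> < e \<longrightarrow> Q s > 0) \<or>
        (\<forall>s. 0 < \<bar>s - t\<bar> \<and> \<bar>s - t\<bar> < e \<longrightarrow> Q s < 0)"
  shows "(\<forall>t. a < t \<and> t < b \<longrightarrow> Q t \<ge> 0) \<or> (\<forall>t. a < t \<and> t < b \<longrightarrow> Q t \<le> 0)"
proof -
  define U where "U = (\<lambda>g :: real \<Rightarrow> real. {t. \<exists>e>0. \<forall>s. 0 < \<bar>s - t\<bar> \<and> \<bar>s - t\<bar> < e \<longrightarrow> g s > 0})"
  have openU: "open (U g)" for g
    unfolding open_dist
  proof
    fix t assume "t \<in> U g"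
    then obtain e where e: "e > 0" "\<And>s. 0 < \<bar>s - t\<bar> \<Longrightarrow> \<bar>s - t\<bar> < e \<Longrightarrow> g s > 0" unfolding U_def by blast
    show "\<exists>e>0. \<forall>y. dist y t < e \<longrightarrow> y \<in> U g"
    proof (intro exI[of _ e] conjI e(1) allI impI)
      fix y assume y: "dist y t < e"
      show "y \<in> U g"
      proof (cases "y = t")
        case True
        then show ?thesis using \<open>t \<in> U g\<close> by simp
      next
        case False
        let ?e = "min \<bar>y - t\<bar> (e - \<bar>y - t\<bar>)"
        have "?e > 0" using False y by (auto simp: dist_real_def)
        moreover have "g s > 0" if "0 < \<bar>s - y\<bar>" "\<bar>s - y\<bar> < ?e" for s
        proof (rule e(2))
          have 1: "\<bar>s - y\<bar> < \<bar>y - t\<bar>" "\<bar>s - y\<bar> < e - \<bar>y - t\<bar>" using that by auto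
          show "0 < \<bar>s - t\<bar>" using 1(1) by (auto simp: abs_if split: if_splits)
          show "\<bar>s - t\<bar> < e" using 1(2) abs_triangle_ineq[of "s - y" "y - t"] by linarith
        qed
        ultimately show ?thesis unfolding U_def by blast
      qed
    qed
  qed
  have nonneg: "g t \<ge> 0" if t: "t \<in> U g" and g: "continuous_on UNIV g" for g t
  proof (rule ccontr)
    assume "\<not> g t \<ge> 0"
    then have neg: "g t < 0" by simp
    have "isCont g t" using g by (simp add: continuous_on_eq_continuous_at)
    then have "\<forall>\<^sub>F s in at t. g s < 0"
      using neg by (auto simp: isCont_def intro: order_tendstoD)
    moreover from t obtain e where e: "e > 0" "\<And>s. 0 < \<bar>s - t\<bar> \<Longrightarrow> \<bar>s - t\<bar> < e \<Longrightarrow> g s > 0" unfolding U_def by blast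
    have "\<forall>\<^sub>F s in at t. g s > 0"
      unfolding eventually_at using e by (intro exI[of _ e]) (auto simp: dist_real_def)
    ultimately have "\<forall>\<^sub>F s in at t. False" by eventually_elim auto
    then show False by simp
  qed
  have cover: "{a<..<b} \<subseteq> U Q \<union> U (\<lambda>t. - Q t)"
  proof
    fix t assume "t \<in> {a<..<b}"
    then have "a < t" "t < b" by auto
    from loc[OF this] show "t \<in> U Q \<union> U (\<lambda>t. - Q t)" unfolding U_def by auto
  qed
  have disj: "U Q \<inter> U (\<lambda>t. - Q t) = {}"
  proof -
    have False if "t \<in> U Q" "t \<in> U (\<lambda>t. - Q t)" for t
    proof -
      from that obtain e1 e2 where e: "e1 > 0" "e2 > 0"
        "\<And>s. 0 < \<bar>s - t\<bar> \<Longrightarrow> \<bar>s - t\<bar> < e1 \<Longrightarrow> Q s > 0" "\<And>s. 0 < \<bar>s - t\<bar> \<Longrightarrow> \<bar>s - t\<bar> < e2 \<Longrightarrow> - Q s > 0"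
        unfolding U_def by blast
      let ?s = "t + min e1 e2 / 2"
      have "Q ?s > 0" by (rule e(3)) (use e(1,2) in \<open>auto simp: min_def\<close>)
      moreover have "- Q ?s > 0" by (rule e(4)) (use e(1,2) in \<open>auto simp: min_def\<close>)
      ultimately show False by simp
    qed
    then show ?thesis by blast
  qed
  have "connected {a<..<b}" by simp
  then have "U Q \<inter> {a<..<b} = {} \<or> U (\<lambda>t. - Q t) \<inter> {a<..<b} = {}"
    by (rule connectedD) (use openU cover disj in auto)
  then show ?thesis
  proof
    assume E: "U Q \<inter> {a<..<b} = {}"
    have "t \<in> U (\<lambda>t. - Q t)" if "a < t" "t < b" for t
    proof -
      have "t \<in> {a<..<b}" using that by simp
      then show ?thesis using E cover by blast
    qed
    then have "- Q t \<ge> 0" if "a < t" "t < b" for t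
      using nonneg[of t "\<lambda>t. - Q t"] cont that by (simp add: continuous_on_minus)
    then show ?thesis by force
  next
    assume E: "U (\<lambda>t. - Q t) \<inter> {a<..<b} = {}"
    have "t \<in> U Q" if "a < t" "t < b" for t
    proof -
      have "t \<in> {a<..<b}" using that by simp
      then show ?thesis using E cover by blast
    qed
    then have "Q t \<ge> 0" if "a < t" "t < b" for t using nonneg[of t Q] cont that by simp
    then show ?thesis by blast
  qed
qed

section \<open>Zeros of odd order and sign changes on the real line\<close>

context sign_change_setup
begin

lemma Phi_holomorphic: "Phi holomorphic_on S"
  unfolding Phi_def by (rule laplace_holomorphic)

lemma xi_minus: "xi (- t) = of_real eta * xi t"
proof -
  have "xi (- t) = (\<integral>u. Psi (of_real u) * exp (\<i> * of_real (- t) * of_real u) \<partial>lborel)"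
    by (simp add: xi_def laplace_def)
  also have "\<dots> = (\<integral>u. Psi (of_real (0 + (- 1) * u)) * exp (\<i> * of_real (- t) * of_real (0 + (- 1) * u)) \<partial>lborel)"
    using lborel_integral_real_affine[of "- 1" "\<lambda>u. Psi (of_real u) * exp (\<i> * of_real (- t) * of_real u)" 0] by simp
  also have "\<dots> = (\<integral>u. of_real eta * (Psi (of_real u) * exp (\<i> * of_real t * of_real u)) \<partial>lborel)"
    by (intro Bochner_Integration.integral_cong refl) (simp add: parity)
  also have "\<dots> = of_real eta * xi t"
    unfolding integral_mult_right_zero by (simp add: xi_def laplace_def)
  finally show ?thesis .
qed

text \<open>Conjugation multiplies \<open>xi t\<close> by the product of two signs, one for
  \<open>Psi\<close> being real or imaginary and one for its parity. If the product is 1,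
  \<open>xi\<close> is real; otherwise i times it is.\<close>

lemma xi_real_multiple: "\<exists>\<omega>. norm \<omega> = 1 \<and> (\<forall>t. Im (\<omega> * xi t) = 0)"
proof -
  obtain e :: real where e: "e = 1 \<or> e = - 1" "\<And>u. cnj (Psi (of_real u)) = of_real e * Psi (of_real u)"
  proof -
    from real_or_imaginary show ?thesis
    proof
      assume "\<forall>u. Im (Psi (of_real u)) = 0"
      then show ?thesis by (intro that[of 1]) (auto simp: complex_eq_iff)
    next
      assume "\<forall>u. Re (Psi (of_real u)) = 0"
      then show ?thesis by (intro that[of "- 1"]) (auto simp: complex_eq_iff)
    qed
  qed
  have cn: "cnj (xi t) = of_real (e * eta) * xi t" for t
  proof -
    have "cnj (xi t) = (\<integral>u. cnj (Psi (of_real u) * exp (\<i> * of_real t * of_real u)) \<partial>lborel)"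
      unfolding xi_def laplace_def by (rule Bochner_Integration.integral_cnj[symmetric])
    also have "\<dots> = (\<integral>u. of_real e * (Psi (of_real u) * exp (\<i> * of_real (- t) * of_real u)) \<partial>lborel)"
      by (intro Bochner_Integration.integral_cong refl) (simp add: e(2) exp_cnj)
    also have "\<dots> = of_real e * xi (- t)"
      unfolding integral_mult_right_zero by (simp add: xi_def laplace_def)
    finally show ?thesis by (simp add: xi_minus)
  qed
  have "e * eta = 1 \<or> e * eta = - 1" using e(1) eta by auto
  then show ?thesis
  proof
    assume h: "e * eta = 1"
    have "Im (1 * xi t) = 0" for t using cn[of t] unfolding h by (simp add: complex_eq_iff)
    then show ?thesis by (intro exI[of _ 1]) auto
  next
    assume h: "e * eta = - 1"
    have "Im (\<i> * xi t) = 0" for t using cn[of t] unfolding h by (simp add: complex_eq_iff)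
    then show ?thesis by (intro exI[of _ \<i>]) auto
  qed
qed

definition omega :: complex where
  "omega = (SOME \<omega>. norm \<omega> = 1 \<and> (\<forall>t. Im (\<omega> * xi t) = 0))"

lemma omega: "norm omega = 1" "Im (omega * xi t) = 0"
  using someI_ex[OF xi_real_multiple] unfolding omega_def by blast+

definition R :: "real \<Rightarrow> real" where "R t = Re (omega * xi t)"

lemma of_real_R: "of_real (R t) = omega * xi t"
  using omega(2)[of t] by (simp add: R_def complex_eq_iff)

lemma abs_R: "\<bar>R t\<bar> = norm (xi t)"
  using arg_cong[OF of_real_R[of t], of norm] omega(1) by (simp add: norm_mult)

lemma R_minus: "R (- t) = eta * R t"
proof -
  have "complex_of_real (R (- t)) = of_real (eta * R t)"
    unfolding of_real_R of_real_mult xi_minus by simp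
  then show ?thesis by (simp only: of_real_eq_iff)
qed

lemma continuous_R: "continuous_on S R"
  unfolding R_def by (intro continuous_intros continuous_xi)

text \<open>The point 0 is excluded because the elements occur as denominators in \<open>QT\<close>;
  a lower bound for the count survives this.\<close>

definition odd_zeros :: "real set" where
  "odd_zeros = {t. 0 < t \<and> Phi (\<i> * of_real t) = 0 \<and> odd (zorder Phi (\<i> * of_real t))}"

lemma finite_zeros:
  assumes "\<exists>z. Phi z \<noteq> 0"
  shows "finite {t. 0 \<le> t \<and> t \<le> T \<and> Phi (\<i> * of_real t) = 0}"
proof (cases "Phi constant_on UNIV")
  case True
  then have "Phi z \<noteq> 0" for z using assms by (auto simp: constant_on_def)
  then show ?thesis by simp
next
  case False
  let ?K = "(\<lambda>t. \<i> * complex_of_real t) ` {0..T}"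
  have "finite {z \<in> ?K. Phi z = 0}"
  proof (rule holomorphic_compact_finite_zeros[OF Phi_holomorphic[of UNIV]])
    show "compact ?K" by (intro compact_continuous_image continuous_intros) auto
  qed (use False in auto)
  moreover have "(\<lambda>t. \<i> * complex_of_real t) ` {t. 0 \<le> t \<and> t \<le> T \<and> Phi (\<i> * of_real t) = 0} \<subseteq> {z \<in> ?K. Phi z = 0}" by auto
  ultimately have "finite ((\<lambda>t. \<i> * complex_of_real t) ` {t. 0 \<le> t \<and> t \<le> T \<and> Phi (\<i> * of_real t) = 0})"
    by (rule finite_subset[rotated])
  then show ?thesis by (rule finite_imageD) (auto simp: inj_on_def)
qed

lemma finite_odd_zeros:
  assumes "\<exists>z. Phi z \<noteq> 0"
  shows "finite (odd_zeros \<inter> {..T})"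
  by (rule finite_subset[OF _ finite_zeros[OF assms, of T]]) (auto simp: odd_zeros_def)

text \<open>The factorisation of \<open>Phi\<close> at i t0 given by \<open>zorder\<close>,
  restricted to the imaginary axis; the phases i^n and \<open>omega\<close> are absorbed in the
  cofactor. At a point that is no zero, \<open>n\<close> is 0.\<close>

lemma R_local_factor:
  assumes nz: "\<exists>z. Phi z \<noteq> 0" and t0: "t0 > 0"
  shows "\<exists>q n r. r > 0 \<and> (\<forall>t. \<bar>t - t0\<bar> < r \<longrightarrow> R t = (t - t0) ^ n * q t) \<and>
    isCont q t0 \<and> q t0 \<noteq> 0 \<and> (odd n \<longleftrightarrow> t0 \<in> odd_zeros)"
proof -
  let ?z = "\<i> * complex_of_real t0"
  have "(if Phi ?z = 0 then 0 < zorder Phi ?z else zorder Phi ?z = 0) \<and>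
     (\<exists>r>0. cball ?z r \<subseteq> UNIV \<and> zor_poly Phi ?z holomorphic_on cball ?z r \<and>
       (\<forall>w\<in>cball ?z r. Phi w = zor_poly Phi ?z w * (w - ?z) ^ nat (zorder Phi ?z) \<and> zor_poly Phi ?z w \<noteq> 0))"
    by (rule zorder_exist_zero[OF Phi_holomorphic[of UNIV]]) (use nz in auto)
  then obtain r where ord: "if Phi ?z = 0 then 0 < zorder Phi ?z else zorder Phi ?z = 0"
    and r: "r > 0" "zor_poly Phi ?z holomorphic_on cball ?z r"
    "\<And>w. w \<in> cball ?z r \<Longrightarrow> Phi w = zor_poly Phi ?z w * (w - ?z) ^ nat (zorder Phi ?z)" "\<And>w. w \<in> cball ?z r \<Longrightarrow> zor_poly Phi ?z w \<noteq> 0"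
    by blast
  define n where "n = nat (zorder Phi ?z)"
  define G where "G = (\<lambda>t. omega * zor_poly Phi ?z (\<i> * of_real t) * \<i> ^ n)"
  have inb: "\<i> * of_real t \<in> cball ?z r" if "\<bar>t - t0\<bar> < r" for t
  proof -
    have "?z - \<i> * of_real t = \<i> * of_real (t0 - t)" by (simp add: algebra_simps)
    then show ?thesis using that by (simp add: dist_norm norm_mult del: of_real_diff)
  qed
  have fac: "of_real (R t) = of_real ((t - t0) ^ n) * G t" if "\<bar>t - t0\<bar> < r" for t
  proof -
    have "\<i> * of_real t - ?z = \<i> * of_real (t - t0)" by (simp add: algebra_simps)
    then show ?thesis
      unfolding of_real_R xi_eq r(3)[OF inb[OF that]] G_def n_def[symmetric] by (simp add: power_mult_distrib)
  qed
  have "continuous_on (cball ?z r) (zor_poly Phi ?z)" by (rule holomorphic_on_imp_continuous_on[OF r(2)])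
  then have "isCont (zor_poly Phi ?z) ?z" using r(1) by (intro continuous_on_interior) auto
  moreover have "isCont (\<lambda>t. \<i> * complex_of_real t) t0" by (intro continuous_intros)
  ultimately have "isCont (\<lambda>t. zor_poly Phi ?z (\<i> * of_real t)) t0"
    by (rule isCont_o2[rotated])
  then have cG: "isCont G t0" unfolding G_def by (intro continuous_intros)
  have G0: "G t0 \<noteq> 0" using r(4)[OF inb[of t0]] r(1) omega(1) by (auto simp: G_def)
  have ImG: "Im (G t) = 0" if "\<bar>t - t0\<bar> < r" "t \<noteq> t0" for t
  proof -
    have "Im (of_real ((t - t0) ^ n) * G t) = 0" using fac[OF that(1)] by (metis Im_complex_of_real)
    then show ?thesis using that(2) by (simp add: Im_complex_of_real)
  qed
  \<comment> \<open>For n > 0 the factorisation says nothing about G at t0 itself; that it is real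
    there follows by continuity.\<close>
  have "\<forall>\<^sub>F t in at t0. Im (G t) = 0"
    unfolding eventually_at using r(1) ImG by (intro exI[of _ r]) (auto simp: dist_real_def)
  then have "((\<lambda>t. Im (G t)) \<longlongrightarrow> 0) (at t0)" by (rule tendsto_eventually)
  moreover have "((\<lambda>t. Im (G t)) \<longlongrightarrow> Im (G t0)) (at t0)" using cG unfolding isCont_def by (rule tendsto_Im)
  ultimately have "Im (G t0) = 0" using LIM_unique by blast
  then have q0: "Re (G t0) \<noteq> 0" using G0 by (auto simp: complex_eq_iff)
  show ?thesis
  proof (intro exI[of _ "\<lambda>t. Re (G t)"] exI[of _ n] exI[of _ r] conjI r(1) allI impI)
    show "R t = (t - t0) ^ n * Re (G t)" if "\<bar>t - t0\<bar> < r" for t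
      using arg_cong[OF fac[OF that], of Re] by simp
    show "isCont (\<lambda>t. Re (G t)) t0" using cG unfolding isCont_def by (rule tendsto_Re)
    show "Re (G t0) \<noteq> 0" by (rule q0)
    show "odd n \<longleftrightarrow> t0 \<in> odd_zeros"
      using ord t0 by (auto simp: n_def odd_zeros_def even_nat_iff split: if_splits)
  qed
qed

text \<open>An even polynomial with value 1 at 0 which, on (0, T), changes sign exactly at the zeros
  of \<open>R\<close> of odd order.\<close>

definition QT :: "real \<Rightarrow> real \<Rightarrow> real" where
  "QT T t = (\<Prod>s\<in>odd_zeros \<inter> {..T}. 1 - t\<^sup>2 / s\<^sup>2)"

text \<open>If t0 is a zero of odd order, \<open>QT\<close> contributes one further factor t - t0,
  otherwise none. In both cases the product is an even power of t - t0 times a continuous function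
  that does not vanish at t0. The condition t0 < T puts t0 into the product when it is such a
  zero.\<close>

lemma R_QT_local_sign:
  assumes nz: "\<exists>z. Phi z \<noteq> 0" and t0: "0 < t0" "t0 < T"
  shows "\<exists>e>0. (\<forall>s. 0 < \<bar>s - t0\<bar> \<and> \<bar>s - t0\<bar> < e \<longrightarrow> R s * QT T s > 0) \<or>
        (\<forall>s. 0 < \<bar>s - t0\<bar> \<and> \<bar>s - t0\<bar> < e \<longrightarrow> R s * QT T s < 0)"
proof -
  let ?S = "odd_zeros \<inter> {..T}"
  have fin: "finite ?S" by (rule finite_odd_zeros[OF nz])
  have Spos: "s > 0" if "s \<in> ?S" for s using that by (simp add: odd_zeros_def)
  obtain q n r where r: "r > 0" and qR: "\<forall>t. \<bar>t - t0\<bar> < r \<longrightarrow> R t = (t - t0) ^ n * q t"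
    and qc: "isCont q t0" and q0: "q t0 \<noteq> 0" and par: "odd n \<longleftrightarrow> t0 \<in> odd_zeros"
    using R_local_factor[OF nz t0(1)] by (elim exE conjE)
  define p where "p = (\<lambda>t. \<Prod>s\<in>?S - {t0}. 1 - t\<^sup>2 / s\<^sup>2)"
  have p0: "p t0 \<noteq> 0"
  proof -
    have "1 - t0\<^sup>2 / s\<^sup>2 \<noteq> 0" if "s \<in> ?S - {t0}" for s
      using that Spos[of s] t0 power2_eq_iff_nonneg[of t0 s] by (auto simp: field_simps)
    then show ?thesis unfolding p_def using fin by (subst prod_zero_iff) auto
  qed
  have pc: "isCont p t0"
  proof -
    have "isCont (\<lambda>t. 1 - t\<^sup>2 / s\<^sup>2) t0" for s :: real by (cases "s = 0") (auto intro!: continuous_intros)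
    then show ?thesis unfolding p_def by (intro continuous_prod)
  qed
  obtain h m where h: "isCont h t0" "h t0 \<noteq> 0" "\<And>t. \<bar>t - t0\<bar> < r \<Longrightarrow> R t * QT T t = (t - t0) ^ (2 * m) * h t"
  proof (cases "t0 \<in> odd_zeros")
    case True
    then have tS: "t0 \<in> ?S" using t0 by simp
    from True par obtain m where m: "n = 2 * m + 1" by (auto elim: oddE)
    let ?h = "\<lambda>t. q t * (- (t + t0) / t0\<^sup>2) * p t"
    have QTe: "QT T t = (t - t0) * (- (t + t0) / t0\<^sup>2) * p t" for t
    proof -
      have "QT T t = (1 - t\<^sup>2 / t0\<^sup>2) * p t" unfolding QT_def p_def by (rule prod.remove[OF fin tS])
      also have "1 - t\<^sup>2 / t0\<^sup>2 = (t - t0) * (- (t + t0) / t0\<^sup>2)"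
        using t0 by (simp add: field_simps power2_eq_square)
      finally show ?thesis .
    qed
    show ?thesis
    proof (rule that[of ?h "m + 1"])
      show "isCont ?h t0" using t0 by (intro continuous_intros qc pc) auto
      show "?h t0 \<noteq> 0" using q0 p0 t0 by simp
      show "R t * QT T t = (t - t0) ^ (2 * (m + 1)) * ?h t" if "\<bar>t - t0\<bar> < r" for t
        unfolding qR[rule_format, OF that] QTe m by (simp add: mult_ac)
    qed
  next
    case False
    with par obtain m where m: "n = 2 * m" by (auto elim: evenE)
    have "QT T t = p t" for t using False by (simp add: QT_def p_def)
    then show ?thesis using qR p0 q0 m
      by (intro that[of "\<lambda>t. q t * p t" m]) (auto intro!: continuous_intros qc pc simp: mult.assoc)
  qed
  obtain e where e: "e > 0" "\<And>t. \<bar>t - t0\<bar> < e \<Longrightarrow> h t * h t0 > 0"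
  proof -
    have "isCont (\<lambda>t. h t * h t0) t0" by (intro continuous_intros h(1))
    then have "((\<lambda>t. h t * h t0) \<longlongrightarrow> h t0 * h t0) (nhds t0)"
      using tendsto_at_iff_tendsto_nhds[of "\<lambda>t. h t * h t0" t0] by (simp only: isCont_def)
    moreover have "h t0 * h t0 > 0" using h(2) by (simp add: zero_less_mult_iff not_less less_le)
    ultimately have "\<forall>\<^sub>F t in nhds t0. h t * h t0 > 0" by (rule order_tendstoD(1))
    then show ?thesis using that unfolding eventually_nhds_metric dist_real_def by blast
  qed
  have pw: "(s - t0) ^ (2 * m) > 0" if "0 < \<bar>s - t0\<bar>" for s
    using that by (simp add: power_mult)
  show ?thesis
  proof (cases "h t0 > 0")
    case True
    have "R s * QT T s > 0" if "0 < \<bar>s - t0\<bar>" "\<bar>s - t0\<bar> < min e r" for s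
      using that h(3)[of s] e(2)[of s] pw[of s] True by (simp add: zero_less_mult_iff)
    then show ?thesis using e(1) r by (intro exI[of _ "min e r"]) auto
  next
    case False
    then have "h t0 < 0" using h(2) by simp
    then have "R s * QT T s < 0" if "0 < \<bar>s - t0\<bar>" "\<bar>s - t0\<bar> < min e r" for s
      using that h(3)[of s] e(2)[of s] pw[of s] by (simp add: zero_less_mult_iff mult_less_0_iff)
    then show ?thesis using e(1) r by (intro exI[of _ "min e r"]) auto
  qed
qed

lemma continuous_QT: "continuous_on S (QT T)"
  unfolding QT_def
proof (rule continuous_on_prod)
  fix s :: real
  show "continuous_on S (\<lambda>t. 1 - t\<^sup>2 / s\<^sup>2)" by (cases "s = 0") (auto intro!: continuous_intros)
qed

lemma R_QT_constant_sign:
  assumes "\<exists>z. Phi z \<noteq> 0"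
  shows "(\<forall>t. 0 < t \<and> t < T \<longrightarrow> R t * QT T t \<ge> 0) \<or> (\<forall>t. 0 < t \<and> t < T \<longrightarrow> R t * QT T t \<le> 0)"
  by (rule constant_sign_if_locally_constant_sign[OF _ R_QT_local_sign[OF assms]])
    (intro continuous_intros continuous_R continuous_QT)

end

lemma one_minus_sum_le_prod:
  fixes f :: "'a \<Rightarrow> real"
  assumes "finite S" "\<And>s. s \<in> S \<Longrightarrow> 0 \<le> f s \<and> f s \<le> 1"
  shows "1 - sum f S \<le> (\<Prod>s\<in>S. 1 - f s)"
  using assms
proof (induction S rule: finite_induct)
  case (insert s S)
  let ?P = "\<Prod>s\<in>S. 1 - f s"
  have "?P \<le> 1" "?P \<ge> 0" using insert by (auto intro!: prod_le_1 prod_nonneg)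
  then have "f s * ?P \<le> f s * 1" using insert by (intro mult_left_mono) auto
  moreover have "1 - sum f S \<le> ?P" using insert by simp
  ultimately show ?case using insert by (simp add: algebra_simps)
qed simp

text \<open>Each factor is polynomial in x, so any rate \<open>D\<close> is attainable at the price
  of the constant; the induction gives D/2 to the new factor and D/2 to the rest.\<close>

lemma finite_prod_le_exp_sqrt:
  fixes S :: "real set"
  assumes "finite S" "D > 0"
  shows "\<exists>C\<ge>0. \<forall>x\<ge>0. (\<Prod>s\<in>S. 1 + x\<^sup>2 / s\<^sup>2) \<le> C * exp (D * sqrt x)"
  using assms
proof (induction S arbitrary: D rule: finite_induct)
  case empty
  then show ?case by (intro exI[of _ 1]) auto
next
  case (insert s S)
  from insert.IH[of "D / 2"] insert.prems obtain C where
    C: "C \<ge> 0" "\<And>x. x \<ge> 0 \<Longrightarrow> (\<Prod>s\<in>S. 1 + x\<^sup>2 / s\<^sup>2) \<le> C * exp (D / 2 * sqrt x)" by auto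
  define c where "c = 1 + fact 4 / ((D / 2) ^ 4 * s\<^sup>2)"
  have c: "c \<ge> 0" using insert.prems by (simp add: c_def)
  have f: "1 + x\<^sup>2 / s\<^sup>2 \<le> c * exp (D / 2 * sqrt x)" if x: "x \<ge> 0" for x
  proof -
    have "(D / 2 * sqrt x) ^ 4 \<le> fact 4 * exp (D / 2 * sqrt x)"
      using x insert.prems by (intro power_le_fact_times_exp) auto
    moreover have "(D / 2 * sqrt x) ^ 4 = (D / 2) ^ 4 * x\<^sup>2"
      using x power_mult[of "sqrt x" 2 2] unfolding power_mult_distrib by simp
    ultimately have "x\<^sup>2 \<le> fact 4 * exp (D / 2 * sqrt x) / (D / 2) ^ 4"
      using insert.prems by (subst pos_le_divide_eq) (auto simp: mult_ac)
    then have "x\<^sup>2 / s\<^sup>2 \<le> fact 4 * exp (D / 2 * sqrt x) / (D / 2) ^ 4 / s\<^sup>2"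
      by (rule divide_right_mono) simp
    then have "x\<^sup>2 / s\<^sup>2 \<le> fact 4 / ((D / 2) ^ 4 * s\<^sup>2) * exp (D / 2 * sqrt x)" by simp
    moreover have "1 \<le> exp (D / 2 * sqrt x)" using x insert.prems by simp
    ultimately show ?thesis unfolding c_def distrib_right by linarith
  qed
  show ?case
  proof (intro exI[of _ "c * C"] conjI allI impI)
    show "c * C \<ge> 0" using c C by simp
    fix x :: real assume x: "x \<ge> 0"
    have "(\<Prod>s\<in>insert s S. 1 + x\<^sup>2 / s\<^sup>2) = (1 + x\<^sup>2 / s\<^sup>2) * (\<Prod>s\<in>S. 1 + x\<^sup>2 / s\<^sup>2)" using insert by simp
    also have "\<dots> \<le> (c * exp (D / 2 * sqrt x)) * (C * exp (D / 2 * sqrt x))"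
      using c by (intro mult_mono f C(2) x prod_nonneg) (auto intro!: add_nonneg_nonneg)
    also have "\<dots> = c * C * exp (D * sqrt x)" by (simp add: mult_exp_exp)
    finally show "(\<Prod>s\<in>insert s S. 1 + x\<^sup>2 / s\<^sup>2) \<le> c * C * exp (D * sqrt x)" .
  qed
qed

context sign_change_setup
begin

text \<open>The counting bound is known only from \<open>T0\<close> on. The zeros up to
  \<open>T0\<close> are absorbed at rate \<open>D\<close> with a constant, and those beyond satisfy
  the counting bound at every height, giving 2 pi D. It matters that \<open>C\<close> does not
  depend on \<open>T\<close>.\<close>

lemma odd_zeros_prod_bound:
  assumes nz: "\<exists>z. Phi z \<noteq> 0" and D: "D > 0" and T0: "T0 > 0"
    and N: "\<And>T. T \<ge> T0 \<Longrightarrow> real (card (odd_zeros \<inter> {..T})) \<le> D * sqrt T"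
  shows "\<exists>C\<ge>0. \<forall>T\<ge>T0. \<forall>x\<ge>0. (\<Prod>s\<in>odd_zeros \<inter> {..T}. 1 + x\<^sup>2 / s\<^sup>2) \<le> C * exp ((2 * pi + 1) * D * sqrt x)"
proof -
  note fin = finite_odd_zeros[OF nz]
  obtain C where C: "C \<ge> 0" "\<And>x. x \<ge> 0 \<Longrightarrow> (\<Prod>s\<in>odd_zeros \<inter> {..T0}. 1 + x\<^sup>2 / s\<^sup>2) \<le> C * exp (D * sqrt x)"
    using finite_prod_le_exp_sqrt[OF fin D, of T0] by blast
  show ?thesis
  proof (intro exI[of _ C] conjI C(1) allI impI)
    fix T x :: real assume T: "T \<ge> T0" and x: "x \<ge> 0"
    let ?S = "odd_zeros \<inter> {T0<..T}"
    have split: "odd_zeros \<inter> {..T} = (odd_zeros \<inter> {..T0}) \<union> ?S" using T by auto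
    have finS: "finite ?S" by (rule finite_subset[OF _ fin[of T]]) auto
    have "(\<Prod>s\<in>?S. 1 + x\<^sup>2 / s\<^sup>2) \<le> exp (2 * pi * D * sqrt x)"
    proof (rule prod_le_exp_sqrt[OF finS _ D x])
      show "?S \<subseteq> {0<..}" using T0 by auto
      fix \<tau> :: real assume \<tau>: "\<tau> > 0"
      show "real (card (?S \<inter> {..\<tau>})) \<le> D * sqrt \<tau>"
      proof (cases "\<tau> \<ge> T0")
        case True
        have "card (?S \<inter> {..\<tau>}) \<le> card (odd_zeros \<inter> {..\<tau>})" by (intro card_mono fin) auto
        then show ?thesis using N[OF True] by linarith
      next
        case False
        then have "?S \<inter> {..\<tau>} = {}" by auto
        then show ?thesis using D \<tau> by simp
      qed
    qed
    then have "(\<Prod>s\<in>odd_zeros \<inter> {..T0}. 1 + x\<^sup>2 / s\<^sup>2) * (\<Prod>s\<in>?S. 1 + x\<^sup>2 / s\<^sup>2) \<le> (C * exp (D * sqrt x)) * exp (2 * pi * D * sqrt x)"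
      using C by (intro mult_mono C(2) x prod_nonneg) (auto intro!: add_nonneg_nonneg)
    also have "\<dots> = C * exp ((2 * pi + 1) * D * sqrt x)"
      by (simp add: mult_exp_exp algebra_simps)
    finally show "(\<Prod>s\<in>odd_zeros \<inter> {..T}. 1 + x\<^sup>2 / s\<^sup>2) \<le> C * exp ((2 * pi + 1) * D * sqrt x)"
      unfolding split by (subst prod.union_disjoint) (use fin finS in auto)
  qed
qed

section \<open>The weighted integral bounded from below\<close>

lemma QT_minus: "QT T (- t) = QT T t"
  by (simp add: QT_def)

lemma abs_QT_le: "\<bar>QT T t\<bar> \<le> (\<Prod>s\<in>odd_zeros \<inter> {..T}. 1 + \<bar>t\<bar>\<^sup>2 / s\<^sup>2)"
proof -
  have "\<bar>1 - t\<^sup>2 / s\<^sup>2\<bar> \<le> 1 + t\<^sup>2 / s\<^sup>2" for s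
    using abs_triangle_ineq4[of 1 "t\<^sup>2 / s\<^sup>2"] by simp
  then show ?thesis unfolding QT_def abs_prod by (intro prod_mono) auto
qed

text \<open>The sum of 1/s^2 is at most the product of 1 + 1/s^2, hence at most \<open>B\<close>,
  and 1 minus the sum of t^2/s^2 bounds the product from below. With \<open>B\<close> uniform in
  \<open>T\<close>, this gives a neighbourhood of 0 independent of \<open>T\<close>.\<close>

lemma QT_ge_half:
  assumes nz: "\<exists>z. Phi z \<noteq> 0" and B: "(\<Prod>s\<in>odd_zeros \<inter> {..T}. 1 + 1\<^sup>2 / s\<^sup>2) \<le> B" and t: "t\<^sup>2 * B \<le> 1 / 2"
  shows "QT T t \<ge> 1 / 2"
proof -
  let ?S = "odd_zeros \<inter> {..T}"
  have fin: "finite ?S" by (rule finite_odd_zeros[OF nz])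
  have "(\<Sum>s\<in>?S. 1\<^sup>2 / s\<^sup>2) \<le> (\<Prod>s\<in>?S. 1 + 1\<^sup>2 / s\<^sup>2)" by (rule sum_le_prod) auto
  then have sB: "(\<Sum>s\<in>?S. 1\<^sup>2 / s\<^sup>2) \<le> B" using B by linarith
  have "(\<Sum>s\<in>?S. t\<^sup>2 / s\<^sup>2) = t\<^sup>2 * (\<Sum>s\<in>?S. 1\<^sup>2 / s\<^sup>2)" by (simp add: sum_distrib_left)
  also have "\<dots> \<le> t\<^sup>2 * B" by (intro mult_left_mono sB) simp
  finally have s2: "(\<Sum>s\<in>?S. t\<^sup>2 / s\<^sup>2) \<le> 1 / 2" using t by linarith
  have "t\<^sup>2 / s\<^sup>2 \<le> 1" if "s \<in> ?S" for s
  proof -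
    have "t\<^sup>2 / s\<^sup>2 \<le> (\<Sum>s\<in>?S. t\<^sup>2 / s\<^sup>2)" by (intro member_le_sum that fin) auto
    then show ?thesis using s2 by linarith
  qed
  then have "1 - (\<Sum>s\<in>?S. t\<^sup>2 / s\<^sup>2) \<le> QT T t" unfolding QT_def by (intro one_minus_sum_le_prod fin) auto
  then show ?thesis using s2 by linarith
qed

lemma R_not_AE_zero:
  assumes nz: "\<exists>z. Phi z \<noteq> 0" and tau: "tau > 0"
  shows "\<not> (AE t in lborel. 0 < t \<and> t < tau \<longrightarrow> R t = 0)"
proof
  assume "AE t in lborel. 0 < t \<and> t < tau \<longrightarrow> R t = 0"
  moreover have "AE t in lborel. t \<notin> {t. 0 \<le> t \<and> t \<le> tau \<and> Phi (\<i> * of_real t) = 0}"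
    by (intro AE_not_in finite_imp_null_set_lborel finite_zeros[OF nz])
  ultimately have "AE t in lborel. t \<notin> {0<..<tau}"
  proof eventually_elim
    case (elim t)
    then show ?case using abs_R[of t] by (auto simp: xi_eq)
  qed
  then have "{0<..<tau} \<in> null_sets lborel" by (subst AE_iff_null_sets) auto
  then have "emeasure lborel {0<..<tau} = 0" by (rule null_setsD1)
  then show False using tau by simp
qed

text \<open>A minorant free of \<open>d\<close> and \<open>T\<close>: 1/2 comes from
  \<open>QT\<close>, exp(-1) from the Gaussian for d, t <= 1, another 1/2 from taking the even part,
  and the difference of exponentials from the worse sign of \<open>eta\<close> with pi/2 - d >=
  1/2.\<close>

definition lower :: "real \<Rightarrow> real \<Rightarrow> real" where
  "lower tau t = indicator {0<..<tau} t * (\<bar>R t\<bar> * (exp (- 1) / 4 * (exp (t / 2) - exp (- t / 2))))"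

lemma lower_nonneg: "lower tau t \<ge> 0"
  unfolding lower_def by (auto simp: indicator_def)

lemma lower_integrable: "integrable lborel (lower tau)"
proof -
  have "integrable lborel (\<lambda>t. indicator {0..tau} t *\<^sub>R (\<bar>R t\<bar> * (exp (- 1) / 4 * (exp (t / 2) - exp (- t / 2)))))"
    by (rule borel_integrable_compact) (auto intro!: continuous_intros continuous_R)
  moreover have [measurable]: "R \<in> borel_measurable borel" by (rule borel_measurable_continuous_onI[OF continuous_R])
  have "lower tau \<in> borel_measurable lborel" unfolding lower_def[abs_def] by measurable
  ultimately show ?thesis
    by (rule Bochner_Integration.integrable_bound) (auto simp: lower_def indicator_def)
qed

lemma lower_integral_pos:
  assumes nz: "\<exists>z. Phi z \<noteq> 0" and tau: "tau > 0"
  shows "(\<integral>t. lower tau t \<partial>lborel) > 0"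
proof -
  have "(\<integral>t. lower tau t \<partial>lborel) \<noteq> 0"
  proof
    assume "(\<integral>t. lower tau t \<partial>lborel) = 0"
    then have "AE t in lborel. lower tau t = 0"
      by (subst (asm) integral_nonneg_eq_0_iff_AE[OF lower_integrable]) (auto simp: lower_nonneg)
    then have "AE t in lborel. 0 < t \<and> t < tau \<longrightarrow> R t = 0"
      by eventually_elim (auto simp: lower_def indicator_def)
    then show False using R_not_AE_zero[OF assms] by blast
  qed
  moreover have "(\<integral>t. lower tau t \<partial>lborel) \<ge> 0" by (rule Bochner_Integration.integral_nonneg) (simp add: lower_nonneg)
  ultimately show ?thesis by simp
qed

text \<open>Controls the range |t| >= T, where the sign is unknown. It is free of \<open>T\<close>
  and integrable for fixed \<open>d\<close>, so its tail vanishes as \<open>T\<close> grows.\<close>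

definition major :: "real \<Rightarrow> real \<Rightarrow> real \<Rightarrow> real \<Rightarrow> real" where
  "major C b d t = (\<integral>u. norm (Psi (of_real u)) \<partial>lborel) * (C * exp (b * sqrt \<bar>t\<bar>)) * (exp (- (d ^ 3) * t\<^sup>2) * exp ((pi / 2 - d) * \<bar>t\<bar>))"

lemma major_integrable:
  assumes "d > 0" "b \<ge> 0" "C \<ge> 0"
  shows "integrable lborel (major C b d)"
proof (rule Bochner_Integration.integrable_bound)
  let ?X = "\<integral>u. norm (Psi (of_real u)) \<partial>lborel"
  have X: "?X \<ge> 0" by (rule Bochner_Integration.integral_nonneg) simp
  show "integrable lborel (\<lambda>t. (?X * C * exp b) * (exp ((b + (pi / 2 - d)) * \<bar>t\<bar>) * exp (- (d ^ 3) * t\<^sup>2)))"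
    by (intro integrable_mult_right gaussian_integrable_abs) (use assms in simp)
  show "major C b d \<in> borel_measurable lborel" unfolding major_def[abs_def] by measurable
  show "AE t in lborel. norm (major C b d t) \<le> norm ((?X * C * exp b) * (exp ((b + (pi / 2 - d)) * \<bar>t\<bar>) * exp (- (d ^ 3) * t\<^sup>2)))"
  proof (rule AE_I2)
    fix t :: real
    have "sqrt \<bar>t\<bar> \<le> 1 + \<bar>t\<bar>"
      by (rule real_le_lsqrt) (auto simp: power2_eq_square algebra_simps)
    then have "b * sqrt \<bar>t\<bar> \<le> b * (1 + \<bar>t\<bar>)" using assms by (intro mult_left_mono)
    then have "exp (b * sqrt \<bar>t\<bar>) \<le> exp b * exp (b * \<bar>t\<bar>)" by (simp add: mult_exp_exp distrib_left)
    then have "major C b d t \<le> ?X * (C * (exp b * exp (b * \<bar>t\<bar>))) * (exp (- (d ^ 3) * t\<^sup>2) * exp ((pi / 2 - d) * \<bar>t\<bar>))"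
      unfolding major_def using X assms by (intro mult_right_mono mult_left_mono) auto
    also have "\<dots> = (?X * C * exp b) * (exp (b * \<bar>t\<bar>) * exp ((pi / 2 - d) * \<bar>t\<bar>) * exp (- (d ^ 3) * t\<^sup>2))"
      by (simp only: mult_ac)
    also have "\<dots> = (?X * C * exp b) * (exp ((b + (pi / 2 - d)) * \<bar>t\<bar>) * exp (- (d ^ 3) * t\<^sup>2))"
      by (simp only: mult_exp_exp distrib_right)
    finally show "norm (major C b d t) \<le> norm ((?X * C * exp b) * (exp ((b + (pi / 2 - d)) * \<bar>t\<bar>) * exp (- (d ^ 3) * t\<^sup>2)))"
      using X assms by (simp add: major_def abs_mult)
  qed
qed

lemma major_tail_tendsto_0:
  assumes "d > 0" "b \<ge> 0" "C \<ge> 0"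
  shows "(\<lambda>n. \<integral>t. indicator {t. real n \<le> \<bar>t\<bar>} t * major C b d t \<partial>lborel) \<longlonglongrightarrow> 0"
proof -
  note mi = major_integrable[OF assms]
  have [measurable]: "major C b d \<in> borel_measurable borel" using mi by auto
  have "(\<lambda>n. \<integral>t. indicator {t. real n \<le> \<bar>t\<bar>} t * major C b d t \<partial>lborel) \<longlonglongrightarrow> (\<integral>t. 0 \<partial>(lborel :: real measure))"
  proof (rule integral_dominated_convergence[where w="\<lambda>t. norm (major C b d t)"])
    show "(\<lambda>t. indicator {t. real n \<le> \<bar>t\<bar>} t * major C b d t) \<in> borel_measurable lborel" for n by measurable
    show "integrable lborel (\<lambda>t. norm (major C b d t))" using mi by simp
    show "AE t in lborel. (\<lambda>n. indicator {t. real n \<le> \<bar>t\<bar>} t * major C b d t) \<longlonglongrightarrow> 0"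
    proof (rule AE_I2)
      fix t :: real
      obtain n where n: "\<bar>t\<bar> < real n" using reals_Archimedean2 by blast
      have "\<forall>\<^sub>F m in sequentially. indicator {t. real m \<le> \<bar>t\<bar>} t * major C b d t = 0"
        using eventually_ge_at_top[of n] by eventually_elim (use n in \<open>auto simp: indicator_def\<close>)
      then show "(\<lambda>n. indicator {t. real n \<le> \<bar>t\<bar>} t * major C b d t) \<longlonglongrightarrow> 0" by (rule tendsto_eventually)
    qed
    show "AE t in lborel. norm (indicator {t. real n \<le> \<bar>t\<bar>} t * major C b d t) \<le> norm (major C b d t)" for n
      by (auto simp: indicator_def)
  qed auto
  then show ?thesis by simp
qed

text \<open>Up to a global sign the even part of the integrand dominates \<open>lower\<close> on (0,
  tau), is nonnegative up to \<open>T\<close>, and is at least minus \<open>major\<close> beyond; by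
  evenness the same holds for t < 0. Its integral is that of the original integrand, which
  \<open>prod_moment_bound\<close> estimates from above.\<close>

lemma weighted_integral_lower_bound:
  assumes nz: "\<exists>z. Phi z \<noteq> 0" and d: "0 < d" "d \<le> d0" and C: "C \<ge> 0" and b: "b \<ge> 0"
    and bd: "\<And>x. x \<ge> 0 \<Longrightarrow> (\<Prod>s\<in>odd_zeros \<inter> {..T}. 1 + x\<^sup>2 / s\<^sup>2) \<le> C * exp (b * sqrt x)"
    and tau: "0 < tau" "tau \<le> 1" "tau\<^sup>2 * (C * exp b) \<le> 1 / 2" and T: "T \<ge> 1"
  shows "(\<integral>t. lower tau t \<partial>lborel) - (\<integral>t. indicator {t. T \<le> \<bar>t\<bar>} t * major C b d t \<partial>lborel)
     \<le> 2 * C * exp (b\<^sup>2 / (2 * (theta * d))) * V d"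
proof -
  let ?S = "odd_zeros \<inter> {..T}" and ?a = "pi / 2 - d"
  let ?X = "\<integral>u. norm (Psi (of_real u)) \<partial>lborel"
  have d1: "d \<le> 1" using d d0 by linarith
  have a: "?a \<ge> 1 / 2" using d1 pi_gt3 by linarith
  have fin: "finite ?S" by (rule finite_odd_zeros[OF nz])
  let ?kk = "\<lambda>t. xi t * of_real (exp (- (d ^ 3) * t\<^sup>2)) * of_real (\<Prod>s\<in>?S. 1 - t\<^sup>2 / s\<^sup>2) * exp (of_real ?a * of_real t)"
  note kk = prod_moment_bound[OF d fin b bd]
  define k where "k = (\<lambda>t. R t * QT T t * (exp (- (d ^ 3) * t\<^sup>2) * exp (?a * t)))"
  have ok: "of_real (k t) = omega * ?kk t" for t
    unfolding k_def of_real_mult of_real_R QT_def by (simp add: exp_of_real[symmetric] mult_ac)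
  have ik': "integrable lborel (\<lambda>t. complex_of_real (k t))"
    unfolding ok by (intro integrable_mult_right kk(1))
  have ik: "integrable lborel k" using integrable_Re[OF ik'] by simp
  have "norm (\<integral>t. complex_of_real (k t) \<partial>lborel) = norm (\<integral>t. ?kk t \<partial>lborel)"
    unfolding ok integral_mult_right_zero norm_mult omega(1) by simp
  then have kI: "\<bar>\<integral>t. k t \<partial>lborel\<bar> \<le> 2 * C * exp (b\<^sup>2 / (2 * (theta * d))) * V d"
    using kk(2) by (simp only: integral_complex_of_real norm_of_real)
  \<comment> \<open>\<open>R\<close> has parity \<open>eta\<close> and \<open>QT\<close> is even, so
    the exponential becomes cosh for eta = 1 and sinh for eta = -1, both nonnegative for t >
    0.\<close>
  define m where "m = (\<lambda>t. (k t + k (- t)) / 2)"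
  have ikm: "integrable lborel (\<lambda>t. k (- t))" using lborel_integrable_real_affine[OF ik, of "- 1" 0] by simp
  have im: "integrable lborel m" unfolding m_def by (intro integrable_divide Bochner_Integration.integrable_add ik ikm)
  have "(\<integral>t. k (- t) \<partial>lborel) = (\<integral>t. k t \<partial>lborel)" using lborel_integral_real_affine[of "- 1" k 0] by simp
  then have mI: "(\<integral>t. m t \<partial>lborel) = (\<integral>t. k t \<partial>lborel)"
    unfolding m_def using ik ikm by simp
  have m: "m t = R t * QT T t * exp (- (d ^ 3) * t\<^sup>2) * ((exp (?a * t) + eta * exp (- ?a * t)) / 2)" for t
    unfolding m_def k_def R_minus QT_minus by (simp add: algebra_simps)
  have m_even: "m (- t) = m t" for t by (simp add: m_def add.commute)
  obtain sg :: real where sg: "sg = 1 \<or> sg = - 1" "\<And>t. 0 < t \<Longrightarrow> t < T \<Longrightarrow> sg * (R t * QT T t) \<ge> 0"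
  proof -
    from R_QT_constant_sign[OF nz, of T] show ?thesis
    proof
      assume "\<forall>t. 0 < t \<and> t < T \<longrightarrow> 0 \<le> R t * QT T t"
      then show ?thesis by (intro that[of 1]) auto
    next
      assume "\<forall>t. 0 < t \<and> t < T \<longrightarrow> R t * QT T t \<le> 0"
      then show ?thesis by (intro that[of "- 1"]) auto
    qed
  qed
  have X: "?X \<ge> 0" by (rule Bochner_Integration.integral_nonneg) simp
  have kern: "exp (?a * t) + eta * exp (- ?a * t) \<ge> exp (t / 2) - exp (- t / 2)" if "t > 0" for t
  proof -
    have "t / 2 \<le> ?a * t" using a that mult_right_mono[of "1/2" ?a t] by simp
    then have "exp (t / 2) \<le> exp (?a * t)" "exp (- ?a * t) \<le> exp (- t / 2)"
      unfolding exp_le_cancel_iff mult_minus_left by linarith+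
    moreover have "eta * exp (- ?a * t) \<ge> - exp (- ?a * t)" using eta by auto
    ultimately show ?thesis by linarith
  qed
  have pw_pos: "lower tau t - indicator {t. T \<le> \<bar>t\<bar>} t * major C b d t \<le> sg * m t" if t: "t > 0" for t
  proof -
    have kn: "exp (?a * t) + eta * exp (- ?a * t) \<ge> 0"
    proof -
      have "exp (- t / 2) \<le> exp (t / 2)" using t by simp
      then show ?thesis using kern[OF t] by linarith
    qed
    have sm: "sg * m t = sg * (R t * QT T t) * (exp (- (d ^ 3) * t\<^sup>2) * ((exp (?a * t) + eta * exp (- ?a * t)) / 2))"
      unfolding m by (simp only: mult.assoc)
    show ?thesis
    proof (cases "t < T")
      case True
      have ind: "indicator {t. T \<le> \<bar>t\<bar>} t = (0::real)" using True t by simp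
      have nn: "sg * m t \<ge> 0" unfolding sm by (rule mult_nonneg_nonneg[OF sg(2)[OF t True]]) (use kn in simp)
      show ?thesis
      proof (cases "t < tau")
        case False
        then show ?thesis using nn by (simp add: ind lower_def)
      next
        case True
        have "t\<^sup>2 \<le> tau\<^sup>2" using True t by (intro power_mono) auto
        then have "t\<^sup>2 * (C * exp b) \<le> tau\<^sup>2 * (C * exp b)" using C by (intro mult_right_mono) auto
        then have "t\<^sup>2 * (C * exp b) \<le> 1 / 2" using tau(3) by linarith
        moreover have "(\<Prod>s\<in>?S. 1 + 1\<^sup>2 / s\<^sup>2) \<le> C * exp b" using bd[of 1] by simp
        ultimately have q: "QT T t \<ge> 1 / 2" using QT_ge_half[OF nz] by blast
        have "sg * (R t * QT T t) = \<bar>R t * QT T t\<bar>"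
          using sg(1) sg(2)[OF t \<open>t < T\<close>] by auto
        also have "\<dots> = \<bar>R t\<bar> * QT T t" using q by (simp add: abs_mult)
        also have "\<dots> \<ge> \<bar>R t\<bar> * (1 / 2)" by (intro mult_left_mono q) simp
        finally have r: "sg * (R t * QT T t) \<ge> \<bar>R t\<bar> * (1 / 2)" .
        have "d ^ 3 * t\<^sup>2 \<le> 1 * 1"
          using d d1 True t tau by (intro mult_mono power_le_one) auto
        then have e: "exp (- (d ^ 3) * t\<^sup>2) \<ge> exp (- 1)" by simp
        have p: "exp (t / 2) - exp (- t / 2) \<ge> 0" using t by simp
        have ker: "exp (- 1) * ((exp (t / 2) - exp (- t / 2)) / 2) \<le> exp (- (d ^ 3) * t\<^sup>2) * ((exp (?a * t) + eta * exp (- ?a * t)) / 2)"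
          using e p kern[OF t] by (intro mult_mono divide_right_mono) auto
        have "\<bar>R t\<bar> * (1 / 2) * (exp (- 1) * ((exp (t / 2) - exp (- t / 2)) / 2)) \<le> sg * m t"
          unfolding sm by (rule mult_mono[OF r ker sg(2)[OF t \<open>t < T\<close>]]) (use p in simp)
        moreover have "lower tau t = \<bar>R t\<bar> * (1 / 2) * (exp (- 1) * ((exp (t / 2) - exp (- t / 2)) / 2))"
          using True t by (simp add: lower_def)
        ultimately show ?thesis by (simp add: ind)
      qed
    next
      case False
      then have ind: "indicator {t. T \<le> \<bar>t\<bar>} t = (1::real)" using t by simp
      have low: "lower tau t = 0" using False T tau by (simp add: lower_def)
      have "\<bar>sg * m t\<bar> = \<bar>R t\<bar> * \<bar>QT T t\<bar> * (exp (- (d ^ 3) * t\<^sup>2) * ((exp (?a * t) + eta * exp (- ?a * t)) / 2))"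
        unfolding sm using sg(1) kn by (auto simp: abs_mult)
      also have "\<dots> \<le> ?X * (C * exp (b * sqrt \<bar>t\<bar>)) * (exp (- (d ^ 3) * t\<^sup>2) * exp (?a * \<bar>t\<bar>))"
      proof (rule mult_mono)
        show "\<bar>R t\<bar> * \<bar>QT T t\<bar> \<le> ?X * (C * exp (b * sqrt \<bar>t\<bar>))"
          using X by (intro mult_mono order_trans[OF abs_QT_le bd]) (auto simp: abs_R xi_bounded)
        have "eta * exp (- ?a * t) \<le> exp (?a * t)"
        proof -
          have "exp (- ?a * t) \<le> exp (?a * t)" using a t by simp
          moreover have "eta * exp (- ?a * t) \<le> exp (- ?a * t)" using eta by auto
          ultimately show ?thesis by linarith
        qed
        then show "exp (- (d ^ 3) * t\<^sup>2) * ((exp (?a * t) + eta * exp (- ?a * t)) / 2) \<le> exp (- (d ^ 3) * t\<^sup>2) * exp (?a * \<bar>t\<bar>)"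
          using t by (intro mult_left_mono) auto
        show "0 \<le> ?X * (C * exp (b * sqrt \<bar>t\<bar>))" using X C by simp
        show "0 \<le> exp (- (d ^ 3) * t\<^sup>2) * ((exp (?a * t) + eta * exp (- ?a * t)) / 2)" using kn by simp
      qed
      also have "\<dots> = major C b d t" by (simp only: major_def)
      finally show ?thesis unfolding ind low by linarith
    qed
  qed
  have pw: "lower tau t - indicator {t. T \<le> \<bar>t\<bar>} t * major C b d t \<le> sg * m t" if "t \<noteq> 0" for t
  proof (cases "t > 0")
    case True
    then show ?thesis by (rule pw_pos)
  next
    case False
    then have nt: "- t > 0" using that by simp
    have "major C b d (- t) = major C b d t" by (simp add: major_def)
    moreover have "lower tau t = 0" using False by (simp add: lower_def)
    moreover have "indicator {t. T \<le> \<bar>t\<bar>} (- t) = (indicator {t. T \<le> \<bar>t\<bar>} t :: real)" by (simp add: indicator_def)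
    ultimately show ?thesis using pw_pos[OF nt] lower_nonneg[of tau "- t"] by (simp add: m_even)
  qed
  have majm: "major C b d \<in> borel_measurable lborel" using major_integrable[OF d(1) b C] by auto
  have iE: "integrable lborel (\<lambda>t. indicator {t. T \<le> \<bar>t\<bar>} t * major C b d t)"
    by (rule Bochner_Integration.integrable_bound[OF major_integrable[OF d(1) b C]])
      (use majm in \<open>measurable, auto simp: indicator_def\<close>)
  have "(\<integral>t. lower tau t \<partial>lborel) - (\<integral>t. indicator {t. T \<le> \<bar>t\<bar>} t * major C b d t \<partial>lborel)
     = (\<integral>t. lower tau t - indicator {t. T \<le> \<bar>t\<bar>} t * major C b d t \<partial>lborel)"
    by (rule Bochner_Integration.integral_diff[OF lower_integrable iE, symmetric])
  also have "\<dots> \<le> (\<integral>t. sg * m t \<partial>lborel)"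
  proof (rule integral_mono_AE)
    show "AE t in lborel. lower tau t - indicator {t. T \<le> \<bar>t\<bar>} t * major C b d t \<le> sg * m t"
      using AE_lborel_singleton[of "0::real"] by eventually_elim (rule pw)
  qed (intro Bochner_Integration.integrable_diff lower_integrable iE integrable_mult_right im)+
  also have "\<dots> = sg * (\<integral>t. k t \<partial>lborel)" by (simp add: mI)
  also have "\<dots> \<le> \<bar>\<integral>t. k t \<partial>lborel\<bar>" using sg(1) by auto
  also note kI
  finally show ?thesis .
qed

text \<open>If zeros were sparse, letting \<open>T\<close> tend to infinity would leave a positive
  constant \<open>c3\<close> below exp(b^2/(2 theta d)) V(d) for all small \<open>d\<close>. The
  hypothesis \<open>small\<close> says that the decay exp(-c2/d) in \<open>V\<close> beats the first
  factor, a contradiction as \<open>d\<close> tends to 0.\<close>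

lemma many_odd_zeros:
  assumes nz: "\<exists>z. Phi z \<noteq> 0" and D: "D > 0" and small: "((2 * pi + 1) * D)\<^sup>2 / (2 * theta) < c2" and T0: "T0 > 0"
  shows "\<exists>T\<ge>T0. real (card (odd_zeros \<inter> {..T})) > D * sqrt T"
proof (rule ccontr)
  assume "\<not> ?thesis"
  then have N: "\<And>T. T \<ge> T0 \<Longrightarrow> real (card (odd_zeros \<inter> {..T})) \<le> D * sqrt T" by (auto simp: not_less)
  define b where "b = (2 * pi + 1) * D"
  have b: "b \<ge> 0" using D by (simp add: b_def)
  obtain C where C: "C \<ge> 0" and bd: "\<And>T x. T \<ge> T0 \<Longrightarrow> x \<ge> 0 \<Longrightarrow> (\<Prod>s\<in>odd_zeros \<inter> {..T}. 1 + x\<^sup>2 / s\<^sup>2) \<le> C * exp (b * sqrt x)"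
    using odd_zeros_prod_bound[OF nz D T0 N] unfolding b_def by blast
  \<comment> \<open>Chosen so that tau <= 1 and tau C exp b <= 1/2, as \<open>QT_ge_half\<close>
    requires with B = C exp b; it depends neither on \<open>T\<close> nor on
    \<open>d\<close>.\<close>
  define tau where "tau = 1 / (1 + 2 * (C * exp b))"
  have Cb: "C * exp b \<ge> 0" using C by simp
  have tau: "0 < tau" "tau \<le> 1" using Cb by (auto simp: tau_def)
  have tau3: "tau\<^sup>2 * (C * exp b) \<le> 1 / 2"
  proof -
    have "tau\<^sup>2 * (C * exp b) \<le> (tau * 1) * (C * exp b)"
      unfolding power2_eq_square using tau Cb by (intro mult_right_mono mult_left_mono) auto
    also have "\<dots> \<le> 1 / 2" using Cb by (simp add: tau_def divide_simps)
    finally show ?thesis .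
  qed
  define c3 where "c3 = (\<integral>t. lower tau t \<partial>lborel)"
  have c3: "c3 > 0" unfolding c3_def by (rule lower_integral_pos[OF nz tau(1)])
  have main: "c3 \<le> 2 * C * exp (b\<^sup>2 / (2 * (theta * d))) * V d" if d: "0 < d" "d \<le> d0" for d
  proof -
    have "(\<lambda>n. c3 - (\<integral>t. indicator {t. real n \<le> \<bar>t\<bar>} t * major C b d t \<partial>lborel)) \<longlonglongrightarrow> c3 - 0"
      by (intro tendsto_diff tendsto_const major_tail_tendsto_0 d b C)
    moreover have "\<forall>n\<ge>nat \<lceil>max 1 T0\<rceil>. c3 - (\<integral>t. indicator {t. real n \<le> \<bar>t\<bar>} t * major C b d t \<partial>lborel) \<le> 2 * C * exp (b\<^sup>2 / (2 * (theta * d))) * V d"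
    proof (intro allI impI)
      fix n assume "n \<ge> nat \<lceil>max 1 T0\<rceil>"
      then have n: "real n \<ge> 1" "real n \<ge> T0" by linarith+
      show "c3 - (\<integral>t. indicator {t. real n \<le> \<bar>t\<bar>} t * major C b d t \<partial>lborel) \<le> 2 * C * exp (b\<^sup>2 / (2 * (theta * d))) * V d"
        unfolding c3_def by (rule weighted_integral_lower_bound[OF nz d C b bd[OF n(2)] tau tau3 n(1)])
    qed
    ultimately have "c3 - 0 \<le> 2 * C * exp (b\<^sup>2 / (2 * (theta * d))) * V d" by (intro LIMSEQ_le_const2) blast+
    then show ?thesis by simp
  qed
  define g where "g = c2 - b\<^sup>2 / (2 * theta)"
  have g: "g > 0" using small by (simp add: g_def b_def)
  let ?G = "4 * C0 * exp A * (\<integral>v. exp (A * \<bar>v\<bar>) * exp (- (1/8) * v\<^sup>2) \<partial>lborel)"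
  \<comment> \<open>\<open>V\<close> carries (1/d)^(K + 2), but the constant bounds (1/d)^(K + 3)
    exp(-g/d): the spare factor \<open>d\<close> makes the final bound W d tend to 0.\<close>
  define W where "W = 2 * C * ?G * (fact (K + 3) / g ^ (K + 3))"
  have W: "W \<ge> 0" unfolding W_def using C C0 g gaussian_moment_integral_nonneg by (intro mult_nonneg_nonneg) auto
  have lin: "c3 \<le> W * d" if d: "0 < d" "d \<le> d0" for d
  proof -
    have "(g / d) ^ (K + 3) \<le> fact (K + 3) * exp (g / d)" by (rule power_le_fact_times_exp) (use g d in simp)
    then have "(1 / d) ^ (K + 3) * g ^ (K + 3) \<le> fact (K + 3) * exp (g / d)"
      by (simp add: power_divide mult.commute)
    then have "(1 / d) ^ (K + 3) \<le> fact (K + 3) * exp (g / d) / g ^ (K + 3)"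
      using g by (subst pos_le_divide_eq) auto
    then have "(1 / d) ^ (K + 3) * exp (- g / d) \<le> fact (K + 3) * exp (g / d) / g ^ (K + 3) * exp (- g / d)"
      by (rule mult_right_mono) simp
    also have "\<dots> = fact (K + 3) / g ^ (K + 3)" by (simp add: exp_minus)
    finally have p: "(1 / d) ^ (K + 3) * exp (- g / d) \<le> fact (K + 3) / g ^ (K + 3)" .
    have q: "(1 / d) ^ (K + 2) = d * (1 / d) ^ (K + 3)"
      using d by (simp add: eval_nat_numeral)
    have "b\<^sup>2 / (2 * (theta * d)) + - c2 / d = - g / d"
      using theta(1) d by (simp add: g_def field_simps)
    then have e: "exp (b\<^sup>2 / (2 * (theta * d))) * exp (- c2 / d) = exp (- g / d)"
      by (simp only: mult_exp_exp)
    have "2 * C * exp (b\<^sup>2 / (2 * (theta * d))) * V d =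
      2 * C * ?G * ((1 / d) ^ (K + 2) * (exp (b\<^sup>2 / (2 * (theta * d))) * exp (- c2 / d)))"
      unfolding V_def by (simp only: mult_ac)
    also have "\<dots> = 2 * C * ?G * ((1 / d) ^ (K + 3) * exp (- g / d)) * d"
      unfolding e q by (simp only: mult_ac)
    also have "\<dots> \<le> W * d"
      unfolding W_def using d C C0 gaussian_moment_integral_nonneg
      by (intro mult_right_mono mult_left_mono p mult_nonneg_nonneg) auto
    finally show ?thesis using main[OF d] by linarith
  qed
  define d where "d = min d0 (c3 / (2 * (W + 1)))"
  have d: "0 < d" "d \<le> d0" using d0 c3 W by (auto simp: d_def)
  have "W * d \<le> (W + 1) * (c3 / (2 * (W + 1)))" using W d by (intro mult_mono) (auto simp: d_def)
  also have "\<dots> = c3 / 2" using W by (simp add: field_simps)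
  finally show False using lin[OF d] c3 by linarith
qed

end

section \<open>Zeros on the critical line\<close>

lemma super_exp_decay_add_cmult:
  assumes "super_exp_decay a" "super_exp_decay b"
  shows "super_exp_decay (\<lambda>u. a u + c * b u)"
    and "super_exp_decay.laplace (\<lambda>u. a u + c * b u) z = super_exp_decay.laplace a z + c * super_exp_decay.laplace b z"
proof -
  interpret a: super_exp_decay a by fact
  interpret b: super_exp_decay b by fact
  show ab: "super_exp_decay (\<lambda>u. a u + c * b u)"
  proof
    show "(\<lambda>u. a u + c * b u) \<in> borel_measurable borel" by measurable
    fix A :: real
    show "integrable lborel (\<lambda>t. exp (A * \<bar>t\<bar>) * norm (a t + c * b t))"
    proof (rule Bochner_Integration.integrable_bound)
      show "integrable lborel (\<lambda>t. exp (A * \<bar>t\<bar>) * norm (a t) + norm c * (exp (A * \<bar>t\<bar>) * norm (b t)))"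
        by (intro Bochner_Integration.integrable_add integrable_mult_right a.int b.int)
      show "AE t in lborel. norm (exp (A * \<bar>t\<bar>) * norm (a t + c * b t)) \<le> norm (exp (A * \<bar>t\<bar>) * norm (a t) + norm c * (exp (A * \<bar>t\<bar>) * norm (b t)))"
      proof (rule AE_I2)
        fix t :: real
        have "norm (a t + c * b t) \<le> norm (a t) + norm c * norm (b t)"
          using norm_triangle_ineq[of "a t" "c * b t"] by (simp add: norm_mult)
        then have "exp (A * \<bar>t\<bar>) * norm (a t + c * b t) \<le> exp (A * \<bar>t\<bar>) * (norm (a t) + norm c * norm (b t))"
          by (rule mult_left_mono) simp
        then show "norm (exp (A * \<bar>t\<bar>) * norm (a t + c * b t)) \<le> norm (exp (A * \<bar>t\<bar>) * norm (a t) + norm c * (exp (A * \<bar>t\<bar>) * norm (b t)))"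
          by (simp add: abs_mult algebra_simps)
      qed
    qed measurable
  qed
  have "(\<integral>u. (a u + c * b u) * exp (z * of_real u) \<partial>lborel) = (\<integral>u. a u * exp (z * of_real u) + c * (b u * exp (z * of_real u)) \<partial>lborel)"
    by (intro Bochner_Integration.integral_cong refl) (simp add: algebra_simps)
  also have "\<dots> = (\<integral>u. a u * exp (z * of_real u) \<partial>lborel) + (\<integral>u. c * (b u * exp (z * of_real u)) \<partial>lborel)"
    by (intro Bochner_Integration.integral_add integrable_mult_right a.integrable_exp b.integrable_exp)
  finally show "super_exp_decay.laplace (\<lambda>u. a u + c * b u) z = a.laplace z + c * b.laplace z"
    unfolding super_exp_decay.laplace_def[OF ab] a.laplace_def b.laplace_def by simp
qed

text \<open>Orders add, and the factor \<open>phi\<close> has order 0 where it does not vanish; a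
  nonzero value of each factor keeps both from vanishing identically.\<close>

lemma zorder_mult_shift:
  fixes phi Phi :: "complex \<Rightarrow> complex"
  assumes hol: "phi holomorphic_on UNIV" "Phi holomorphic_on UNIV" and nz: "phi s \<noteq> 0" "Phi b \<noteq> 0"
  shows "zorder (\<lambda>s. phi s * Phi (s - c)) s = zorder Phi (s - c)"
proof -
  have "(\<lambda>s. Phi (s - c)) holomorphic_on UNIV"
    by (rule holomorphic_on_compose_gen[OF _ hol(2), unfolded o_def]) (auto intro!: holomorphic_intros)
  then have h: "phi analytic_on {s}" "(\<lambda>s. Phi (s - c)) analytic_on {s}"
    using hol(1) by (auto simp: analytic_on_holomorphic)
  have "\<forall>\<^sub>F w in at s. phi w \<noteq> 0 \<and> w \<in> UNIV"
    by (rule non_zero_neighbour_alt[OF hol(1) open_UNIV connected_UNIV UNIV_I UNIV_I nz(1)])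
  moreover have "\<forall>\<^sub>F w in at s. Phi (w - c) \<noteq> 0 \<and> w \<in> UNIV"
    by (rule non_zero_neighbour_alt[OF \<open>(\<lambda>s. Phi (s - c)) holomorphic_on UNIV\<close> open_UNIV connected_UNIV UNIV_I UNIV_I, of "b + c"])
      (use nz(2) in simp)
  ultimately have "\<forall>\<^sub>F w in at s. phi w * Phi (w - c) \<noteq> 0" by eventually_elim simp
  then have "zorder (\<lambda>s. phi s * Phi (s - c)) s = zorder phi s + zorder (\<lambda>s. Phi (s - c)) s"
    by (rule zorder_times_analytic[OF h])
  also have "zorder phi s = 0" by (rule zorder_eq_0I[OF h(1) nz(1)])
  also have "zorder (\<lambda>s. Phi (s - c)) s = zorder Phi (s - c)"
    by (subst (1 2) zorder_shift) (simp add: algebra_simps)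
  finally show ?thesis by simp
qed

lemma rGamma_nonzero_right_half_plane: "Re s > 0 \<Longrightarrow> rGamma (s :: complex) \<noteq> 0"
  by (rule rGamma_nonzero) (auto elim!: nonpos_Ints_cases)

theorem theorem1p1:
  fixes k N :: nat and f :: "complex \<Rightarrow> complex" and \<eta> :: complex
    and F :: "complex \<Rightarrow> complex"
  assumes "k \<ge> 1"
    and "N > 0" and "\<exists>m. N = m ^ 2"
    and "f \<in> half_cusp_forms k (4 * N)"
    and "(\<forall>n\<ge>1. Im (fourier_coeff f n) = 0) \<or> (\<forall>n\<ge>1. Re (fourier_coeff f n) = 0)"
    and "\<eta> = 1 \<or> \<eta> = - 1"
    and "F = (\<lambda>s. L_function f s + \<eta> * L_function (fricke k (4 * N) f) s)"
    and "\<exists>s. F s \<noteq> 0"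
  shows "\<exists>d>0. Limsup at_top
           (\<lambda>T::real. ereal (real (odd_zero_count F (real k / 2 + 1 / 4) T) / T powr (1 / 2)))
         > ereal d"
proof -
  interpret half_integral_cusp_form k "4 * N" f
    using assms by unfold_locales auto
  obtain m where m: "N = m\<^sup>2" using assms(3) by blast
  \<comment> \<open>Here the square hypothesis enters: 4 N = c^2 makes the limiting cusps 1/c and
    -1/c rational.\<close>
  define c where "c = 2 * m"
  have c: "4 * N = c\<^sup>2" "c > 0" using assms(2) by (auto simp: c_def m power_mult_distrib)
  define e :: real where "e = (if \<eta> = 1 then 1 else - 1)"
  have e: "e = 1 \<or> e = - 1" "\<eta> = of_real e" using assms(6) by (auto simp: e_def)
  define Psi where "Psi = (\<lambda>z. P z + \<eta> * P (- z))"
  have neg: "P (- of_real u) = P (of_real (- u))" for u by simp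
  from P_strip_bound obtain C1 where C1: "C1 \<ge> 0" "\<And>d z. 0 < d \<Longrightarrow> d \<le> 1 \<Longrightarrow> \<bar>Im z\<bar> \<le> pi / 2 - d \<Longrightarrow>
     norm (P z) \<le> C1 * (1 / d) ^ (k + 1) * exp ((real k + 1 + p) * \<bar>Re z\<bar>)" by blast
  let ?c0 = "pi / (432 * real c * real (4 * N))"
  from P_cusp_decay[OF c] obtain C2 where C2: "C2 \<ge> 0"
    "\<And>d v. 0 < d \<Longrightarrow> d \<le> 1 / (216 * real c) \<Longrightarrow> \<bar>v\<bar> \<le> d \<Longrightarrow>
       norm (P (of_real v + \<i> * of_real (pi / 2 - d))) \<le> C2 * (1 / d) ^ (k + 1) * exp (- ?c0 / d)"
    "\<And>d v. 0 < d \<Longrightarrow> d \<le> 1 / (216 * real c) \<Longrightarrow> \<bar>v\<bar> \<le> d \<Longrightarrow>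
       norm (P (- (of_real v + \<i> * of_real (pi / 2 - d)))) \<le> C2 * (1 / d) ^ (k + 1) * exp (- ?c0 / d)"
    by blast
  have nPsi: "norm (Psi z) \<le> norm (P z) + norm (P (- z))" for z
    using norm_triangle_ineq[of "P z" "\<eta> * P (- z)"] assms(6) by (auto simp: Psi_def norm_mult)
  have Psi_decay: "super_exp_decay (\<lambda>u. Psi (of_real u))"
    unfolding Psi_def by (rule super_exp_decay_add_cmult(1)[OF super_exp_decay_P])
  \<comment> \<open>The factor 2 accounts for the two terms of \<open>Psi\<close>; the sum C1 + C2
    lets one constant serve the strip bound and the cusp bound.\<close>
  interpret S: sign_change_setup Psi e "real k + 1 + p" "2 * (C1 + C2)" ?c0 "1 / (216 * real c)" "k + 1"
  proof
    have "(\<lambda>z. P (- z)) holomorphic_on {z. \<bar>Im z\<bar> < pi / 2}"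
      by (rule holomorphic_on_compose_gen[OF _ P_holomorphic, unfolded o_def]) (auto intro!: holomorphic_intros)
    then show "Psi holomorphic_on {z. \<bar>Im z\<bar> < pi / 2}"
      unfolding Psi_def by (intro holomorphic_intros P_holomorphic)
    show "(\<lambda>u. Psi (of_real u)) \<in> borel_measurable borel"
      "integrable lborel (\<lambda>t. exp (A * \<bar>t\<bar>) * norm (Psi (of_real t)))" for A
      using Psi_decay by (auto simp: super_exp_decay_def)
    show "e = 1 \<or> e = - 1" by (rule e(1))
    show "Psi (- of_real u) = of_real e * Psi (of_real u)" for u
      using e(1) by (auto simp: Psi_def e(2))
    show "(\<forall>u. Im (Psi (of_real u)) = 0) \<or> (\<forall>u. Re (Psi (of_real u)) = 0)"
      using P_of_real_real_or_imaginary[OF assms(5)]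
      by (auto simp: Psi_def e(2) neg simp del: of_real_minus)
    show "real k + 1 + p \<ge> 0" using p_pos by simp
    show "2 * (C1 + C2) \<ge> 0" using C1(1) C2(1) by simp
    show "?c0 > 0" using c(2) assms(2) by simp
    show "0 < 1 / (216 * real c)" "1 / (216 * real c) \<le> 1" using c(2) by auto
    show "norm (Psi z) \<le> 2 * (C1 + C2) * (1 / d) ^ (k + 1) * exp ((real k + 1 + p) * \<bar>Re z\<bar>)"
      if "0 < d" "d \<le> 1" "\<bar>Im z\<bar> \<le> pi / 2 - d" for d z
    proof -
      have "norm (Psi z) \<le> 2 * (C1 * (1 / d) ^ (k + 1) * exp ((real k + 1 + p) * \<bar>Re z\<bar>))"
        using nPsi[of z] C1(2)[OF that] C1(2)[OF that(1,2), of "- z"] that(3) by simp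
      also have "\<dots> \<le> 2 * ((C1 + C2) * (1 / d) ^ (k + 1) * exp ((real k + 1 + p) * \<bar>Re z\<bar>))"
        using C2(1) that by (intro mult_left_mono mult_right_mono) auto
      finally show ?thesis by (simp only: mult.assoc)
    qed
    show "norm (Psi (of_real v + \<i> * of_real (pi / 2 - d))) \<le> 2 * (C1 + C2) * (1 / d) ^ (k + 1) * exp (- ?c0 / d)"
      if "0 < d" "d \<le> 1 / (216 * real c)" "\<bar>v\<bar> \<le> d" for d v
    proof -
      have "norm (Psi (of_real v + \<i> * of_real (pi / 2 - d))) \<le> 2 * (C2 * (1 / d) ^ (k + 1) * exp (- ?c0 / d))"
        using nPsi[of "of_real v + \<i> * of_real (pi / 2 - d)"] C2(2)[OF that] C2(3)[OF that] by linarith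
      also have "\<dots> \<le> 2 * ((C1 + C2) * (1 / d) ^ (k + 1) * exp (- ?c0 / d))"
        using C1(1) that by (intro mult_left_mono mult_right_mono) auto
      finally show ?thesis by (simp only: mult.assoc)
    qed
  qed
  define phi where "phi = (\<lambda>s. of_real (2 * pi * X) powr s * rGamma s :: complex)"
  have phi_hol: "phi holomorphic_on UNIV" unfolding phi_def by (intro holomorphic_intros)
  have phi_nz: "phi s \<noteq> 0" if "Re s > 0" for s
    using rGamma_nonzero_right_half_plane[OF that] X_pos by (simp add: phi_def)
  have Phi: "S.Phi z = super_exp_decay.laplace (\<lambda>u. P (of_real u)) z + \<eta> * super_exp_decay.laplace (\<lambda>u. P (- of_real u)) z" for z
    unfolding S.Phi_def unfolding Psi_def by (rule super_exp_decay_add_cmult(2)[OF super_exp_decay_P])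
  \<comment> \<open>Both L-functions carry the same prefactor \<open>phi\<close>, which has no zero
    for Re s > 0, in particular on the line Re s = p.\<close>
  have F: "F = (\<lambda>s. phi s * S.Phi (s - of_real p))"
    unfolding assms(7) L_function_P Phi phi_def by (simp add: algebra_simps)
  have nz: "\<exists>z. S.Phi z \<noteq> 0" using assms(8) unfolding F by auto
  then obtain b where b: "S.Phi b \<noteq> 0" by blast
  let ?Z = "\<lambda>T. {s. Re s = p \<and> 0 \<le> Im s \<and> Im s \<le> T \<and> F s = 0 \<and> odd (zorder F s)}"
  have count: "card (S.odd_zeros \<inter> {..T}) \<le> odd_zero_count F p T" for T
  proof -
    have "?Z T \<subseteq> (\<lambda>t. of_real p + \<i> * of_real t) ` {t. 0 \<le> t \<and> t \<le> T \<and> S.Phi (\<i> * of_real t) = 0}"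
    proof
      fix s assume s: "s \<in> ?Z T"
      then have se: "s = of_real p + \<i> * of_real (Im s)" by (auto simp: complex_eq_iff)
      have "phi s \<noteq> 0" using s p_pos by (intro phi_nz) auto
      then have "S.Phi (s - of_real p) = 0" using s by (auto simp: F)
      moreover have "s - of_real p = \<i> * of_real (Im s)" using se by (metis add_diff_cancel_left')
      ultimately show "s \<in> (\<lambda>t. of_real p + \<i> * of_real t) ` {t. 0 \<le> t \<and> t \<le> T \<and> S.Phi (\<i> * of_real t) = 0}"
        using s se by (intro image_eqI[of _ _ "Im s"]) auto
    qed
    \<comment> \<open>Finiteness is essential to the comparison, since \<open>card\<close> of an
      infinite set is 0.\<close>
    then have fin: "finite (?Z T)" by (rule finite_subset) (intro finite_imageI S.finite_zeros[OF nz])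
    have "(\<lambda>t. of_real p + \<i> * of_real t) ` (S.odd_zeros \<inter> {..T}) \<subseteq> ?Z T"
    proof (rule image_subsetI)
      fix t assume t: "t \<in> S.odd_zeros \<inter> {..T}"
      let ?s = "of_real p + \<i> * of_real t"
      have "phi ?s \<noteq> 0" using p_pos by (intro phi_nz) simp
      then have "zorder F ?s = zorder S.Phi (\<i> * of_real t)"
        unfolding F using zorder_mult_shift[OF phi_hol S.Phi_holomorphic _ b, of ?s "of_real p"] by simp
      then show "?s \<in> ?Z T" using t by (simp add: S.odd_zeros_def F)
    qed
    then have "card ((\<lambda>t. of_real p + \<i> * of_real t) ` (S.odd_zeros \<inter> {..T})) \<le> card (?Z T)"
      by (rule card_mono[OF fin])
    moreover have "inj_on (\<lambda>t. of_real p + \<i> * of_real t) (S.odd_zeros \<inter> {..T})" by (auto simp: inj_on_def)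
    ultimately show ?thesis by (simp add: card_image odd_zero_count_def)
  qed
  \<comment> \<open>This makes the left side of \<open>small\<close> equal to c2/2, half of what is
    allowed.\<close>
  define D where "D = sqrt (S.c2 * S.theta) / (2 * pi + 1)"
  have D: "D > 0" using S.c2 S.theta(1) by (auto simp: D_def intro!: divide_pos_pos add_pos_pos)
  have "(2 * pi + 1) * D = sqrt (S.c2 * S.theta)"
    using pi_gt_zero by (simp add: D_def add_pos_pos less_imp_neq[symmetric])
  then have small: "((2 * pi + 1) * D)\<^sup>2 / (2 * S.theta) < S.c2"
    using S.c2 S.theta(1) by (simp add: field_simps)
  have pk: "real k / 2 + 1 / 4 = p" by (simp add: p_def)
  show ?thesis
  proof (intro exI[of _ "D / 2"] conjI)
    show "D / 2 > 0" using D by simp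
    show "ereal (D / 2) < Limsup at_top (\<lambda>T. ereal (real (odd_zero_count F (real k / 2 + 1 / 4) T) / T powr (1 / 2)))"
    proof (rule ccontr)
      assume "\<not> ?thesis"
      then have "Limsup at_top (\<lambda>T. ereal (real (odd_zero_count F p T) / T powr (1 / 2))) \<le> ereal (D / 2)"
        unfolding pk by simp
      also have "\<dots> < ereal D" using D by simp
      finally have "\<forall>\<^sub>F T in at_top. ereal (real (odd_zero_count F p T) / T powr (1 / 2)) < ereal D"
        by (rule Limsup_lessD)
      then obtain T1 where T1: "\<And>T. T \<ge> T1 \<Longrightarrow> real (odd_zero_count F p T) / T powr (1 / 2) < D"
        by (auto simp: eventually_at_top_linorder)
      have "max 1 T1 > 0" by (simp add: less_max_iff_disj)
      then obtain T where T: "T \<ge> max 1 T1" "real (card (S.odd_zeros \<inter> {..T})) > D * sqrt T"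
        using S.many_odd_zeros[OF nz D small] by blast
      have "real (odd_zero_count F p T) < D * T powr (1 / 2)"
        using T1[of T] T(1) by (simp add: divide_less_eq)
      then show False using T count[of T] by (simp add: powr_half_sqrt)
    qed
  qed
qed

end
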